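(* Let $I \subseteq [m]\times[r]$, $J\subseteq[n]\times[r]$ and let $\mathcal{P}$ be the collection of equivalence classes of rank-one supports. If the representative rank-one supports are pairwise disjoint, i.e. $\mathcal{S}_P \cap \mathcal{S}_{P'} = \emptyset$ for all distinct $P,P'\in\mathcal{P}$, then (FSMF) with data $(A,I,J)$ is tractable (an optimal solution can be computed in polynomial time) for every $A\in\mathbb{R}^{m\times n}$.
   Context: For $p\in\mathbb{N}$, $[p]=\{1,\dots,p\}$; $\|\cdot\|$ is the Frobenius norm, $\mathrm{supp}(M)=\{(i,j):M_{i,j}\neq0\}$. (FSMF) with data $A\in\mathbb{R}^{m\times n}$, $I\subseteq[m]\times[r]$, $J\subseteq[n]\times[r]$: minimize $L(X,Y)=\|A-XY^\top\|^2$ over $X\in\mathbb{R}^{m\times r}$, $Y\in\mathbb{R}^{n\times r}$ with $\mathrm{supp}(X)\subseteq I$, $\mathrm{supp}(Y)\subseteq J$. For $k\in[r]$ the $k$-th rank-one support is $\mathcal{S}_k=\{i:(i,k)\in I\}\times\{j:(j,k)\in J\}\subseteq[m]\times[n]$. Define the equivalence relation $k\sim l$ on $[r]$ iff $\mathcal{S}_k=\mathcal{S}_l$ (equivalently, columns $k$ and $l$ of $I$ and of $J$ coincide); $\mathcal{P}$ is the set of its equivalence classes, and for $P\in\mathcal{P}$, $\mathcal{S}_P$ denotes the common value of $\mathcal{S}_k$, $k\in P$. *)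

theory Defs
  imports
    "HOL-Library.Disjoint_Sets"
    "HOL-Computational_Algebra.Polynomial"
    "Jordan_Normal_Form.Matrix"
begin

section \<open>Matrix factorization with fixed support\<close>

text \<open>
  Matrix indices start at 0, as in \<^theory>\<open>Jordan_Normal_Form.Matrix\<close>: the index set
  \<open>[p] = {1, \<dots>, p}\<close> is rendered as \<open>{..<p}\<close>.
\<close>

definition frob_norm :: "real mat \<Rightarrow> real" where
  "frob_norm M = sqrt (\<Sum>i<dim_row M. \<Sum>j<dim_col M. (M $$ (i, j))\<^sup>2)"

definition mat_supp :: "real mat \<Rightarrow> (nat \<times> nat) set" where
  "mat_supp M = {(i, j). i < dim_row M \<and> j < dim_col M \<and> M $$ (i, j) \<noteq> 0}"

definition fsmf_loss :: "real mat \<Rightarrow> real mat \<Rightarrow> real mat \<Rightarrow> real" where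
  "fsmf_loss A X Y = (frob_norm (A - X * transpose_mat Y))\<^sup>2"

definition fsmf_feasible ::
  "nat \<Rightarrow> nat \<Rightarrow> nat \<Rightarrow> (nat \<times> nat) set \<Rightarrow> (nat \<times> nat) set \<Rightarrow> real mat \<Rightarrow> real mat \<Rightarrow> bool" where
  "fsmf_feasible m n r I J X Y \<longleftrightarrow>
     X \<in> carrier_mat m r \<and> Y \<in> carrier_mat n r \<and> mat_supp X \<subseteq> I \<and> mat_supp Y \<subseteq> J"

definition fsmf_optimal ::
  "nat \<Rightarrow> nat \<Rightarrow> nat \<Rightarrow> real mat \<Rightarrow> (nat \<times> nat) set \<Rightarrow> (nat \<times> nat) set \<Rightarrow>
   real mat \<Rightarrow> real mat \<Rightarrow> bool" where
  "fsmf_optimal m n r A I J X Y \<longleftrightarrow>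
     is_arg_min (\<lambda>(X', Y'). fsmf_loss A X' Y') (\<lambda>(X', Y'). fsmf_feasible m n r I J X' Y') (X, Y)"

definition rank_one_supp ::
  "(nat \<times> nat) set \<Rightarrow> (nat \<times> nat) set \<Rightarrow> nat \<Rightarrow> (nat \<times> nat) set" where
  "rank_one_supp I J k = {i. (i, k) \<in> I} \<times> {j. (j, k) \<in> J}"

definition supp_equiv ::
  "nat \<Rightarrow> (nat \<times> nat) set \<Rightarrow> (nat \<times> nat) set \<Rightarrow> (nat \<times> nat) set" where
  "supp_equiv r I J = {(k, l). k < r \<and> l < r \<and> rank_one_supp I J k = rank_one_supp I J l}"

definition supp_classes ::
  "nat \<Rightarrow> (nat \<times> nat) set \<Rightarrow> (nat \<times> nat) set \<Rightarrow> nat set set" where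
  "supp_classes r I J = {..<r} // supp_equiv r I J"

definition class_supp ::
  "(nat \<times> nat) set \<Rightarrow> (nat \<times> nat) set \<Rightarrow> nat set \<Rightarrow> (nat \<times> nat) set" where
  "class_supp I J P = the_elem (rank_one_supp I J ` P)"

lemma equiv_supp_equiv: "equiv {..<r} (supp_equiv r I J)"
  by (auto simp: equiv_def supp_equiv_def refl_on_def sym_def trans_def)

lemma class_supp_eq:
  assumes "P \<in> supp_classes r I J" "k \<in> P"
  shows "class_supp I J P = rank_one_supp I J k"
proof -
  have "rank_one_supp I J ` P = {rank_one_supp I J k}"
    using assms by (fastforce simp: supp_classes_def quotient_def supp_equiv_def)
  then show ?thesis by (simp add: class_supp_def)
qed


section \<open>Machine model\<close>

text \<open>
  Programs of a real random access machine in the style of Blum, Shub and Smale: registers for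
  natural numbers (used as counters and addresses; only addition and truncated subtraction) and
  two-dimensional arrays of exact real numbers, each operation at unit cost.  The only real
  constants are integers, so no information can be hidden in a program.

  Entries of an optimal factorization are in general not expressible by radicals in the entries
  of \<open>A\<close> (already for a single rank-one block, i.e. for the leading singular pair of a
  matrix), so no program over the four field operations and square roots computes them exactly.
  Calling the singular value decomposition a polynomial-time algorithm presupposes that
  eigenvalues, i.e. roots of univariate polynomials, are available.  The machine therefore has
  one more instruction: the largest real root of a univariate polynomial given by its list of
  coefficients, charged by the length of that list.
\<close>

datatype iexp =
    IConst nat
  | IVar nat
  | IAdd iexp iexp
  | ISub iexp iexp

datatype rexp =
    RConst int
  | REntry nat iexp iexp
  | RAdd rexp rexp
  | RSub rexp rexp
  | RMul rexp rexp
  | RDiv rexp rexp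

datatype bexp =
    ILess iexp iexp
  | RLess rexp rexp
  | BNot bexp
  | BAnd bexp bexp

text \<open>
  \<open>MaxRoot a i j b k d\<close> stores into entry \<open>(i, j)\<close> of array \<open>a\<close> the largest real root of the
  polynomial whose coefficients, from degree 0 to degree \<open>d\<close>, are in row \<open>k\<close> of array \<open>b\<close>.
\<close>

datatype com =
    Skip
  | IAssign nat iexp
  | RAssign nat iexp iexp rexp
  | MaxRoot nat iexp iexp nat iexp iexp
  | Seq com com
  | Cond bexp com com
  | Loop bexp com

record store =
  ireg :: "nat \<Rightarrow> nat"
  rarr :: "nat \<Rightarrow> nat \<Rightarrow> nat \<Rightarrow> real"

primrec ival :: "iexp \<Rightarrow> store \<Rightarrow> nat" where
  "ival (IConst c) s = c"
| "ival (IVar x) s = ireg s x"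
| "ival (IAdd e f) s = ival e s + ival f s"
| "ival (ISub e f) s = ival e s - ival f s"

primrec rval :: "rexp \<Rightarrow> store \<Rightarrow> real" where
  "rval (RConst c) s = of_int c"
| "rval (REntry a e f) s = rarr s a (ival e s) (ival f s)"
| "rval (RAdd e f) s = rval e s + rval f s"
| "rval (RSub e f) s = rval e s - rval f s"
| "rval (RMul e f) s = rval e s * rval f s"
| "rval (RDiv e f) s = rval e s / rval f s"

primrec bval :: "bexp \<Rightarrow> store \<Rightarrow> bool" where
  "bval (ILess e f) s \<longleftrightarrow> ival e s < ival f s"
| "bval (RLess e f) s \<longleftrightarrow> rval e s < rval f s"
| "bval (BNot b) s \<longleftrightarrow> \<not> bval b s"
| "bval (BAnd b c) s \<longleftrightarrow> bval b s \<and> bval c s"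

text \<open>The cost of an expression is its number of nodes.\<close>

primrec icost :: "iexp \<Rightarrow> nat" where
  "icost (IConst c) = 1"
| "icost (IVar x) = 1"
| "icost (IAdd e f) = 1 + icost e + icost f"
| "icost (ISub e f) = 1 + icost e + icost f"

primrec rcost :: "rexp \<Rightarrow> nat" where
  "rcost (RConst c) = 1"
| "rcost (REntry a e f) = 1 + icost e + icost f"
| "rcost (RAdd e f) = 1 + rcost e + rcost f"
| "rcost (RSub e f) = 1 + rcost e + rcost f"
| "rcost (RMul e f) = 1 + rcost e + rcost f"
| "rcost (RDiv e f) = 1 + rcost e + rcost f"

primrec bcost :: "bexp \<Rightarrow> nat" where
  "bcost (ILess e f) = 1 + icost e + icost f"
| "bcost (RLess e f) = 1 + rcost e + rcost f"
| "bcost (BNot b) = 1 + bcost b"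
| "bcost (BAnd b c) = 1 + bcost b + bcost c"

text \<open>The value is 0 for the zero polynomial and for polynomials without real roots.\<close>

definition largest_root :: "real poly \<Rightarrow> real" where
  "largest_root p = (if p \<noteq> 0 \<and> (\<exists>x. poly p x = 0) then Max {x. poly p x = 0} else 0)"

definition write_entry :: "store \<Rightarrow> nat \<Rightarrow> nat \<Rightarrow> nat \<Rightarrow> real \<Rightarrow> store" where
  "write_entry s a i j x =
     s\<lparr>rarr := (rarr s)(a := (rarr s a)(i := (rarr s a i)(j := x)))\<rparr>"

text \<open>\<open>exec c s t s'\<close>: started in \<open>s\<close>, program \<open>c\<close> halts in \<open>s'\<close> after \<open>t\<close> operations.\<close>

inductive exec :: "com \<Rightarrow> store \<Rightarrow> nat \<Rightarrow> store \<Rightarrow> bool" where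
  Skip: "exec Skip s 1 s"
| IAssign: "exec (IAssign x e) s (1 + icost e) (s\<lparr>ireg := (ireg s)(x := ival e s)\<rparr>)"
| RAssign: "exec (RAssign a e f g) s (1 + icost e + icost f + rcost g)
     (write_entry s a (ival e s) (ival f s) (rval g s))"
| MaxRoot: "exec (MaxRoot a e f b g h) s (1 + icost e + icost f + icost g + icost h + (ival h s + 1))
     (write_entry s a (ival e s) (ival f s)
        (largest_root (\<Sum>l\<le>ival h s. monom (rarr s b (ival g s) l) l)))"
| Seq: "exec c s t s' \<Longrightarrow> exec d s' u s'' \<Longrightarrow> exec (Seq c d) s (t + u) s''"
| CondTrue: "bval b s \<Longrightarrow> exec c s t s' \<Longrightarrow> exec (Cond b c d) s (1 + bcost b + t) s'"
| CondFalse: "\<not> bval b s \<Longrightarrow> exec d s t s' \<Longrightarrow> exec (Cond b c d) s (1 + bcost b + t) s'"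
| LoopFalse: "\<not> bval b s \<Longrightarrow> exec (Loop b c) s (1 + bcost b) s"
| LoopTrue: "bval b s \<Longrightarrow> exec c s t s' \<Longrightarrow> exec (Loop b c) s' u s'' \<Longrightarrow>
     exec (Loop b c) s (1 + bcost b + t + u) s''"

inductive_cases exec_SkipE: "exec Skip s t s'"
  and exec_IAssignE: "exec (IAssign x e) s t s'"
  and exec_RAssignE: "exec (RAssign a e f g) s t s'"
  and exec_MaxRootE: "exec (MaxRoot a e f b g h) s t s'"
  and exec_SeqE: "exec (Seq c d) s t s'"
  and exec_CondE: "exec (Cond b c d) s t s'"
  and exec_LoopE: "exec (Loop b c) s t s'"

lemma exec_deterministic:
  "exec c s t s' \<Longrightarrow> exec c s u s'' \<Longrightarrow> u = t \<and> s'' = s'"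
proof (induction arbitrary: u s'' rule: exec.induct)
  case (Skip s)
  then show ?case by (rule exec_SkipE) simp
next
  case (IAssign x e s)
  then show ?case by (rule exec_IAssignE) simp
next
  case (RAssign a e f g s)
  then show ?case by (rule exec_RAssignE) simp
next
  case (MaxRoot a e f b g h s)
  then show ?case by (rule exec_MaxRootE) simp
next
  case (Seq c s t s1 d u1 s2)
  show ?case
  proof (rule exec_SeqE[OF Seq.prems])
    fix t' s1' u'
    assume *: "u = t' + u'" "exec c s t' s1'" "exec d s1' u' s''"
    from Seq.IH(1)[OF *(2)] *(3) have "exec d s1 u' s''" by simp
    from Seq.IH(2)[OF this] Seq.IH(1)[OF *(2)] *(1) show ?thesis by simp
  qed
next
  case (CondTrue b s c t s1 d)
  show ?case
  proof (rule exec_CondE[OF CondTrue.prems])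
    fix t'
    assume *: "u = Suc (bcost b + t')" "exec c s t' s''"
    from CondTrue.IH[OF *(2)] *(1) show ?thesis by simp
  next
    assume "\<not> bval b s"
    with CondTrue.hyps(1) show ?thesis by simp
  qed
next
  case (CondFalse b s d t s1 c)
  show ?case
  proof (rule exec_CondE[OF CondFalse.prems])
    assume "bval b s"
    with CondFalse.hyps(1) show ?thesis by simp
  next
    fix t'
    assume *: "u = Suc (bcost b + t')" "exec d s t' s''"
    from CondFalse.IH[OF *(2)] *(1) show ?thesis by simp
  qed
next
  case (LoopFalse b s c)
  show ?case
    by (rule exec_LoopE[OF LoopFalse.prems]) (use LoopFalse.hyps in simp_all)
next
  case (LoopTrue b s c t s1 u1 s2)
  show ?case
  proof (rule exec_LoopE[OF LoopTrue.prems])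
    assume "\<not> bval b s"
    with LoopTrue.hyps(1) show ?thesis by simp
  next
    fix t' s1' u'
    assume *: "u = Suc (bcost b + t' + u')" "exec c s t' s1'" "exec (Loop b c) s1' u' s''"
    from LoopTrue.IH(1)[OF *(2)] *(3) have "exec (Loop b c) s1 u' s''" by simp
    from LoopTrue.IH(2)[OF this] LoopTrue.IH(1)[OF *(2)] *(1) show ?thesis by simp
  qed
qed


section \<open>Tractability\<close>

text \<open>
  Input: registers 0, 1, 2 hold \<open>m\<close>, \<open>n\<close>, \<open>r\<close>; arrays 0, 1, 2 hold \<open>A\<close> and the 0/1 indicator
  matrices of \<open>I\<close> and \<open>J\<close>.  Output: \<open>X\<close> in array 3 and \<open>Y\<close> in array 4.
\<close>

definition fsmf_input ::
  "nat \<Rightarrow> nat \<Rightarrow> nat \<Rightarrow> real mat \<Rightarrow> (nat \<times> nat) set \<Rightarrow> (nat \<times> nat) set \<Rightarrow> store" where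
  "fsmf_input m n r A I J =
     \<lparr>ireg = (\<lambda>_. 0)(0 := m, 1 := n, 2 := r),
      rarr = (\<lambda>_ _ _. 0)
        (0 := (\<lambda>i j. if i < m \<and> j < n then A $$ (i, j) else 0),
         1 := (\<lambda>i k. if (i, k) \<in> I then 1 else 0),
         2 := (\<lambda>j k. if (j, k) \<in> J then 1 else 0))\<rparr>"

definition read_mat :: "store \<Rightarrow> nat \<Rightarrow> nat \<Rightarrow> nat \<Rightarrow> real mat" where
  "read_mat s a p q = mat p q (\<lambda>(i, j). rarr s a i j)"

type_synonym fsmf_data =
  "nat \<times> nat \<times> nat \<times> real mat \<times> (nat \<times> nat) set \<times> (nat \<times> nat) set"

text \<open>
  A set of problem data \<open>(m, n, r, A, I, J)\<close> is tractable if a single program computes an optimal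
  solution for all of them in a number of operations polynomial in the dimensions.  In
  particular an optimal solution exists for each of them.
\<close>

definition fsmf_tractable :: "fsmf_data set \<Rightarrow> bool" where
  "fsmf_tractable D \<longleftrightarrow>
     (\<exists>(c :: com) (p :: nat poly). \<forall>(m, n, r, A, I, J) \<in> D.
        \<exists>t s. exec c (fsmf_input m n r A I J) t s \<and> t \<le> poly p (m + n + r) \<and>
              fsmf_optimal m n r A I J (read_mat s 3 m r) (read_mat s 4 n r))"

end

theory Submission
  imports Defs "HOL-Analysis.Function_Topology"
begin

text \<open>
  Greedy deflation is optimal: process the columns in order; for column \<open>k\<close>, mask the current
  residual by \<open>S\<^sub>k\<close> and take a leading singular pair of the result.  Columns with other, hence
  disjoint, supports do not interfere, and within a class the squared norm removed by the
  successive pairs bounds what any factorization of the same width can remove (Eckart--Young).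

  A leading right singular vector of \<open>B\<close> is computed exactly as follows.  The Lanczos recursion for
  \<open>P \<mapsto> P G\<close>, \<open>G = B\<^sup>T B\<close>, started at \<open>B\<close>, reaches zero after \<open>d \<le> m n\<close> steps and
  yields the monic polynomial \<open>q\<close> of least degree with \<open>B q(G) = 0\<close>.  Its largest
  root \<open>\<lambda>\<close> is the largest eigenvalue of \<open>G\<close>: every nonzero eigenvalue is a root, and with
  \<open>q = (x - \<lambda>) h\<close> the matrix \<open>V = B h(G)\<close> is nonzero by minimality and satisfies \<open>V G = \<lambda> V\<close>,
  so that any nonzero row of \<open>V\<close> is an eigenvector.
\<close>

section \<open>Rank-constrained lower bound\<close>

text \<open>Two features of the machine shape the argument. It has no square roots, so singular
  vectors are never normalised: a pair of columns is \<open>v\<close> and B v / (v . v), with the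
  same product as the normalised pair. And it compares reals exactly, so the Lanczos recursion
  detects its own end. Minimality of the polynomial relative to the start \<open>B\<close> matters
  when the top eigenvalue is multiple: for the characteristic polynomial the quotient by one linear
  factor could vanish at \<open>G\<close>.

  Optimality does not go through a singular value decomposition. It uses only that each pair removes
  at least the maximum of |B u|^2 / |u|^2 from the squared norm. On vectors \<open>u\<close>
  orthogonal to the earlier right vectors of the class, the residual acts like the masked
  \<open>A\<close>, so the removed amounts bound the Rayleigh quotients of \<open>A\<close> on a
  decreasing chain of subspaces, and a dimension count covers every competitor. Disjointness enters
  twice: the mask hides earlier columns of other classes, and the decrease achieved by a feasible
  pair is a sum over the supports.\<close>

definition dotp :: "nat \<Rightarrow> (nat \<Rightarrow> real) \<Rightarrow> (nat \<Rightarrow> real) \<Rightarrow> real" where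
  "dotp n u v = (\<Sum>j<n. u j * v j)"

definition mvec :: "nat \<Rightarrow> (nat \<Rightarrow> nat \<Rightarrow> real) \<Rightarrow> (nat \<Rightarrow> real) \<Rightarrow> nat \<Rightarrow> real" where
  "mvec n A u = (\<lambda>i. \<Sum>j<n. A i j * u j)"

definition fro :: "nat \<Rightarrow> nat \<Rightarrow> (nat \<Rightarrow> nat \<Rightarrow> real) \<Rightarrow> real" where
  "fro m n A = (\<Sum>i<m. \<Sum>j<n. (A i j)\<^sup>2)"

section \<open>Inner products and orthogonal projection of rows\<close>

lemma dotp_commute: "dotp n u v = dotp n v u"
  by (simp add: dotp_def mult.commute)

lemma dotp_self_nonneg: "0 \<le> dotp n u u"
  by (simp add: dotp_def sum_nonneg)

lemma dotp_self_eq_0: "dotp n u u = 0 \<longleftrightarrow> (\<forall>j<n. u j = 0)"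
  by (auto simp: dotp_def sum_nonneg_eq_0_iff)

lemma dotp_diff_scaled: "dotp n u (\<lambda>j. v j - t * w j) = dotp n u v - t * dotp n u w"
  by (simp add: dotp_def algebra_simps sum_subtractf sum_distrib_left)

lemma dotp_combination:
  "dotp n u (\<lambda>j. \<Sum>k\<in>K. Y j k * c k) = (\<Sum>k\<in>K. dotp n u (\<lambda>j. Y j k) * c k)"
  by (simp add: dotp_def sum_distrib_left sum_distrib_right mult.assoc) (rule sum.swap)

lemma mvec_diff_scaled: "mvec n A (\<lambda>j. v j - t * w j) i = mvec n A v i - t * mvec n A w i"
  by (simp add: mvec_def algebra_simps sum_subtractf sum_distrib_left)

lemma mvec_add_scaled: "mvec n A (\<lambda>j. v j + t * w j) i = mvec n A v i + t * mvec n A w i"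
  by (simp add: mvec_def algebra_simps sum.distrib sum_distrib_left)

lemma mvec_sub_rank_one:
  "mvec n (\<lambda>i j. A i j - x i * y j) u i = mvec n A u i - x i * dotp n y u"
  by (simp add: mvec_def dotp_def algebra_simps sum_subtractf sum_distrib_left)

text \<open>The hypothesis allows \<open>t = 1 / dotp n w w\<close> and also \<open>t = 0\<close>,
  so that projecting \<open>u\<close> away from \<open>w\<close> needs no separate treatment of
  \<open>w = 0\<close>.\<close>

lemma dotp_sub_proj:
  assumes "t * t * dotp n w w = t"
  shows "dotp n (\<lambda>j. u j - t * dotp n u w * w j) (\<lambda>j. u j - t * dotp n u w * w j)
    = dotp n u u - t * (dotp n u w)\<^sup>2"
proof -
  define c where "c = t * dotp n u w"
  have "dotp n (\<lambda>j. u j - c * w j) (\<lambda>j. u j - c * w j)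
      = dotp n u u - 2 * c * dotp n u w + c\<^sup>2 * dotp n w w"
    by (simp add: dotp_def power2_eq_square algebra_simps sum_subtractf sum.distrib sum_distrib_left)
  also have "c\<^sup>2 * dotp n w w = (t * t * dotp n w w) * (dotp n u w)\<^sup>2"
    by (simp add: c_def power2_eq_square)
  also have "\<dots> = t * (dotp n u w)\<^sup>2" by (simp only: assms)
  finally show ?thesis by (simp add: c_def power2_eq_square)
qed

lemma fro_eq_dotp: "fro m n A = (\<Sum>i<m. dotp n (A i) (A i))"
  by (simp add: fro_def dotp_def power2_eq_square)

text \<open>Pythagoras row by row: entry \<open>i\<close> of \<open>mvec n A w\<close> is the inner
  product of row \<open>i\<close> with \<open>w\<close>, and every row is projected away from
  \<open>w\<close>.\<close>

lemma fro_sub_proj: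
  assumes "t * t * dotp n w w = t"
  shows "fro m n (\<lambda>i j. A i j - t * mvec n A w i * w j)
    = fro m n A - t * dotp m (mvec n A w) (mvec n A w)"
proof -
  have "mvec n A w i = dotp n (A i) w" for i by (simp add: mvec_def dotp_def)
  then show ?thesis
    by (simp add: fro_eq_dotp dotp_sub_proj[OF assms])
       (simp add: dotp_def power2_eq_square sum_subtractf sum_distrib_left)
qed

text \<open>Gaussian elimination, by induction on the equations: a nonzero coefficient
  \<open>a l k0\<close> eliminates the unknown \<open>k0\<close>, which leaves one equation and one
  unknown fewer.\<close>

lemma homogeneous_system_nontrivial:
  fixes a :: "'l \<Rightarrow> 'k \<Rightarrow> real"
  assumes "finite L" "finite K" "card L < card K"
  obtains c where "\<exists>k\<in>K. c k \<noteq> 0" "\<And>l. l \<in> L \<Longrightarrow> (\<Sum>k\<in>K. a l k * c k) = 0"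
proof -
  have "\<exists>c. (\<exists>k\<in>K. c k \<noteq> 0) \<and> (\<forall>l\<in>L. (\<Sum>k\<in>K. a l k * c k) = 0)"
    using assms
  proof (induction L arbitrary: K a rule: finite_induct)
    case empty
    then obtain k where "k \<in> K" by fastforce
    then show ?case by (intro exI[of _ "\<lambda>_. 1"]) auto
  next
    case (insert l L)
    show ?case
    proof (cases "\<forall>k\<in>K. a l k = 0")
      case True
      from insert.IH[of K a] insert.prems insert.hyps
      obtain c where "\<exists>k\<in>K. c k \<noteq> 0" "\<forall>l\<in>L. (\<Sum>k\<in>K. a l k * c k) = 0" by auto
      with True show ?thesis by (intro exI[of _ c]) auto
    next
      case False
      then obtain k0 where k0: "k0 \<in> K" "a l k0 \<noteq> 0" by blast
      define a' where "a' = (\<lambda>l' k. a l' k - a l' k0 * a l k / a l k0)"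
      from insert.IH[of "K - {k0}" a'] insert.prems insert.hyps k0 card_Diff_singleton[OF k0(1)]
      obtain c where c: "\<exists>k\<in>K - {k0}. c k \<noteq> 0"
        "\<forall>l\<in>L. (\<Sum>k\<in>K - {k0}. a' l k * c k) = 0" by (auto simp: less_diff_conv)
      define S where "S = (\<Sum>k\<in>K - {k0}. a l k * c k)"
      \<comment> \<open>The eliminated unknown is recovered from equation \<open>l\<close>.\<close>
      define d where "d = c(k0 := - S / a l k0)"
      have split: "(\<Sum>k\<in>K. a l' k * d k)
          = - a l' k0 * S / a l k0 + (\<Sum>k\<in>K - {k0}. a l' k * c k)" for l'
        using insert.prems k0 by (subst sum.remove[of K k0]) (auto simp: d_def)
      have "(\<Sum>k\<in>K. a l k * d k) = 0"
        using k0 by (simp add: split flip: S_def)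
      moreover have "(\<Sum>k\<in>K. a l' k * d k) = 0" if "l' \<in> L" for l'
      proof -
        have "0 = (\<Sum>k\<in>K - {k0}. a' l' k * c k)" using c that by simp
        also have "\<dots> = (\<Sum>k\<in>K - {k0}. a l' k * c k) - a l' k0 * S / a l k0"
          by (simp add: a'_def S_def algebra_simps sum_subtractf sum_distrib_left
              sum_divide_distrib)
        finally show ?thesis by (simp add: split)
      qed
      moreover have "\<exists>k\<in>K. d k \<noteq> 0" using c by (auto simp: d_def)
      ultimately show ?thesis by (intro exI[of _ d]) auto
    qed
  qed
  with that show ?thesis by blast
qed

text \<open>
  Some combination \<open>w\<close> of the columns of \<open>Y\<close> is orthogonal to \<open>y l\<close> for all \<open>l\<close> below the
  maximum \<open>b\<close> of the index set.  Projecting \<open>w\<close> away decreases \<open>\<parallel>A\<parallel>\<^sup>2\<close> by at most \<open>s b\<close> and makes one column of \<open>Y\<close>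
  redundant.  The factor \<open>t\<close> in the proof is \<open>1 / \<parallel>w\<parallel>\<^sup>2\<close>, and 0 in the degenerate case \<open>w = 0\<close>.
\<close>

lemma greedy_lower_bound:
  fixes P :: "nat set" and K :: "'k set"
  assumes "finite P" "finite K" "card K \<le> card P"
    and "\<And>k. k \<in> P \<Longrightarrow> 0 \<le> s k"
    and "\<And>k u. k \<in> P \<Longrightarrow> (\<And>l. l \<in> P \<Longrightarrow> l < k \<Longrightarrow> dotp n (y l) u = 0) \<Longrightarrow>
      dotp m (mvec n A u) (mvec n A u) \<le> s k * dotp n u u"
  shows "fro m n A - (\<Sum>k\<in>P. s k) \<le> fro m n (\<lambda>i j. A i j - (\<Sum>k\<in>K. X i k * Y j k))"
  using assms
proof (induction P arbitrary: K A X Y rule: finite_linorder_max_induct)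
  case empty
  then show ?case by simp
next
  case (insert b P)
  have bP: "b \<notin> P" using insert.hyps by auto
  show ?case
  proof (cases "card K \<le> card P")
    \<comment> \<open>The width already fits \<open>P\<close>; enlarging \<open>P\<close> by
      \<open>b\<close> only weakens the bound, because \<open>0 \<le> s b\<close>.\<close>
    case True
    have "fro m n A - (\<Sum>k\<in>P. s k) \<le> fro m n (\<lambda>i j. A i j - (\<Sum>k\<in>K. X i k * Y j k))"
    proof (rule insert.IH[OF insert.prems(1) True])
      fix k u assume k: "k \<in> P" and u: "\<And>l. l \<in> P \<Longrightarrow> l < k \<Longrightarrow> dotp n (y l) u = 0"
      show "dotp m (mvec n A u) (mvec n A u) \<le> s k * dotp n u u"
        by (rule insert.prems(4)) (use k u insert.hyps in \<open>auto dest: order.asym\<close>)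
    qed (use insert.prems in auto)
    moreover have "0 \<le> s b" using insert.prems by simp
    ultimately show ?thesis using insert.hyps bP by simp
  next
    case False
    \<comment> \<open>Here \<open>card P < card K\<close>: there is one equation for each
      \<open>y l\<close> and one unknown for each column of \<open>Y\<close>.\<close>
    obtain c where c: "\<exists>k\<in>K. c k \<noteq> 0"
      "\<And>l. l \<in> P \<Longrightarrow> (\<Sum>k\<in>K. dotp n (y l) (\<lambda>j. Y j k) * c k) = 0"
      using homogeneous_system_nontrivial[of P K "\<lambda>l k. dotp n (y l) (\<lambda>j. Y j k)"]
        insert.hyps insert.prems False by auto
    from c(1) obtain k0 where k0: "k0 \<in> K" "c k0 \<noteq> 0" by blast
    define w where "w = (\<lambda>j. \<Sum>k\<in>K. Y j k * c k)"
    define t where "t = 1 / dotp n w w"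
    have tt: "t * t * dotp n w w = t" by (simp add: t_def)
    have t0: "0 \<le> t" by (simp add: t_def dotp_self_nonneg)
    have wP: "dotp n (y l) w = 0" if "l \<in> P" for l
      using c(2)[OF that] by (simp add: w_def dotp_combination)
    define A' where "A' = (\<lambda>i j. A i j - t * mvec n A w i * w j)"
    define z where "z = (\<lambda>k. t * dotp n (\<lambda>j. Y j k) w)"
    \<comment> \<open>The columns of \<open>Y\<close> projected away from \<open>w\<close>. Their
      combination with coefficients \<open>c\<close> becomes zero, so column \<open>k0\<close>
      depends on the others, and \<open>X'\<close> redistributes its contribution.\<close>
    define Y' where "Y' = (\<lambda>j k. Y j k - z k * w j)"
    define M where "M = (\<lambda>i j. A i j - (\<Sum>k\<in>K. X i k * Y j k))"
    define X' where "X' = (\<lambda>i k. X i k - X i k0 * c k / c k0)"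
    have mv: "mvec n A' u i = mvec n A (\<lambda>j. u j - t * dotp n u w * w j) i" for u i
      by (simp only: A'_def mvec_sub_rank_one mvec_diff_scaled)
         (simp add: dotp_commute)
    have IH: "fro m n A' - (\<Sum>k\<in>P. s k)
        \<le> fro m n (\<lambda>i j. A' i j - (\<Sum>k\<in>K - {k0}. X' i k * Y' j k))"
    proof (rule insert.IH)
      show "card (K - {k0}) \<le> card P" using k0 insert.prems insert.hyps bP by simp
    next
      fix k u assume k: "k \<in> P" and u: "\<And>l. l \<in> P \<Longrightarrow> l < k \<Longrightarrow> dotp n (y l) u = 0"
      define u' where "u' = (\<lambda>j. u j - t * dotp n u w * w j)"
      have "mvec n A' u = mvec n A u'" by (rule ext) (simp only: mv u'_def)
      then have "dotp m (mvec n A' u) (mvec n A' u) = dotp m (mvec n A u') (mvec n A u')"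
        by simp
      also have "\<dots> \<le> s k * dotp n u' u'"
      proof (rule insert.prems(4))
        fix l assume "l \<in> insert b P" "l < k"
        then have "l \<in> P" "l < k" using k insert.hyps by (auto dest: order.asym)
        then show "dotp n (y l) u' = 0"
          by (simp add: u'_def dotp_diff_scaled u wP)
      qed (use k in simp)
      also have "dotp n u' u' \<le> dotp n u u"
        using t0 by (simp add: u'_def dotp_sub_proj[OF tt])
      then have "s k * dotp n u' u' \<le> s k * dotp n u u"
        using k insert.prems(3) by (intro mult_left_mono) auto
      finally show "dotp m (mvec n A' u) (mvec n A' u) \<le> s k * dotp n u u" .
    qed (use insert.prems in auto)
    have A'sq: "fro m n A' = fro m n A - t * dotp m (mvec n A w) (mvec n A w)"
      unfolding A'_def by (rule fro_sub_proj[OF tt])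
    \<comment> \<open>\<open>w\<close> is admissible for the index \<open>b\<close>: the elements of
      \<open>insert b P\<close> below \<open>b\<close> lie in \<open>P\<close>.\<close>
    have "dotp m (mvec n A w) (mvec n A w) \<le> s b * dotp n w w"
      by (rule insert.prems(4)) (use wP in auto)
    then have "t * dotp m (mvec n A w) (mvec n A w) \<le> s b * (t * dotp n w w)"
      using t0 by (metis mult.left_commute mult_left_mono)
    also have "\<dots> \<le> s b * 1"
      using insert.prems(3)[of b] by (intro mult_left_mono) (auto simp: t_def)
    finally have Aw: "t * dotp m (mvec n A w) (mvec n A w) \<le> s b" by simp
    \<comment> \<open>Projecting the rows of the error matrix \<open>M\<close> away from
      \<open>w\<close> does not increase its norm, and by \<open>MM\<close> the result is the error
      of a narrower factorization of \<open>A'\<close>.\<close>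
    have Msq: "fro m n (\<lambda>i j. M i j - t * mvec n M w i * w j) \<le> fro m n M"
      using t0 by (subst fro_sub_proj[OF tt]) (simp add: dotp_self_nonneg)
    have MM: "M i j - t * mvec n M w i * w j = A' i j - (\<Sum>k\<in>K - {k0}. X' i k * Y' j k)"
      if j: "j < n" for i j
    proof -
      have mM: "mvec n M w i = mvec n A w i - (\<Sum>k\<in>K. X i k * dotp n (\<lambda>j. Y j k) w)"
        by (simp add: M_def mvec_def dotp_def algebra_simps sum_subtractf sum_distrib_left)
           (rule sum.swap)
      have e1: "M i j - t * mvec n M w i * w j = A' i j - (\<Sum>k\<in>K. X i k * Y' j k)"
        unfolding mM by (simp add: M_def A'_def Y'_def z_def algebra_simps sum_subtractf sum_distrib_left
            sum_distrib_right)
      have "(\<Sum>k\<in>K. c k * z k) = t * (\<Sum>k\<in>K. dotp n w (\<lambda>j. Y j k) * c k)"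
        by (simp add: z_def sum_distrib_left dotp_commute mult_ac)
      also have "(\<Sum>k\<in>K. dotp n w (\<lambda>j. Y j k) * c k) = dotp n w w"
        by (subst (3) w_def) (simp add: dotp_combination)
      finally have "(\<Sum>k\<in>K. c k * z k) = t * dotp n w w" .
      moreover have "(\<Sum>k\<in>K. c k * Y' j k) = w j - (\<Sum>k\<in>K. c k * z k) * w j"
        by (simp add: Y'_def right_diff_distrib sum_subtractf sum_distrib_right mult.assoc)
           (simp add: w_def mult.commute)
      ultimately have "(\<Sum>k\<in>K. c k * Y' j k) = w j - t * dotp n w w * w j" by simp
      also have "\<dots> = 0"
        using j dotp_self_eq_0[of n w] by (auto simp: t_def)
      finally have z: "c k0 * Y' j k0 = - (\<Sum>k\<in>K - {k0}. c k * Y' j k)"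
        using k0 insert.prems(1) by (simp add: sum.remove[of K k0])
      have "X i k0 * Y' j k0 = X i k0 / c k0 * (c k0 * Y' j k0)" using k0 by simp
      also have "\<dots> = - (\<Sum>k\<in>K - {k0}. X i k0 * c k / c k0 * Y' j k)"
        unfolding z by (simp add: sum_distrib_left mult_ac)
      finally have "(\<Sum>k\<in>K. X i k * Y' j k) = (\<Sum>k\<in>K - {k0}. X' i k * Y' j k)"
        using k0 insert.prems(1)
        by (simp add: sum.remove[of K k0] X'_def algebra_simps sum_subtractf)
      with e1 show ?thesis by simp
    qed
    have "fro m n (\<lambda>i j. M i j - t * mvec n M w i * w j)
        = fro m n (\<lambda>i j. A' i j - (\<Sum>k\<in>K - {k0}. X' i k * Y' j k))"
      unfolding fro_def by (intro sum.cong refl) (simp add: MM)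
    with IH Msq A'sq Aw show ?thesis
      using insert.hyps bP by (simp add: M_def)
  qed
qed

text \<open>The decrease in squared norm dominates every Rayleigh quotient of B^T B. Being stated
  through the decrease and not through an eigenvalue, it can be summed over the columns by
  telescoping.\<close>

definition top_rank_one where
  "top_rank_one m n B x y \<longleftrightarrow> (\<forall>u. dotp m (mvec n B u) (mvec n B u)
     \<le> (fro m n B - fro m n (\<lambda>i j. B i j - x i * y j)) * dotp n u u)"

section \<open>Leading eigenvectors\<close>

text \<open>The form |B v|^2 attains its maximum on the unit sphere, and stationarity at a maximizer
  \<open>u\<close> in every direction \<open>v\<close> is the eigenvalue equation in weak
  form.\<close>

lemma exists_top_eigenvector:
  assumes "0 < n"
  obtains u \<mu> where "dotp n u u = 1"
    "\<And>v. dotp m (mvec n B v) (mvec n B v) \<le> \<mu> * dotp n v v"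
    "\<And>v. dotp m (mvec n B u) (mvec n B v) = \<mu> * dotp n u v"
proof -
  \<comment> \<open>Vectors are functions on all of \<open>nat\<close>. Pinning the coordinates from
    \<open>n\<close> on to 0 turns the cube into a product of compact sets.\<close>
  define C where "C = (PiE UNIV (\<lambda>j::nat. if j < n then {-1..1::real} else {0}))"
  define S where "S = C \<inter> {u. dotp n u u = 1}"
  define f where "f = (\<lambda>v. dotp m (mvec n B v) (mvec n B v))"
  have "compact C"
    unfolding C_def compactin_euclidean_iff[symmetric] euclidean_product_topology[symmetric]
    by (subst compactin_PiE) auto
  moreover have "closed {u. dotp n u u = 1}"
    unfolding dotp_def by (intro closed_Collect_eq continuous_intros) auto
  ultimately have "compact S" unfolding S_def by (rule compact_Int_closed)
  moreover have "(\<lambda>j. if j = 0 then 1 else 0) \<in> S"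
    using assms by (auto simp: S_def C_def dotp_def if_distrib[of "\<lambda>x. x * _"] cong: if_cong)
  moreover have "continuous_on S f"
    unfolding f_def dotp_def mvec_def
    by (intro continuous_intros continuous_on_subset[OF continuous_on_product_coordinates]) auto
  ultimately obtain u where u: "u \<in> S" "\<And>v. v \<in> S \<Longrightarrow> f v \<le> f u"
    using continuous_attains_sup[of S f] by blast
  define \<mu> where "\<mu> = f u"
  have uu: "dotp n u u = 1" using u by (simp add: S_def)
  have le: "f v \<le> \<mu> * dotp n v v" for v
  proof (cases "dotp n v v = 0")
    case True
    then have "f v = 0" by (auto simp: f_def dotp_def mvec_def dotp_self_eq_0[unfolded dotp_def])
    with True show ?thesis by simp
  next
    case False
    define c where "c = sqrt (dotp n v v)"
    have c: "c\<^sup>2 = dotp n v v" "c \<noteq> 0" using False by (auto simp: c_def dotp_self_nonneg)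
    define v' where "v' = (\<lambda>j. if j < n then v j / c else 0)"
    have v'1: "dotp n v' v' = 1"
      using c False by (simp add: dotp_def v'_def power2_eq_square flip: sum_divide_distrib)
    have "\<bar>v' j\<bar> \<le> 1" if "j < n" for j
    proof -
      have "(v' j)\<^sup>2 \<le> dotp n v' v'"
        unfolding dotp_def power2_eq_square using that by (intro member_le_sum) auto
      then show ?thesis using v'1 by (simp add: abs_square_le_1)
    qed
    then have "- 1 \<le> v' j \<and> v' j \<le> 1" if "j < n" for j using that by (simp add: abs_le_iff minus_le_iff)
    then have "v' \<in> S" using v'1 by (auto simp: S_def C_def) (auto simp: v'_def)
    then have "f v' \<le> \<mu>" using u by (simp add: \<mu>_def)
    moreover have "mvec n B v' i = mvec n B v i / c" for i
      by (simp add: mvec_def v'_def sum_divide_distrib)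
    then have "f v' = f v / c\<^sup>2"
      by (simp add: f_def dotp_def power2_eq_square sum_divide_distrib)
    ultimately show ?thesis using c False dotp_self_nonneg[of n v] by (simp add: field_simps)
  qed
  have "dotp m (mvec n B u) (mvec n B v) = \<mu> * dotp n u v" for v
  proof -
    define D where "D = dotp m (mvec n B u) (mvec n B v) - \<mu> * dotp n u v"
    define E where "E = \<mu> * dotp n v v - f v"
    have E: "0 \<le> E" using le[of v] by (simp add: E_def)
    \<comment> \<open>Maximality at \<open>u + t v\<close>, expanded in \<open>t\<close>: a linear
      term is bounded by a quadratic one for all \<open>t\<close>, which forces
      \<open>D = 0\<close>.\<close>
    have quad: "2 * t * D \<le> t\<^sup>2 * E" for t
    proof -
      have "f (\<lambda>j. u j + t * v j) = \<mu> + 2 * t * dotp m (mvec n B u) (mvec n B v) + t\<^sup>2 * f v"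
        unfolding f_def \<mu>_def
        by (simp add: dotp_def mvec_add_scaled power2_eq_square algebra_simps sum.distrib
            sum_distrib_left)
      moreover have "dotp n (\<lambda>j. u j + t * v j) (\<lambda>j. u j + t * v j)
          = 1 + 2 * t * dotp n u v + t\<^sup>2 * dotp n v v"
        unfolding uu[symmetric]
        by (simp add: dotp_def power2_eq_square algebra_simps sum.distrib sum_distrib_left)
      ultimately show ?thesis using le[of "\<lambda>j. u j + t * v j"]
        by (simp add: D_def E_def algebra_simps)
    qed
    \<comment> \<open>\<open>E\<close> may be 0, so \<open>t = D / F\<close> with
      \<open>F = E + 1\<close> is inserted; this yields 2 D^2 / F \<le> D^2 / F.\<close>
    define F where "F = E + 1"
    have F: "0 < F" using E by (simp add: F_def)
    have "2 * (D / F) * D \<le> (D / F)\<^sup>2 * E" by (rule quad)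
    also have "\<dots> \<le> (D / F)\<^sup>2 * F" by (intro mult_left_mono) (auto simp: F_def)
    also have "\<dots> = D\<^sup>2 / F" using F by (simp add: power2_eq_square field_simps)
    finally have "D\<^sup>2 / F \<le> 0" by (simp add: power2_eq_square)
    then have "D\<^sup>2 \<le> 0" using F by (simp add: divide_le_0_iff)
    then show ?thesis by (simp add: D_def)
  qed
  then show ?thesis using that[OF uu, of \<mu>] le by (simp only: f_def)
qed

section \<open>Krylov matrices B G^l and the Frobenius inner product\<close>

definition mmul :: "nat \<Rightarrow> (nat \<Rightarrow> nat \<Rightarrow> real) \<Rightarrow> (nat \<Rightarrow> nat \<Rightarrow> real) \<Rightarrow> nat \<Rightarrow> nat \<Rightarrow> real" where
  "mmul n A G = (\<lambda>i j. \<Sum>l<n. A i l * G l j)"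

definition gram :: "nat \<Rightarrow> (nat \<Rightarrow> nat \<Rightarrow> real) \<Rightarrow> nat \<Rightarrow> nat \<Rightarrow> real" where
  "gram m B = (\<lambda>i j. \<Sum>l<m. B l i * B l j)"

definition ip :: "nat \<Rightarrow> nat \<Rightarrow> (nat \<Rightarrow> nat \<Rightarrow> real) \<Rightarrow> (nat \<Rightarrow> nat \<Rightarrow> real) \<Rightarrow> real" where
  "ip m n P Q = (\<Sum>i<m. \<Sum>j<n. P i j * Q i j)"

primrec krylov ::
  "nat \<Rightarrow> (nat \<Rightarrow> nat \<Rightarrow> real) \<Rightarrow> (nat \<Rightarrow> nat \<Rightarrow> real) \<Rightarrow> nat \<Rightarrow> nat \<Rightarrow> nat \<Rightarrow> real" where
  "krylov n G B 0 = B"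
| "krylov n G B (Suc l) = mmul n (krylov n G B l) G"

lemma gram_sym: "gram m B i j = gram m B j i"
  by (simp add: gram_def mult.commute)

lemma mvec_gram: "mvec n (gram m B) u j = (\<Sum>l<m. B l j * mvec n B u l)"
  by (simp add: mvec_def gram_def sum_distrib_right sum_distrib_left mult.assoc) (rule sum.swap)

lemma mvec_mmul: "mvec n (mmul n A G) u = mvec n A (mvec n G u)"
  by (rule ext) (simp add: mvec_def mmul_def sum_distrib_right sum_distrib_left mult.assoc, rule sum.swap)

lemma dotp_mvec_gram: "dotp n v (mvec n (gram m B) u) = dotp m (mvec n B v) (mvec n B u)"
proof -
  have "dotp n v (mvec n (gram m B) u) = (\<Sum>j<n. \<Sum>l<m. v j * (B l j * mvec n B u l))"
    by (simp add: dotp_def mvec_gram sum_distrib_left)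
  also have "\<dots> = (\<Sum>l<m. \<Sum>j<n. v j * (B l j * mvec n B u l))" by (rule sum.swap)
  also have "\<dots> = dotp m (mvec n B v) (mvec n B u)"
    by (simp add: dotp_def mvec_def[of n B v] sum_distrib_left sum_distrib_right mult_ac)
  finally show ?thesis .
qed

lemma ip_commute: "ip m n P Q = ip m n Q P"
  by (simp add: ip_def mult.commute)

lemma ip_self_nonneg: "0 \<le> ip m n P P"
  by (simp add: ip_def sum_nonneg)

lemma ip_self_eq_0: "ip m n P P = 0 \<longleftrightarrow> (\<forall>i<m. \<forall>j<n. P i j = 0)"
  by (auto simp: ip_def sum_nonneg_eq_0_iff sum_nonneg)

lemma ip_sum_right: "ip m n P (\<lambda>i j. \<Sum>l\<in>S. c l * W l i j) = (\<Sum>l\<in>S. c l * ip m n P (W l))"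
proof -
  have "ip m n P (\<lambda>i j. \<Sum>l\<in>S. c l * W l i j)
      = (\<Sum>i<m. \<Sum>j<n. \<Sum>l\<in>S. c l * (P i j * W l i j))"
    by (simp add: ip_def sum_distrib_left mult_ac)
  also have "\<dots> = (\<Sum>i<m. \<Sum>l\<in>S. \<Sum>j<n. c l * (P i j * W l i j))"
    by (intro sum.cong refl sum.swap)
  also have "\<dots> = (\<Sum>l\<in>S. \<Sum>i<m. \<Sum>j<n. c l * (P i j * W l i j))"
    by (rule sum.swap)
  finally show ?thesis by (simp add: ip_def sum_distrib_left)
qed

lemma ip_lanczos_step:
  "ip m n (\<lambda>i j. S i j - a * Q i j - b * R i j) W = ip m n S W - a * ip m n Q W - b * ip m n R W"
  by (simp add: ip_def algebra_simps sum_subtractf sum.distrib sum_distrib_left)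

text \<open>Right multiplication by a symmetric \<open>G\<close> is self-adjoint for
  \<open>ip\<close>; this is why three terms suffice in the Lanczos recursion.\<close>

lemma ip_mmul_sym:
  assumes "\<And>i j. G i j = G j i"
  shows "ip m n (mmul n P G) Q = ip m n P (mmul n Q G)"
proof -
  have "(\<Sum>j<n. (\<Sum>l<n. P i l * G l j) * Q i j) = (\<Sum>l<n. P i l * (\<Sum>j<n. Q i j * G j l))" for i
    by (simp add: sum_distrib_left sum_distrib_right)
       (subst sum.swap, intro sum.cong refl, subst assms, simp)
  then show ?thesis by (simp add: ip_def mmul_def)
qed

lemma mmul_sum: "mmul n (\<lambda>i j. \<Sum>l\<in>S. c l * W l i j) G i j = (\<Sum>l\<in>S. c l * mmul n (W l) G i j)"
  by (simp add: mmul_def sum_distrib_right sum_distrib_left mult.assoc) (rule sum.swap)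

lemma mmul_add_scaled:
  "mmul n (\<lambda>i j. P i j + c * Q i j) G i j = mmul n P G i j + c * mmul n Q G i j"
  by (simp add: mmul_def algebra_simps sum.distrib sum_distrib_left)

lemma mvec_krylov:
  assumes "\<And>j. j < n \<Longrightarrow> mvec n G u j = \<mu> * u j"
  shows "mvec n (krylov n G B l) u i = \<mu> ^ l * mvec n B u i"
proof (induction l)
  case (Suc l)
  have "mvec n (krylov n G B (Suc l)) u i = mvec n (krylov n G B l) (mvec n G u) i"
    by (simp add: mvec_mmul)
  also have "\<dots> = \<mu> * mvec n (krylov n G B l) u i"
    by (simp add: mvec_def[of n "krylov n G B l"] assms sum_distrib_left mult_ac)
  finally show ?case using Suc by simp
qed simp

section \<open>The Lanczos recursion: orthogonality and termination\<close>

text \<open>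
  In the Lanczos recursion below, the pairs hold the current and the previous term.  Since
  \<open>x / 0 = 0\<close>, the coefficient of the previous matrix \<open>0\<close> vanishes in the first step.
\<close>

definition lz_alpha where
  "lz_alpha m n G Q = ip m n (mmul n Q G) Q / ip m n Q Q"

definition lz_beta where
  "lz_beta m n Q Q' = ip m n Q Q / ip m n Q' Q'"

primrec lzQ where
  "lzQ m n G B 0 = (B, \<lambda>_ _. 0)"
| "lzQ m n G B (Suc d) = (let (Q, Q') = lzQ m n G B d in
     (\<lambda>i j. mmul n Q G i j - lz_alpha m n G Q * Q i j - lz_beta m n Q Q' * Q' i j, Q))"

text \<open>Coefficients of the polynomials p_d for which B p_d(G) is the d-th matrix of
  \<open>lzQ\<close>: the same recursion, with a shift of coefficients in place of multiplication by
  \<open>G\<close>.\<close>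

primrec lzp :: "_ \<Rightarrow> _ \<Rightarrow> _ \<Rightarrow> _ \<Rightarrow> nat \<Rightarrow> (nat \<Rightarrow> real) \<times> (nat \<Rightarrow> real)" where
  "lzp m n G B 0 = (\<lambda>l. if l = 0 then 1 else 0, \<lambda>_. 0)"
| "lzp m n G B (Suc d) = (let (Q, Q') = lzQ m n G B d; (p, p') = lzp m n G B d in
     (\<lambda>l. (if l = 0 then 0 else p (l - 1)) - lz_alpha m n G Q * p l - lz_beta m n Q Q' * p' l, p))"

lemma snd_lzQ_Suc [simp]: "snd (lzQ m n G B (Suc d)) = fst (lzQ m n G B d)"
  by (simp add: Let_def split: prod.split)

lemma snd_lzp_Suc [simp]: "snd (lzp m n G B (Suc d)) = fst (lzp m n G B d)"
  by (simp add: Let_def split: prod.split)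

lemma fst_lzQ_Suc:
  "fst (lzQ m n G B (Suc d)) = (\<lambda>i j. mmul n (fst (lzQ m n G B d)) G i j
     - lz_alpha m n G (fst (lzQ m n G B d)) * fst (lzQ m n G B d) i j
     - lz_beta m n (fst (lzQ m n G B d)) (snd (lzQ m n G B d)) * snd (lzQ m n G B d) i j)"
  by (simp add: Let_def split: prod.split)

lemma fst_lzp_Suc:
  "fst (lzp m n G B (Suc d)) = (\<lambda>l. (if l = 0 then 0 else fst (lzp m n G B d) (l - 1))
     - lz_alpha m n G (fst (lzQ m n G B d)) * fst (lzp m n G B d) l
     - lz_beta m n (fst (lzQ m n G B d)) (snd (lzQ m n G B d)) * snd (lzp m n G B d) l)"
  by (simp add: Let_def case_prod_beta)

declare lzQ.simps(2) [simp del] lzp.simps(2) [simp del]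

lemma lzp_zero: "(d < l \<longrightarrow> fst (lzp m n G B d) l = 0) \<and> (d \<le> l \<longrightarrow> snd (lzp m n G B d) l = 0)"
  by (induction d arbitrary: l) (auto simp: fst_lzp_Suc)

lemma lzp_lead: "fst (lzp m n G B d) d = 1"
  by (induction d) (auto simp: fst_lzp_Suc lzp_zero)

lemma lzQ_eq_krylov:
  "fst (lzQ m n G B d) i j = (\<Sum>l\<le>d. fst (lzp m n G B d) l * krylov n G B l i j) \<and>
   snd (lzQ m n G B d) i j = (\<Sum>l\<le>d. snd (lzp m n G B d) l * krylov n G B l i j)"
proof (induction d arbitrary: i j)
  case (Suc d)
  let ?p = "fst (lzp m n G B d)" and ?p' = "snd (lzp m n G B d)" and ?W = "krylov n G B"
  have Q: "fst (lzQ m n G B d) = (\<lambda>i j. \<Sum>l\<le>d. ?p l * ?W l i j)"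
    and Q': "snd (lzQ m n G B d) = (\<lambda>i j. \<Sum>l\<le>d. ?p' l * ?W l i j)" using Suc by auto
  have ext: "(\<Sum>l\<le>Suc d. ?p l * ?W l i j) = (\<Sum>l\<le>d. ?p l * ?W l i j)"
     "(\<Sum>l\<le>Suc d. ?p' l * ?W l i j) = (\<Sum>l\<le>d. ?p' l * ?W l i j)" for i j
    by (simp_all add: lzp_zero)
  define a where "a = lz_alpha m n G (fst (lzQ m n G B d))"
  define b where "b = lz_beta m n (fst (lzQ m n G B d)) (snd (lzQ m n G B d))"
  have "mmul n (fst (lzQ m n G B d)) G i j = (\<Sum>l\<le>d. ?p l * ?W (Suc l) i j)"
    unfolding Q by (simp add: mmul_sum)
  also have "\<dots> = (\<Sum>l\<le>Suc d. (if l = 0 then 0 else ?p (l - 1)) * ?W l i j)"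
    by (subst sum.atMost_Suc_shift) simp
  finally have M: "mmul n (fst (lzQ m n G B d)) G i j
    = (\<Sum>l\<le>Suc d. (if l = 0 then 0 else ?p (l - 1)) * ?W l i j)" .
  have "fst (lzQ m n G B (Suc d)) i j
    = (\<Sum>l\<le>Suc d. (if l = 0 then 0 else ?p (l - 1)) * ?W l i j)
      - a * (\<Sum>l\<le>Suc d. ?p l * ?W l i j) - b * (\<Sum>l\<le>Suc d. ?p' l * ?W l i j)"
    unfolding fst_lzQ_Suc M a_def[symmetric] b_def[symmetric] ext using Suc by simp
  also have "\<dots> = (\<Sum>l\<le>Suc d. fst (lzp m n G B (Suc d)) l * ?W l i j)"
    unfolding fst_lzp_Suc a_def[symmetric] b_def[symmetric]
    by (simp only: left_diff_distrib sum_subtractf sum_distrib_left mult.assoc)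
  finally show ?case using Suc by (simp add: lzp_zero)
qed simp

lemma lzQ_eq_krylov_fst:
  "fst (lzQ m n G B d) = (\<lambda>i j. \<Sum>l\<le>d. fst (lzp m n G B d) l * krylov n G B l i j)"
  by (intro ext) (simp add: lzQ_eq_krylov)

text \<open>The polynomial of step \<open>d\<close> is monic of degree \<open>d\<close>, so the
  Lanczos matrix is B G^d plus lower Krylov terms, to which \<open>P\<close> is orthogonal.\<close>

lemma ip_lzQ_expand:
  assumes "\<And>i. i < d \<Longrightarrow> ip m n P (krylov n G B i) = 0"
  shows "ip m n P (fst (lzQ m n G B d)) = ip m n P (krylov n G B d)"
proof -
  have "ip m n P (fst (lzQ m n G B d))
      = (\<Sum>l\<le>d. fst (lzp m n G B d) l * ip m n P (krylov n G B l))"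
    unfolding lzQ_eq_krylov_fst ip_sum_right ..
  also have "\<dots> = (\<Sum>l\<in>{d}. fst (lzp m n G B d) l * ip m n P (krylov n G B l))"
    using assms by (intro sum.mono_neutral_right) auto
  finally show ?thesis by (simp add: lzp_lead)
qed

text \<open>In the passage from d to d + 1, self-adjointness settles B G^i for i < d - 1, the choice
  of \<open>lz_beta\<close> settles i = d - 1 and that of \<open>lz_alpha\<close> settles i = d.
  Nonzero norms give these quotients their meaning.\<close>

lemma lanczos_orthogonal:
  assumes sym: "\<And>i j. G i j = G j i"
    and nz: "\<And>j. j < d \<Longrightarrow> ip m n (fst (lzQ m n G B j)) (fst (lzQ m n G B j)) \<noteq> 0"
    and "i < d"
  shows "ip m n (fst (lzQ m n G B d)) (krylov n G B i) = 0"
  using assms(2,3)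
proof (induction d arbitrary: i rule: less_induct)
  case (less d')
  then obtain d where d': "d' = Suc d" by (cases d') auto
  let ?q = "\<lambda>d. fst (lzQ m n G B d)" and ?W = "krylov n G B"
  let ?q' = "snd (lzQ m n G B d)"
  have qW: "ip m n (?q d) (?W i) = 0" if "i < d" for i
    using less d' that by auto
  have exp: "ip m n (?q d') (?W i)
      = ip m n (?q d) (?W (Suc i)) - lz_alpha m n G (?q d) * ip m n (?q d) (?W i)
        - lz_beta m n (?q d) ?q' * ip m n ?q' (?W i)" for i
    unfolding d' fst_lzQ_Suc ip_lanczos_step by (simp add: ip_mmul_sym[OF sym])
  have nzd: "ip m n (?q d) (?q d) \<noteq> 0" using less.prems d' by simp
  have lower: "ip m n (?q d') (?W i) = 0" if i: "i < d" for i
  proof -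
    obtain e where e: "d = Suc e" using i by (cases d) auto
    have q': "?q' = ?q e" by (simp add: e)
    have eW: "ip m n (?q e) (?W i) = 0" if "i < e" for i
      using less d' e that by auto
    show ?thesis
    proof (cases "i = e")
      case True
      have "ip m n (?q d) (?W d) = ip m n (?q d) (?q d)" by (simp add: ip_lzQ_expand qW)
      moreover have "ip m n (?q e) (?W e) = ip m n (?q e) (?q e)" by (simp add: ip_lzQ_expand eW)
      moreover have "ip m n (?q e) (?q e) \<noteq> 0" using less.prems d' e by simp
      ultimately show ?thesis unfolding exp q' using True e qW[OF i]
        by (simp add: qW lz_beta_def del: krylov.simps)
    next
      case False
      then show ?thesis unfolding exp q' using i e qW[OF i] qW[of "Suc i"] eW
        by (simp del: krylov.simps)
    qed
  qed
  show ?case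
  proof (cases "i = d")
    case True
    \<comment> \<open>Up to lower Krylov terms B G^d is the Lanczos matrix itself. The previous
      matrix is orthogonal to it, and what remains is the definition of
      \<open>lz_alpha\<close>.\<close>
    have q'q: "ip m n ?q' (?q d) = 0"
    proof (cases d)
      case 0
      then show ?thesis by (simp add: ip_def)
    next
      case (Suc e)
      have "ip m n (?q d) (?q e) = ip m n (?q d) (?W e)"
        by (rule ip_lzQ_expand) (use qW Suc in auto)
      then show ?thesis using Suc qW by (simp add: ip_commute)
    qed
    have "ip m n (?q d') (?W d) = ip m n (?q d') (?q d)"
      by (rule ip_lzQ_expand[symmetric]) (use lower in auto)
    also have "\<dots> = 0"
      unfolding d' fst_lzQ_Suc ip_lanczos_step q'q lz_alpha_def using nzd by simp
    finally show ?thesis using True by simp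
  next
    case False
    with less.prems d' lower show ?thesis by simp
  qed
qed

text \<open>m n + 1 nonzero, pairwise orthogonal matrices would be linearly dependent, having only m
  n entries each; pairing a dependency with one of its members gives the contradiction.\<close>

lemma lanczos_terminates:
  assumes sym: "\<And>i j. G i j = G j i"
  obtains d where "d \<le> m * n" "ip m n (fst (lzQ m n G B d)) (fst (lzQ m n G B d)) = 0"
proof -
  let ?q = "\<lambda>d. fst (lzQ m n G B d)"
  have "\<exists>d\<le>m * n. ip m n (?q d) (?q d) = 0"
  proof (rule ccontr)
    assume "\<not> ?thesis"
    then have nz: "ip m n (?q d) (?q d) \<noteq> 0" if "d \<le> m * n" for d using that by blast
    have orth1: "ip m n (?q k) (?q j) = 0" if "j < k" "k \<le> m * n" for j k
    proof -
      have W: "ip m n (?q k) (krylov n G B i) = 0" if "i < k" for i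
        by (rule lanczos_orthogonal[OF sym]) (use nz that \<open>k \<le> m * n\<close> in auto)
      have "ip m n (?q k) (?q j) = ip m n (?q k) (krylov n G B j)"
        by (rule ip_lzQ_expand) (use W that in auto)
      with W that show ?thesis by simp
    qed
    then have orth: "ip m n (?q j) (?q k) = 0" if "j \<noteq> k" "j \<le> m * n" "k \<le> m * n" for j k
      using that by (metis ip_commute linorder_neqE_nat)
    obtain c where c: "\<exists>k\<in>{..m * n}. c k \<noteq> 0"
      "\<And>x. x \<in> {..<m} \<times> {..<n} \<Longrightarrow> (\<Sum>k\<le>m * n. ?q k (fst x) (snd x) * c k) = 0"
      using homogeneous_system_nontrivial[of "{..<m} \<times> {..<n}" "{..m * n}"
          "\<lambda>x k. ?q k (fst x) (snd x)"] by auto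
    from c(1) obtain k0 where k0: "k0 \<le> m * n" "c k0 \<noteq> 0" by auto
    have "(\<Sum>k\<le>m * n. c k * ?q k i j) = 0" if "i < m" "j < n" for i j
      using c(2)[of "(i, j)"] that by (simp add: mult.commute)
    then have "0 = ip m n (?q k0) (\<lambda>i j. \<Sum>k\<le>m * n. c k * ?q k i j)"
      by (simp add: ip_def)
    also have "\<dots> = (\<Sum>k\<le>m * n. c k * ip m n (?q k0) (?q k))" by (rule ip_sum_right)
    also have "\<dots> = (\<Sum>k\<in>{k0}. c k * ip m n (?q k0) (?q k))"
      using k0 orth by (intro sum.mono_neutral_right) auto
    finally show False using k0 nz by simp
  qed
  with that show ?thesis by blast
qed

section \<open>Synthetic division and evaluation at G\<close>

primrec horner_h :: "real \<Rightarrow> (nat \<Rightarrow> real) \<Rightarrow> nat \<Rightarrow> real" where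
  "horner_h x P 0 = 0"
| "horner_h x P (Suc s) = P s + x * horner_h x P s"

text \<open>Horner's scheme for B h(G), with the values of \<open>horner_h\<close> as coefficients
  of \<open>h\<close>, leading coefficient first.\<close>

primrec horner_V where
  "horner_V n G B x P 0 = (\<lambda>_ _. 0)"
| "horner_V n G B x P (Suc s) =
    (\<lambda>i j. mmul n (horner_V n G B x P s) G i j + horner_h x P (Suc s) * B i j)"

text \<open>With \<open>P i = p (d - i)\<close> the coefficients are read from the top: the value at
  \<open>Suc d\<close> is p(x), and the values at 1, ..., d are the coefficients of the quotient of
  p by the linear factor with root \<open>x\<close>.\<close>

lemma horner_h_eq: "horner_h x P (Suc s) = (\<Sum>l\<le>s. P (s - l) * x ^ l)"
proof (induction s)
  case (Suc s)
  have "horner_h x P (Suc (Suc s)) = P (Suc s) + x * horner_h x P (Suc s)" by simp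
  also have "\<dots> = P (Suc s) + x * (\<Sum>l\<le>s. P (s - l) * x ^ l)" unfolding Suc ..
  also have "\<dots> = (\<Sum>l\<le>Suc s. P (Suc s - l) * x ^ l)"
    by (subst sum.atMost_Suc_shift) (simp add: sum_distrib_left mult_ac)
  finally show ?case .
qed simp

lemma horner_V_krylov:
  "horner_V n G B x P s i j = (\<Sum>l<s. horner_h x P (s - l) * krylov n G B l i j)"
proof (induction s arbitrary: i j)
  case (Suc s)
  have "mmul n (horner_V n G B x P s) G i j
      = mmul n (\<lambda>i j. \<Sum>l<s. horner_h x P (s - l) * krylov n G B l i j) G i j"
    using Suc by presburger
  then show ?case
    by (subst sum.lessThan_Suc_shift) (simp add: mmul_sum del: horner_h.simps)
qed simp

text \<open>Synthetic division of the annihilating polynomial by \<open>x - \<lambda>\<close>, evaluated at \<open>G\<close>.\<close>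

lemma horner_V_shift:
  "mmul n (horner_V n G B x P s) G i j - x * horner_V n G B x P s i j
    = (\<Sum>l\<le>s. P (s - l) * krylov n G B l i j) - horner_h x P (Suc s) * B i j"
proof (induction s arbitrary: i j)
  case (Suc s)
  let ?V = "horner_V n G B x P s" and ?h = "horner_h x P (Suc s)" and ?W = "krylov n G B"
  let ?q = "\<lambda>i j. \<Sum>l\<le>s. P (s - l) * ?W l i j"
  have IH: "mmul n ?V G = (\<lambda>i j. x * ?V i j + (?q i j - ?h * B i j))"
    using Suc by (auto simp: fun_eq_iff algebra_simps)
  have V: "horner_V n G B x P (Suc s) = (\<lambda>i j. mmul n ?V G i j + ?h * B i j)" by simp
  \<comment> \<open>The induction hypothesis trades the product with \<open>G\<close> for
    multiplication by \<open>x\<close>. Multiplying this form by \<open>G\<close> makes the terms in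
    \<open>mmul n ?V G\<close> cancel below.\<close>
  have V2: "horner_V n G B x P (Suc s) = (\<lambda>i j. ?q i j + x * ?V i j)"
    unfolding V IH by (simp add: algebra_simps)
  have "mmul n (horner_V n G B x P (Suc s)) G i j = mmul n ?q G i j + x * mmul n ?V G i j"
    unfolding V2 by (rule mmul_add_scaled)
  then have "mmul n (horner_V n G B x P (Suc s)) G i j - x * horner_V n G B x P (Suc s) i j
      = mmul n ?q G i j - x * ?h * B i j"
    unfolding V by (simp add: algebra_simps del: horner_h.simps)
  also have "mmul n ?q G i j = (\<Sum>l\<le>s. P (s - l) * ?W (Suc l) i j)" by (simp add: mmul_sum)
  also have "\<dots> = (\<Sum>l\<le>Suc s. P (Suc s - l) * ?W l i j) - P (Suc s) * B i j"
    by (subst sum.atMost_Suc_shift) simp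
  finally show ?case by (simp add: algebra_simps)
qed (simp add: mmul_def)

text \<open>The largest root \<open>x\<close> is the amount removed from the squared norm, as |B
  y|^2 = x |y|^2 for a row \<open>y\<close> of \<open>V\<close>. The top eigenvalue \<mu> bounds all
  Rayleigh quotients, so \<mu> \<le> x suffices.\<close>

lemma lanczos_top_rank_one:
  fixes m n d :: nat and B :: "nat \<Rightarrow> nat \<Rightarrow> real"
  defines "G \<equiv> gram m B"
  assumes nz: "\<And>j. j < d \<Longrightarrow> ip m n (fst (lzQ m n G B j)) (fst (lzQ m n G B j)) \<noteq> 0"
    and z: "ip m n (fst (lzQ m n G B d)) (fst (lzQ m n G B d)) = 0"
    and d: "0 < d"
  defines "p \<equiv> fst (lzp m n G B d)"
  defines "x \<equiv> largest_root (\<Sum>l\<le>d. monom (p l) l)"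
  defines "V \<equiv> horner_V n G B x (\<lambda>s. p (d - s)) d"
  shows "\<exists>i<m. \<exists>j<n. V i j \<noteq> 0"
    and "\<And>w. w < m \<Longrightarrow> dotp n (V w) (V w) \<noteq> 0 \<Longrightarrow>
      top_rank_one m n B (\<lambda>i. mvec n B (V w) i / dotp n (V w) (V w)) (V w)"
proof -
  note sym = gram_sym[of m B, folded G_def]
  have ne: "\<exists>i<m. \<exists>j<n. B i j \<noteq> 0" using nz[OF d] by (simp add: ip_self_eq_0 Bex_def)
  have ann: "(\<Sum>l\<le>d. p l * krylov n G B l i j) = 0" if "i < m" "j < n" for i j
    using z that unfolding ip_self_eq_0 lzQ_eq_krylov_fst p_def by simp
  have pd: "p d = 1" by (simp add: p_def lzp_lead)
  have "0 < n" using ne by auto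
  then obtain u \<mu> where u: "dotp n u u = 1"
    and max: "\<And>v. dotp m (mvec n B v) (mvec n B v) \<le> \<mu> * dotp n v v"
    and eig: "\<And>v. dotp m (mvec n B u) (mvec n B v) = \<mu> * dotp n u v"
    using exists_top_eigenvector[of n m B] by metis
  have "mvec n G u j = \<mu> * u j" if "j < n" for j
  proof -
    define e where "e = (\<lambda>i. if i = j then 1 else 0 :: real)"
    have "dotp n e (mvec n G u) = \<mu> * dotp n e u"
      unfolding G_def dotp_mvec_gram using eig[of e] by (simp add: dotp_commute)
    then show ?thesis
      using that by (simp add: dotp_def e_def if_distrib[of "\<lambda>x. x * _"] cong: if_cong)
  qed
  note Wu = mvec_krylov[of n G u \<mu> B, OF this]
  have BuBu: "dotp m (mvec n B u) (mvec n B u) = \<mu>" using eig[of u] u by simp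
  have "0 \<le> \<mu>" using BuBu dotp_self_nonneg[of m "mvec n B u"] by simp
  \<comment> \<open>\<mu> = 0 would make \<open>B\<close> vanish, whereas \<open>0 < d\<close> says
    that the start of the recursion is nonzero.\<close>
  have "\<mu> \<noteq> 0"
  proof
    assume "\<mu> = 0"
    then have "dotp m (mvec n B v) (mvec n B v) = 0" for v
      using max[of v] dotp_self_nonneg[of m "mvec n B v"] by simp
    then have *: "mvec n B v i = 0" if "i < m" for v i
      using dotp_self_eq_0 that by blast
    from ne obtain i j where "i < m" "j < n" "B i j \<noteq> 0" by blast
    with *[of i "\<lambda>l. if l = j then 1 else 0"] show False
      by (simp add: mvec_def if_distrib[of "\<lambda>x. _ * x"] cong: if_cong)
  qed
  then obtain i where i: "i < m" "mvec n B u i \<noteq> 0"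
    using BuBu dotp_self_eq_0[of m "mvec n B u"] by auto
  define q where "q = (\<Sum>l\<le>d. monom (p l) l)"
  have polyq: "poly q t = (\<Sum>l\<le>d. p l * t ^ l)" for t
    by (simp add: q_def poly_sum poly_monom)
  have "coeff q d = 1" by (simp add: q_def coeff_sum pd)
  then have q0: "q \<noteq> 0" by auto
  \<comment> \<open>B q(G) = 0 applied to \<open>u\<close> reads q(\<mu>) B u = 0, and row
    \<open>i\<close> of B u is nonzero.\<close>
  have "0 = mvec n (\<lambda>i j. \<Sum>l\<le>d. p l * krylov n G B l i j) u i"
    using i ann by (simp add: mvec_def)
  also have "\<dots> = (\<Sum>l\<le>d. p l * mvec n (krylov n G B l) u i)"
    by (simp add: mvec_def sum_distrib_left sum_distrib_right mult.assoc) (rule sum.swap)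
  also have "\<dots> = poly q \<mu> * mvec n B u i"
    by (simp add: Wu polyq sum_distrib_right mult.assoc)
  finally have root: "poly q \<mu> = 0" using i by simp
  have x: "x = Max {t. poly q t = 0}"
    unfolding x_def q_def[symmetric] largest_root_def using q0 root by auto
  have fin: "finite {t. poly q t = 0}" using q0 by (rule poly_roots_finite)
  have mux: "\<mu> \<le> x" unfolding x using fin root by (intro Max_ge) auto
  have "x \<in> {t. poly q t = 0}" unfolding x using fin root by (intro Max_in) auto
  then have xroot: "poly q x = 0" by simp
  have "horner_h x (\<lambda>s. p (d - s)) (Suc d) = 0"
    unfolding horner_h_eq using xroot by (simp add: polyq)
  then have VG: "mmul n V G i j = x * V i j" if "i < m" "j < n" for i j
    using horner_V_shift[of n G B x "\<lambda>s. p (d - s)" d i j] ann[OF that] by (simp add: V_def)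
  show "\<exists>i<m. \<exists>j<n. V i j \<noteq> 0"
  proof (rule ccontr)
    assume "\<not> ?thesis"
    then have 0: "ip m n (fst (lzQ m n G B (d - 1))) V = 0" by (simp add: ip_def)
    \<comment> \<open>\<open>V\<close> has coefficient 1 at B G^(d - 1), so its inner product with
      the last nonzero Lanczos matrix is the squared norm of that matrix.\<close>
    have Vk: "V = (\<lambda>i j. \<Sum>l<d. horner_h x (\<lambda>s. p (d - s)) (d - l) * krylov n G B l i j)"
      by (intro ext) (simp add: V_def horner_V_krylov)
    have orth: "ip m n (fst (lzQ m n G B (d - 1))) (krylov n G B l) = 0" if "l < d - 1" for l
      by (rule lanczos_orthogonal[OF sym]) (use nz that in auto)
    have "ip m n (fst (lzQ m n G B (d - 1))) V
        = (\<Sum>l<d. horner_h x (\<lambda>s. p (d - s)) (d - l)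
            * ip m n (fst (lzQ m n G B (d - 1))) (krylov n G B l))"
      unfolding Vk by (rule ip_sum_right)
    also have "\<dots> = (\<Sum>l\<in>{d - 1}. horner_h x (\<lambda>s. p (d - s)) (d - l)
            * ip m n (fst (lzQ m n G B (d - 1))) (krylov n G B l))"
    proof (intro sum.mono_neutral_right ballI)
      fix l assume "l \<in> {..<d} - {d - 1}"
      then have "l < d - 1" using d by auto
      then show "horner_h x (\<lambda>s. p (d - s)) (d - l)
            * ip m n (fst (lzQ m n G B (d - 1))) (krylov n G B l) = 0"
        using orth[of l] by simp
    qed (use d in auto)
    also have "\<dots> = ip m n (fst (lzQ m n G B (d - 1))) (krylov n G B (d - 1))"
      using d pd by simp
    also have "\<dots> = ip m n (fst (lzQ m n G B (d - 1))) (fst (lzQ m n G B (d - 1)))"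
      by (rule ip_lzQ_expand[symmetric]) (rule orth)
    finally show False using 0 nz d by simp
  qed
  fix w assume w: "w < m" and y0: "dotp n (V w) (V w) \<noteq> 0"
  define N where "N = dotp n (V w) (V w)"
  have N: "0 < N" using y0 dotp_self_nonneg[of n "V w"] by (simp add: N_def)
  have "mvec n G (V w) j = x * V w j" if "j < n" for j
    using VG[OF w that] by (simp add: mvec_def mmul_def sym[of j] mult.commute)
  then have "dotp n (V w) (mvec n G (V w)) = x * N"
    by (simp add: dotp_def N_def sum_distrib_left mult_ac)
  then have By: "dotp m (mvec n B (V w)) (mvec n B (V w)) = x * N"
    unfolding G_def dotp_mvec_gram .
  have "fro m n (\<lambda>i j. B i j - mvec n B (V w) i / N * V w j) = fro m n B - x"
    using fro_sub_proj[of "1 / N" n "V w" m B] By N y0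
    by (simp add: N_def[symmetric])
  then show "top_rank_one m n B (\<lambda>i. mvec n B (V w) i / dotp n (V w) (V w)) (V w)"
    unfolding top_rank_one_def N_def[symmetric]
    using order_trans[OF max mult_right_mono[OF mux dotp_self_nonneg]] by simp
qed

section \<open>Global optimality of greedy deflation\<close>

text \<open>All earlier columns are subtracted, whatever their class; when the supports are
  disjoint, feasible columns of other classes contribute 0 on the support of column
  \<open>k\<close>.\<close>

definition masked_residual ::
  "(nat \<Rightarrow> nat \<Rightarrow> real) \<Rightarrow> (nat \<times> nat) set \<Rightarrow> (nat \<times> nat) set \<Rightarrow> (nat \<Rightarrow> nat \<Rightarrow> real) \<Rightarrow>
   (nat \<Rightarrow> nat \<Rightarrow> real) \<Rightarrow> nat \<Rightarrow> nat \<Rightarrow> nat \<Rightarrow> real" where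
  "masked_residual A I J X Y k = (\<lambda>i j. if (i, j) \<in> rank_one_supp I J k
     then A i j - (\<Sum>l<k. X i l * Y j l) else 0)"

lemma in_rank_one_supp: "(i, j) \<in> rank_one_supp I J k \<longleftrightarrow> (i, k) \<in> I \<and> (j, k) \<in> J"
  by (simp add: rank_one_supp_def)

lemma rank_one_supp_disjoint:
  assumes disj: "disjoint_family_on (class_supp I J) (supp_classes r I J)"
    and "k < r" "l < r" "rank_one_supp I J k \<noteq> rank_one_supp I J l"
  shows "rank_one_supp I J k \<inter> rank_one_supp I J l = {}"
proof -
  let ?c = "\<lambda>k. supp_equiv r I J `` {k}"
  have mem: "?c k \<in> supp_classes r I J" "k \<in> ?c k" if "k < r" for k
    using that quotientI[of k "{..<r}" "supp_equiv r I J"]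
    by (auto simp: supp_classes_def supp_equiv_def)
  have "?c k \<noteq> ?c l" using assms by (auto simp: supp_equiv_def)
  then have "class_supp I J (?c k) \<inter> class_supp I J (?c l) = {}"
    using disj mem assms by (auto simp: disjoint_family_on_def)
  then show ?thesis using class_supp_eq[of "?c k" r I J k] class_supp_eq[of "?c l" r I J l] mem assms
    by simp
qed

text \<open>The greedy decreases \<open>s k\<close> telescope to the total decrease. The decrease of
  the competitor splits over the disjoint supports, and on each of them
  \<open>greedy_lower_bound\<close> compares it with the \<open>s k\<close> of the class, which has
  the same width.\<close>

lemma greedy_optimal:
  fixes A X Y :: "nat \<Rightarrow> nat \<Rightarrow> real"
  assumes disj: "disjoint_family_on (class_supp I J) (supp_classes r I J)"
    and X: "\<And>i k. i < m \<Longrightarrow> k < r \<Longrightarrow> (i, k) \<notin> I \<Longrightarrow> X i k = 0"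
    and Y: "\<And>j k. j < n \<Longrightarrow> k < r \<Longrightarrow> (j, k) \<notin> J \<Longrightarrow> Y j k = 0"
    and top: "\<And>k. k < r \<Longrightarrow>
      top_rank_one m n (masked_residual A I J X Y k) (\<lambda>i. X i k) (\<lambda>j. Y j k)"
    and X': "\<And>i k. i < m \<Longrightarrow> k < r \<Longrightarrow> (i, k) \<notin> I \<Longrightarrow> X' i k = 0"
    and Y': "\<And>j k. j < n \<Longrightarrow> k < r \<Longrightarrow> (j, k) \<notin> J \<Longrightarrow> Y' j k = 0"
  shows "fro m n (\<lambda>i j. A i j - (\<Sum>k<r. X i k * Y j k))
    \<le> fro m n (\<lambda>i j. A i j - (\<Sum>k<r. X' i k * Y' j k))"
proof -
  define B where "B = masked_residual A I J X Y"
  define s where "s k = fro m n (B k) - fro m n (\<lambda>i j. B k i j - X i k * Y j k)" for k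
  let ?S = "rank_one_supp I J"
  have XYS: "X i k * Y j k = 0" "X' i k * Y' j k = 0"
    if "i < m" "j < n" "k < r" "(i, j) \<notin> ?S k" for i j k
    using that X[of i k] Y[of j k] X'[of i k] Y'[of j k] by (auto simp: in_rank_one_supp)
  \<comment> \<open>Off the support of column \<open>k\<close> its product vanishes, and on the
    support the masked residual is the full one, so the two decreases agree entry by entry.\<close>
  have step: "s k = fro m n (\<lambda>i j. A i j - (\<Sum>l<k. X i l * Y j l))
      - fro m n (\<lambda>i j. A i j - (\<Sum>l<Suc k. X i l * Y j l))" if "k < r" for k
    unfolding s_def fro_def sum_subtractf[symmetric]
  proof (intro sum.cong refl)
    fix i j assume "i \<in> {..<m}" "j \<in> {..<n}"
    then show "(B k i j)\<^sup>2 - (B k i j - X i k * Y j k)\<^sup>2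
      = (A i j - (\<Sum>l<k. X i l * Y j l))\<^sup>2 - (A i j - (\<Sum>l<Suc k. X i l * Y j l))\<^sup>2"
      using XYS(1)[of i j k] that by (auto simp: B_def masked_residual_def algebra_simps)
  qed
  have upper: "fro m n (\<lambda>i j. A i j - (\<Sum>k<r. X i k * Y j k)) = fro m n A - (\<Sum>k<r. s k)"
  proof -
    have "(\<Sum>k<r'. s k) = fro m n A - fro m n (\<lambda>i j. A i j - (\<Sum>l<r'. X i l * Y j l))"
      if "r' \<le> r" for r'
      using that by (induction r') (auto simp: step)
    then show ?thesis by simp
  qed
  have s0: "0 \<le> s k" if k: "k < r" for k
  proof (cases "n = 0")
    case False
    \<comment> \<open>Any unit vector shows that \<open>s k\<close> dominates a nonnegative Rayleigh
      quotient.\<close>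
    define e where "e = (\<lambda>j::nat. if j = 0 then 1 else 0 :: real)"
    have "dotp n e e = 1" using False by (simp add: dotp_def e_def if_distrib[of "\<lambda>x. x * _"] cong: if_cong)
    then show ?thesis
      using top[OF k, unfolded top_rank_one_def, rule_format, of e] dotp_self_nonneg[of m "mvec n (B k) e"]
      by (simp add: s_def B_def)
  qed (simp add: s_def fro_def)
  define D where "D = (\<lambda>(i, j). (A i j)\<^sup>2 - (A i j - (\<Sum>k<r. X' i k * Y' j k))\<^sup>2)"
  define R where "R = {..<m} \<times> {..<n}"
  define T where "T = ?S ` {..<r}"
  have blk: "(\<Sum>x\<in>R \<inter> S. D x) \<le> (\<Sum>k | k < r \<and> ?S k = S. s k)" if S: "S \<in> T" for S
  proof -
    define P where "P = {k. k < r \<and> ?S k = S}"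
    define AP where "AP = (\<lambda>i j. if (i, j) \<in> S then A i j else 0)"
    have fP: "finite P" by (simp add: P_def)
    have off: "(i, j) \<notin> ?S l" if "(i, j) \<in> S" "l < r" "l \<notin> P" for i j l
      using rank_one_supp_disjoint[OF disj, of l] S that unfolding T_def P_def by blast
    have restr: "(\<Sum>l<k. Z l) = (\<Sum>l | l \<in> P \<and> l < k. Z l)"
      if "\<And>l. l < r \<Longrightarrow> l \<notin> P \<Longrightarrow> Z l = 0" "k \<le> r" for Z :: "nat \<Rightarrow> real" and k
      using that by (intro sum.mono_neutral_right) (auto, meson order_less_le_trans)
    have "fro m n AP - (\<Sum>k\<in>P. s k) \<le> fro m n (\<lambda>i j. AP i j - (\<Sum>k\<in>P. X' i k * Y' j k))"
    proof (rule greedy_lower_bound[OF fP fP order_refl])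
      show "0 \<le> s k" if "k \<in> P" for k using s0 that by (simp add: P_def)
    next
      fix k u assume k: "k \<in> P" and u: "\<And>l. l \<in> P \<Longrightarrow> l < k \<Longrightarrow> dotp n (\<lambda>j. Y j l) u = 0"
      have kr: "k < r" and Sk: "?S k = S" using k by (auto simp: P_def)
      have Bk: "B k i j = AP i j - (\<Sum>l | l \<in> P \<and> l < k. X i l * Y j l)" if "i < m" "j < n" for i j
      proof (cases "(i, j) \<in> S")
        case True
        have "(\<Sum>l<k. X i l * Y j l) = (\<Sum>l | l \<in> P \<and> l < k. X i l * Y j l)"
          by (rule restr) (use XYS(1) off[OF True] that kr in auto)
        then show ?thesis by (simp add: B_def masked_residual_def Sk True AP_def)
      next
        case False
        have "X i l * Y j l = 0" if "l \<in> P" for l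
          using XYS(1)[of i j l] \<open>i < m\<close> \<open>j < n\<close> that False by (simp add: P_def)
        then have "(\<Sum>l | l \<in> P \<and> l < k. X i l * Y j l) = 0" by (intro sum.neutral) auto
        then show ?thesis by (simp add: B_def masked_residual_def Sk False AP_def)
      qed
      \<comment> \<open>\<open>u\<close> is orthogonal to the earlier right vectors of the class, so
        the subtracted columns have no effect on \<open>u\<close>.\<close>
      have "mvec n (B k) u i = mvec n AP u i" if "i < m" for i
      proof -
        have "mvec n (B k) u i
            = mvec n AP u i - (\<Sum>j<n. \<Sum>l | l \<in> P \<and> l < k. X i l * Y j l * u j)"
          using that by (simp add: mvec_def Bk left_diff_distrib sum_subtractf sum_distrib_right)
        also have "(\<Sum>j<n. \<Sum>l | l \<in> P \<and> l < k. X i l * Y j l * u j)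
            = (\<Sum>l | l \<in> P \<and> l < k. X i l * dotp n (\<lambda>j. Y j l) u)"
          by (subst sum.swap) (simp add: dotp_def sum_distrib_left mult.assoc)
        also have "\<dots> = 0" using u by (intro sum.neutral) auto
        finally show ?thesis by simp
      qed
      then have "dotp m (mvec n AP u) (mvec n AP u) = dotp m (mvec n (B k) u) (mvec n (B k) u)"
        by (simp add: dotp_def)
      also have "\<dots> \<le> s k * dotp n u u"
        using top[OF kr] unfolding top_rank_one_def s_def B_def by blast
      finally show "dotp m (mvec n AP u) (mvec n AP u) \<le> s k * dotp n u u" .
    qed
    moreover have "fro m n AP - fro m n (\<lambda>i j. AP i j - (\<Sum>k\<in>P. X' i k * Y' j k))
        = (\<Sum>i<m. \<Sum>j<n. if (i, j) \<in> S then D (i, j) else 0)"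
      unfolding fro_def sum_subtractf[symmetric]
    proof (intro sum.cong refl)
      fix i j assume ij: "i \<in> {..<m}" "j \<in> {..<n}"
      show "(AP i j)\<^sup>2 - (AP i j - (\<Sum>k\<in>P. X' i k * Y' j k))\<^sup>2 = (if (i, j) \<in> S then D (i, j) else 0)"
      proof (cases "(i, j) \<in> S")
        case True
        have "(\<Sum>l<r. X' i l * Y' j l) = (\<Sum>l | l \<in> P \<and> l < r. X' i l * Y' j l)"
          by (rule restr) (use XYS(2) off[OF True] ij in auto)
        moreover have "{l. l \<in> P \<and> l < r} = P" by (auto simp: P_def)
        ultimately show ?thesis using True by (simp add: AP_def D_def)
      next
        case False
        have "X' i l * Y' j l = 0" if "l \<in> P" for l
          using XYS(2)[of i j l] ij that False by (simp add: P_def)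
        then have "(\<Sum>l\<in>P. X' i l * Y' j l) = 0" by (intro sum.neutral) auto
        then show ?thesis by (simp add: AP_def False)
      qed
    qed
    moreover have "(\<Sum>i<m. \<Sum>j<n. if (i, j) \<in> S then D (i, j) else 0) = (\<Sum>x\<in>R \<inter> S. D x)"
      by (subst sum.inter_restrict) (auto simp: R_def sum.cartesian_product intro!: sum.cong)
    ultimately show ?thesis by (simp add: P_def)
  qed
  have disjT: "S \<inter> S' = {}" if "S \<in> T" "S' \<in> T" "S \<noteq> S'" for S S'
    using rank_one_supp_disjoint[OF disj] that by (auto simp: T_def)
  have "fro m n A - fro m n (\<lambda>i j. A i j - (\<Sum>k<r. X' i k * Y' j k)) = (\<Sum>x\<in>R. D x)"
    unfolding fro_def R_def sum_subtractf[symmetric] sum.cartesian_product D_def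
    by (intro sum.cong) auto
  \<comment> \<open>Outside all supports a feasible product is 0 and cannot change the loss.\<close>
  also have "\<dots> = (\<Sum>x\<in>(\<Union>S\<in>T. R \<inter> S). D x)"
  proof (intro sum.mono_neutral_right ballI)
    fix x assume "x \<in> R - (\<Union>S\<in>T. R \<inter> S)"
    moreover obtain i j where "x = (i, j)" by force
    ultimately have "i < m" "j < n" "\<forall>k<r. (i, j) \<notin> ?S k" by (auto simp: R_def T_def)
    then have "(\<Sum>k<r. X' i k * Y' j k) = 0" using XYS(2) by (intro sum.neutral) auto
    then show "D x = 0" using \<open>x = (i, j)\<close> by (simp add: D_def)
  qed (auto simp: R_def)
  also have "\<dots> = (\<Sum>S\<in>T. \<Sum>x\<in>R \<inter> S. D x)"
    using disjT by (intro sum.UNION_disjoint) (auto simp: R_def T_def)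
  also have "\<dots> \<le> (\<Sum>S\<in>T. \<Sum>k | k < r \<and> ?S k = S. s k)"
    by (intro sum_mono blk)
  also have "\<dots> = (\<Sum>k<r. s k)"
    using sum.group[of "{..<r}" T ?S s] by (simp add: T_def)
  finally show ?thesis using upper by simp
qed

section \<open>Program logic\<close>

text \<open>Total correctness with an upper bound on the cost, so that bounds can be rounded up and
  branches of different cost merged.\<close>

definition achieves :: "com \<Rightarrow> store \<Rightarrow> nat \<Rightarrow> (store \<Rightarrow> bool) \<Rightarrow> bool" where
  "achieves c s T Q \<longleftrightarrow> (\<exists>t s'. exec c s t s' \<and> t \<le> T \<and> Q s')"

lemma achieves_mono:
  assumes "achieves c s T P" "T \<le> U" "\<And>s'. P s' \<Longrightarrow> Q s'"
  shows "achieves c s U Q"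
  using assms unfolding achieves_def by (meson order_trans)

lemma achieves_Skip: "Q s \<Longrightarrow> achieves Skip s 1 Q"
  unfolding achieves_def using exec.Skip by blast

lemma achieves_IAssign:
  "Q (s\<lparr>ireg := (ireg s)(x := ival e s)\<rparr>) \<Longrightarrow> achieves (IAssign x e) s (1 + icost e) Q"
  unfolding achieves_def using exec.IAssign by blast

lemma achieves_RAssign:
  "Q (write_entry s a (ival e s) (ival f s) (rval g s)) \<Longrightarrow>
    achieves (RAssign a e f g) s (1 + icost e + icost f + rcost g) Q"
  unfolding achieves_def using exec.RAssign by blast

lemma achieves_MaxRoot:
  "Q (write_entry s a (ival e s) (ival f s)
      (largest_root (\<Sum>l\<le>ival h s. monom (rarr s b (ival g s) l) l))) \<Longrightarrow>
    achieves (MaxRoot a e f b g h) s (1 + icost e + icost f + icost g + icost h + (ival h s + 1)) Q"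
  unfolding achieves_def using exec.MaxRoot by blast

lemma achieves_Seq:
  assumes "achieves c s T P" "\<And>s'. P s' \<Longrightarrow> achieves d s' U Q"
  shows "achieves (Seq c d) s (T + U) Q"
  using assms unfolding achieves_def by (meson add_mono exec.Seq)

text \<open>For straight-line code: naming the intermediate store exactly keeps the following goals
  free of postconditions.\<close>

lemma achieves_Seq_eq:
  assumes "achieves c s T (\<lambda>s'. s' = s1)" "achieves d s1 U Q"
  shows "achieves (Seq c d) s (T + U) Q"
  using assms by (auto intro: achieves_Seq)

lemma achieves_Cond:
  assumes "bval b s \<Longrightarrow> achieves c s T Q" "\<not> bval b s \<Longrightarrow> achieves d s T Q"
  shows "achieves (Cond b c d) s (1 + bcost b + T) Q"
  using assms unfolding achieves_def
  by (cases "bval b s") (meson add_left_mono exec.CondTrue exec.CondFalse)+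

text \<open>\<open>Inv\<close> carries the number of rounds done and \<open>N\<close> bounds it. The
  guard may fail earlier, hence the exit index \<open>j\<close>; this covers loops whose length
  depends on the real data.\<close>

lemma achieves_Loop:
  assumes "\<And>i s. Inv i s \<Longrightarrow> bval b s \<Longrightarrow> i < N \<and> achieves c s T (Inv (Suc i))"
    and "Inv i s" "i \<le> N"
  shows "achieves (Loop b c) s ((N - i) * (1 + bcost b + T) + (1 + bcost b))
    (\<lambda>s'. \<exists>j\<le>N. Inv j s' \<and> \<not> bval b s')"
  using assms(2,3)
proof (induction "N - i" arbitrary: i s)
  case 0
  then have "\<not> bval b s" using assms(1) by fastforce
  with 0 show ?case unfolding achieves_def using exec.LoopFalse by fastforce
next
  case (Suc k)
  show ?case
  proof (cases "bval b s")
    case False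
    with Suc.prems show ?thesis unfolding achieves_def using exec.LoopFalse by fastforce
  next
    case True
    with assms(1)[OF Suc.prems(1)] have i: "i < N" and "achieves c s T (Inv (Suc i))" by auto
    then obtain t s1 where c: "exec c s t s1" "t \<le> T" "Inv (Suc i) s1"
      unfolding achieves_def by blast
    have "achieves (Loop b c) s1 ((N - Suc i) * (1 + bcost b + T) + (1 + bcost b))
      (\<lambda>s'. \<exists>j\<le>N. Inv j s' \<and> \<not> bval b s')"
      by (rule Suc.hyps(1)) (use Suc.hyps(2) i c(3) in auto)
    then obtain u s2 where l: "exec (Loop b c) s1 u s2"
      "u \<le> (N - Suc i) * (1 + bcost b + T) + (1 + bcost b)" "\<exists>j\<le>N. Inv j s2 \<and> \<not> bval b s2"
      unfolding achieves_def by blast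
    have "N - i = Suc (N - Suc i)" using i by simp
    then have "1 + bcost b + t + u \<le> (N - i) * (1 + bcost b + T) + (1 + bcost b)"
      using c(2) l(2) by simp
    with exec.LoopTrue[OF True c(1) l(1)] l(3) show ?thesis unfolding achieves_def by blast
  qed
qed

text \<open>Resetting the counter at the end lets a loop leave all registers as they were, if its
  counter was 0 before.\<close>

definition for_loop :: "nat \<Rightarrow> iexp \<Rightarrow> com \<Rightarrow> com" where
  "for_loop x e c = Seq (IAssign x (IConst 0))
     (Seq (Loop (ILess (IVar x) e) (Seq c (IAssign x (IAdd (IVar x) (IConst 1)))))
       (IAssign x (IConst 0)))"

text \<open>Besides the body, a round costs \<open>3 + icost e\<close> for the guard and 4 for the
  increment; the final test and the two assignments of 0 account for the rest.\<close>

lemma achieves_for_loop: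
  assumes "Inv 0 (s\<lparr>ireg := (ireg s)(x := 0)\<rparr>)"
    and "\<And>i s. Inv i s \<Longrightarrow> ireg s x = i \<and> ival e s = N"
    and "\<And>i s. i < N \<Longrightarrow> Inv i s \<Longrightarrow> achieves c s T
      (\<lambda>s'. ireg s' x = i \<and> Inv (Suc i) (s'\<lparr>ireg := (ireg s')(x := Suc i)\<rparr>))"
    and "\<And>s. Inv N s \<Longrightarrow> Q (s\<lparr>ireg := (ireg s)(x := 0)\<rparr>)"
  shows "achieves (for_loop x e c) s (N * (T + 7 + icost e) + icost e + 7) Q"
proof -
  have "achieves (for_loop x e c) s (2 + (((N - 0) * (1 + bcost (ILess (IVar x) e) + (T + 4))
      + (1 + bcost (ILess (IVar x) e))) + 2)) Q"
    unfolding for_loop_def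
  proof (rule achieves_Seq)
    show "achieves (IAssign x (IConst 0)) s 2 (Inv 0)"
      by (rule achieves_mono[OF achieves_IAssign]) (use assms(1) in auto)
  next
    fix s0 assume s0: "Inv 0 s0"
    show "achieves (Seq (Loop (ILess (IVar x) e) (Seq c (IAssign x (IAdd (IVar x) (IConst 1)))))
        (IAssign x (IConst 0))) s0 (((N - 0) * (1 + bcost (ILess (IVar x) e) + (T + 4))
      + (1 + bcost (ILess (IVar x) e))) + 2) Q"
    proof (rule achieves_Seq)
      show "achieves (Loop (ILess (IVar x) e) (Seq c (IAssign x (IAdd (IVar x) (IConst 1))))) s0
        ((N - 0) * (1 + bcost (ILess (IVar x) e) + (T + 4)) + (1 + bcost (ILess (IVar x) e)))
        (\<lambda>s'. \<exists>j\<le>N. Inv j s' \<and> \<not> bval (ILess (IVar x) e) s')"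
      proof (rule achieves_Loop[where Inv = Inv])
        fix i s assume I: "Inv i s" and b: "bval (ILess (IVar x) e) s"
        then have i: "i < N" using assms(2)[OF I] by simp
        have "achieves (Seq c (IAssign x (IAdd (IVar x) (IConst 1)))) s (T + 4) (Inv (Suc i))"
        proof (rule achieves_Seq[OF assms(3)[OF i I]])
          fix s' assume "ireg s' x = i \<and> Inv (Suc i) (s'\<lparr>ireg := (ireg s')(x := Suc i)\<rparr>)"
          then show "achieves (IAssign x (IAdd (IVar x) (IConst 1))) s' 4 (Inv (Suc i))"
            by (intro achieves_mono[OF achieves_IAssign, of "\<lambda>s. Inv (Suc i) s"]) auto
        qed
        with i show "i < N \<and> achieves (Seq c (IAssign x (IAdd (IVar x) (IConst 1)))) s (T + 4)
          (Inv (Suc i))" ..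
      qed (use s0 in auto)
    next
      fix s' assume "\<exists>j\<le>N. Inv j s' \<and> \<not> bval (ILess (IVar x) e) s'"
      then obtain j where j: "j \<le> N" "Inv j s'" "\<not> bval (ILess (IVar x) e) s'" by blast
      with assms(2)[OF j(2)] have "j = N" by auto
      with assms(4) j(2) have "Q (s'\<lparr>ireg := (ireg s')(x := 0)\<rparr>)" by blast
      then show "achieves (IAssign x (IConst 0)) s' 2 Q"
        by (intro achieves_mono[OF achieves_IAssign, of Q]) auto
    qed
  qed
  then show ?thesis by (rule achieves_mono) (auto simp: algebra_simps)
qed

section \<open>Loops that compute matrix-valued sums\<close>

primrec iregs :: "iexp \<Rightarrow> nat set" where
  "iregs (IConst c) = {}"
| "iregs (IVar x) = {x}"
| "iregs (IAdd e f) = iregs e \<union> iregs f"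
| "iregs (ISub e f) = iregs e \<union> iregs f"

primrec rarrs :: "rexp \<Rightarrow> nat set" where
  "rarrs (RConst c) = {}"
| "rarrs (REntry a e f) = {a}"
| "rarrs (RAdd e f) = rarrs e \<union> rarrs f"
| "rarrs (RSub e f) = rarrs e \<union> rarrs f"
| "rarrs (RMul e f) = rarrs e \<union> rarrs f"
| "rarrs (RDiv e f) = rarrs e \<union> rarrs f"

lemma ival_cong: "(\<And>x. x \<in> iregs e \<Longrightarrow> ireg s x = ireg s' x) \<Longrightarrow> ival e s = ival e s'"
  by (induction e) auto

lemma rval_cong:
  "ireg s = ireg s' \<Longrightarrow> (\<And>a. a \<in> rarrs f \<Longrightarrow> rarr s a = rarr s' a) \<Longrightarrow> rval f s = rval f s'"
proof (induction f)
  case (REntry a e f)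
  then have "ival e s = ival e s'" "ival f s = ival f s'" by (auto intro: ival_cong)
  with REntry show ?case by simp
qed auto

definition upd :: "nat \<Rightarrow> (nat \<Rightarrow> nat \<Rightarrow> real) \<Rightarrow> store \<Rightarrow> store" where
  "upd a F s = s\<lparr>rarr := (rarr s)(a := F)\<rparr>"

text \<open>The stores inside \<open>msum\<close> have the form
  \<open>regs i j l (upd a F s)\<close>, so only the three counters and one array have to be
  tracked.\<close>

definition regs :: "nat \<Rightarrow> nat \<Rightarrow> nat \<Rightarrow> store \<Rightarrow> store" where
  "regs i j l s = s\<lparr>ireg := (ireg s)(10 := i, 11 := j, 12 := l)\<rparr>"

lemma ireg_upd [simp]: "ireg (upd a F s) = ireg s"
  by (simp add: upd_def)

lemma rarr_upd [simp]: "rarr (upd a F s) = (rarr s)(a := F)"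
  by (simp add: upd_def)

lemma ireg_regs [simp]: "ireg (regs i j l s) = (ireg s)(10 := i, 11 := j, 12 := l)"
  by (simp add: regs_def)

lemma rarr_regs [simp]: "rarr (regs i j l s) = rarr s"
  by (simp add: regs_def)

lemma write_entry_upd: "write_entry s a i j x = upd a ((rarr s a)(i := (rarr s a i)(j := x))) s"
  by (simp add: write_entry_def upd_def)

text \<open>
  \<open>msum a o1 o2 p q e f\<close> stores \<open>\<Sum>l<e. f\<close> into entry \<open>(o1 + i, o2 + j)\<close> of array \<open>a\<close> for all
  \<open>i < p\<close>, \<open>j < q\<close>.  The expression \<open>f\<close> finds \<open>i\<close>, \<open>j\<close>, \<open>l\<close> in registers 10, 11, 12, which
  are 0 before and after.
\<close>

definition msum :: "nat \<Rightarrow> iexp \<Rightarrow> iexp \<Rightarrow> iexp \<Rightarrow> iexp \<Rightarrow> iexp \<Rightarrow> rexp \<Rightarrow> com" where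
  "msum a o1 o2 p q e f = for_loop 10 p (for_loop 11 q
     (Seq (RAssign a (IAdd o1 (IVar 10)) (IAdd o2 (IVar 11)) (RConst 0))
       (for_loop 12 e (RAssign a (IAdd o1 (IVar 10)) (IAdd o2 (IVar 11))
          (RAdd (REntry a (IAdd o1 (IVar 10)) (IAdd o2 (IVar 11))) f)))))"

text \<open>The summand is evaluated in the initial store; \<open>achieves_msum\<close> justifies
  this by requiring that \<open>f\<close> does not read the target array.\<close>

definition block_sum where
  "block_sum s a o1 o2 p q e f = (\<lambda>u v. if o1 \<le> u \<and> u < o1 + p \<and> o2 \<le> v \<and> v < o2 + q
     then \<Sum>l<e. rval f (regs (u - o1) (v - o2) l s) else rarr s a u v)"

text \<open>One bound for all calls: three nested loops of length below \<open>M\<close> give cubic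
  cost, and the limits 3 and 50 on expression sizes are generous enough for every call in the
  program.\<close>

lemma achieves_msum:
  assumes reg0: "ireg s 10 = 0" "ireg s 11 = 0" "ireg s 12 = 0"
    and af: "a \<notin> rarrs f"
    and free: "(iregs o1 \<union> iregs o2 \<union> iregs p \<union> iregs q \<union> iregs e) \<inter> {10, 11, 12} = {}"
    and lt: "ival p s < M" "ival q s < M" "ival e s < M"
    and cost: "icost o1 \<le> 3" "icost o2 \<le> 3" "icost p \<le> 3" "icost q \<le> 3" "icost e \<le> 3" "rcost f \<le> 50"
    and Q: "Q (upd a (block_sum s a (ival o1 s) (ival o2 s) (ival p s) (ival q s) (ival e s) f) s)"
  shows "achieves (msum a o1 o2 p q e f) s (100 * M ^ 3) Q"
proof -
  define P1 where "P1 = ival o1 s"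
  define P2 where "P2 = ival o2 s"
  define np where "np = ival p s"
  define nq where "nq = ival q s"
  define ne where "ne = ival e s"
  define g where "g i j l = rval f (regs i j l s)" for i j l
  \<comment> \<open>The target array once the rows before \<open>i\<close> and the first
    \<open>j\<close> entries of row \<open>i\<close> of the block are done. In
    \<open>arr' i j l\<close> entry \<open>j\<close> holds in addition a partial sum of
    \<open>l\<close> terms.\<close>
  define arr where "arr i j = (\<lambda>u v. if P1 \<le> u \<and> P2 \<le> v \<and>
      (u - P1 < i \<and> v - P2 < nq \<or> u - P1 = i \<and> v - P2 < j)
    then \<Sum>l<ne. g (u - P1) (v - P2) l else rarr s a u v)" for i j
  define arr' where "arr' i j l = (arr i j)(P1 + i := (arr i j (P1 + i))(P2 + j := \<Sum>l'<l. g i j l'))"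
    for i j l
  have iv: "ival d (regs i j l (upd a F s)) = ival d s"
    if "d \<in> {o1, o2, p, q, e}" for d i j l F
    using that free by (intro ival_cong) auto
  have rv: "rval f (regs i j l (upd a F s)) = g i j l" for i j l F
    unfolding g_def using af by (intro rval_cong) auto
  have reset: "(regs i j l s)\<lparr>ireg := (ireg (regs i j l s))(12 := x)\<rparr> = regs i j x s"
    "(regs i j l s)\<lparr>ireg := (ireg (regs i j l s))(11 := x)\<rparr> = regs i x l s"
    "(regs i j l s)\<lparr>ireg := (ireg (regs i j l s))(10 := x)\<rparr> = regs x j l s" for i j l x s
    by (simp_all add: regs_def fun_upd_twist)
  have wr: "write_entry (regs i j l (upd a F s)) a u v x
      = regs i j l (upd a (F(u := (F u)(v := x))) s)" for i j l F u v x
    by (simp add: write_entry_def regs_def upd_def)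
  have regs0: "regs 0 0 0 s = s" using reg0 by (simp add: regs_def fun_upd_idem)
  define T3 :: nat where "T3 = 1 + (2 + icost o1) + (2 + icost o2) + (1 + (1 + (2 + icost o1) + (2 + icost o2)) + rcost f)"
  have inner: "achieves (for_loop 12 e (RAssign a (IAdd o1 (IVar 10)) (IAdd o2 (IVar 11))
          (RAdd (REntry a (IAdd o1 (IVar 10)) (IAdd o2 (IVar 11))) f)))
      (regs i j 0 (upd a (arr' i j 0) s)) (ne * (T3 + 7 + icost e) + icost e + 7)
      (\<lambda>s'. s' = regs i j 0 (upd a (arr' i j ne) s))" for i j
  proof (rule achieves_for_loop[where Inv = "\<lambda>l s'. s' = regs i j l (upd a (arr' i j l) s)"])
    fix l s' assume "s' = regs i j l (upd a (arr' i j l) s)"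
    then show "ireg s' 12 = l \<and> ival e s' = ne" using iv[of e] by (simp add: ne_def)
  next
    fix l s' assume s': "s' = regs i j l (upd a (arr' i j l) s)"
    show "achieves (RAssign a (IAdd o1 (IVar 10)) (IAdd o2 (IVar 11))
          (RAdd (REntry a (IAdd o1 (IVar 10)) (IAdd o2 (IVar 11))) f)) s' T3
       (\<lambda>s'. ireg s' 12 = l \<and>
         s'\<lparr>ireg := (ireg s')(12 := Suc l)\<rparr> = regs i j (Suc l) (upd a (arr' i j (Suc l)) s))"
    proof (rule achieves_mono[where P = "\<lambda>s'. s' = regs i j l (upd a (arr' i j (Suc l)) s)", OF achieves_RAssign])
      show "write_entry s' a (ival (IAdd o1 (IVar 10)) s') (ival (IAdd o2 (IVar 11)) s')
         (rval (RAdd (REntry a (IAdd o1 (IVar 10)) (IAdd o2 (IVar 11))) f) s')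
        = regs i j l (upd a (arr' i j (Suc l)) s)"
        by (simp add: s' iv rv wr P1_def[symmetric] P2_def[symmetric] arr'_def)
    qed (auto simp: T3_def reset)
  qed (auto simp: reset)
  define T2 where "T2 = (1 + (2 + icost o1) + (2 + icost o2) + 1) + (ne * (T3 + 7 + icost e) + icost e + 7)"
  have arr_Suc: "arr' i j ne = arr i (Suc j)" if "j < nq" for i j
    using that by (intro ext) (auto simp: arr'_def arr_def)
  have row: "achieves (for_loop 11 q
     (Seq (RAssign a (IAdd o1 (IVar 10)) (IAdd o2 (IVar 11)) (RConst 0))
       (for_loop 12 e (RAssign a (IAdd o1 (IVar 10)) (IAdd o2 (IVar 11))
          (RAdd (REntry a (IAdd o1 (IVar 10)) (IAdd o2 (IVar 11))) f)))))
      (regs i 0 0 (upd a (arr i 0) s)) (nq * (T2 + 7 + icost q) + icost q + 7)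
      (\<lambda>s'. s' = regs i 0 0 (upd a (arr i nq) s))" for i
  proof (rule achieves_for_loop[where Inv = "\<lambda>j s'. s' = regs i j 0 (upd a (arr i j) s)"])
    fix j s' assume "s' = regs i j 0 (upd a (arr i j) s)"
    then show "ireg s' 11 = j \<and> ival q s' = nq" using iv[of q] by (simp add: nq_def)
  next
    fix j s' assume j: "j < nq" and s': "s' = regs i j 0 (upd a (arr i j) s)"
    show "achieves (Seq (RAssign a (IAdd o1 (IVar 10)) (IAdd o2 (IVar 11)) (RConst 0))
       (for_loop 12 e (RAssign a (IAdd o1 (IVar 10)) (IAdd o2 (IVar 11))
          (RAdd (REntry a (IAdd o1 (IVar 10)) (IAdd o2 (IVar 11))) f)))) s' T2
       (\<lambda>s'. ireg s' 11 = j \<and>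
         s'\<lparr>ireg := (ireg s')(11 := Suc j)\<rparr> = regs i (Suc j) 0 (upd a (arr i (Suc j)) s))"
      unfolding T2_def
    proof (rule achieves_Seq_eq)
      show "achieves (RAssign a (IAdd o1 (IVar 10)) (IAdd o2 (IVar 11)) (RConst 0)) s'
        (1 + (2 + icost o1) + (2 + icost o2) + 1) (\<lambda>s'. s' = regs i j 0 (upd a (arr' i j 0) s))"
        by (rule achieves_mono[where P = "\<lambda>s'. s' = regs i j 0 (upd a (arr' i j 0) s)", OF achieves_RAssign])
           (auto simp: s' iv wr P1_def[symmetric] P2_def[symmetric] arr'_def)
    qed (rule achieves_mono[OF inner], auto simp: regs_def fun_upd_twist arr_Suc j)
  qed (auto simp: regs_def fun_upd_twist)
  define T1 where "T1 = nq * (T2 + 7 + icost q) + icost q + 7"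
  have arr_row: "arr i nq = arr (Suc i) 0" for i
    by (intro ext) (auto simp: arr_def less_Suc_eq)
  have all: "achieves (msum a o1 o2 p q e f) s (np * (T1 + 7 + icost p) + icost p + 7)
      (\<lambda>s'. s' = upd a (arr np 0) s)"
    unfolding msum_def
  proof (rule achieves_for_loop[where Inv = "\<lambda>i s'. s' = regs i 0 0 (upd a (arr i 0) s)"])
    have "arr 0 0 = rarr s a" by (simp add: arr_def fun_eq_iff)
    then have "upd a (arr 0 0) s = s" by (simp add: upd_def)
    then show "s\<lparr>ireg := (ireg s)(10 := 0)\<rparr> = regs 0 0 0 (upd a (arr 0 0) s)"
      using reg0 regs0 by (simp add: fun_upd_idem)
  next
    fix i s' assume "s' = regs i 0 0 (upd a (arr i 0) s)"
    then show "ireg s' 10 = i \<and> ival p s' = np" using iv[of p] by (simp add: np_def)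
  next
    fix i s' assume s': "s' = regs i 0 0 (upd a (arr i 0) s)"
    show "achieves (for_loop 11 q
     (Seq (RAssign a (IAdd o1 (IVar 10)) (IAdd o2 (IVar 11)) (RConst 0))
       (for_loop 12 e (RAssign a (IAdd o1 (IVar 10)) (IAdd o2 (IVar 11))
          (RAdd (REntry a (IAdd o1 (IVar 10)) (IAdd o2 (IVar 11))) f))))) s' T1
       (\<lambda>s'. ireg s' 10 = i \<and>
         s'\<lparr>ireg := (ireg s')(10 := Suc i)\<rparr> = regs (Suc i) 0 0 (upd a (arr (Suc i) 0) s))"
      unfolding T1_def s'
      by (rule achieves_mono[OF row]) (auto simp: regs_def fun_upd_twist arr_row)
  qed (use reg0 in \<open>auto simp: reset regs_def fun_upd_idem\<close>)
  have "arr np 0 = block_sum s a (ival o1 s) (ival o2 s) (ival p s) (ival q s) (ival e s) f"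
    by (intro ext) (auto simp: arr_def block_sum_def P1_def P2_def np_def nq_def ne_def g_def)
  then have post: "\<And>s'. s' = upd a (arr np 0) s \<Longrightarrow> Q s'" using Q by simp
  have MM: "10 \<le> M * (85 * M)"
    by (rule order_trans[OF _ mult_le_mono[of 1 M 85 "85 * M"]]) (use lt in auto)
  \<comment> \<open>Expression sizes at their limits give 73; with loop overhead an innermost round
    costs at most 85. The strict bounds by \<open>M\<close> absorb the lower-order terms.\<close>
  have T3: "T3 \<le> 75" using cost by (simp add: T3_def)
  have "ne * (T3 + 7 + icost e) \<le> ne * 85" using T3 cost by (intro mult_left_mono) auto
  then have "T2 + 7 + icost q \<le> 85 * ne + 40" using cost unfolding T2_def by linarith
  also have "\<dots> \<le> 85 * M" using lt by (simp add: ne_def)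
  finally have "nq * (T2 + 7 + icost q) \<le> nq * (85 * M)" by (rule mult_left_mono) simp
  then have "T1 + 7 + icost p \<le> nq * (85 * M) + 20" using cost unfolding T1_def by linarith
  also have "\<dots> \<le> (nq + 1) * (85 * M)" using lt by simp
  also have "\<dots> \<le> M * (85 * M)" using lt by (intro mult_right_mono) (auto simp: nq_def)
  finally have "np * (T1 + 7 + icost p) \<le> np * (M * (85 * M))" by (rule mult_left_mono) simp
  then have "np * (T1 + 7 + icost p) + icost p + 7 \<le> np * (M * (85 * M)) + 10" using cost by linarith
  also have "\<dots> \<le> (np + 1) * (M * (85 * M))"
    using MM unfolding add_mult_distrib by linarith
  also have "\<dots> \<le> M * (M * (85 * M))" using lt by (intro mult_right_mono) (auto simp: np_def)
  also have "\<dots> \<le> 100 * M ^ 3" by (simp add: power3_eq_cube)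
  finally have le: "np * (T1 + 7 + icost p) + icost p + 7 \<le> 100 * M ^ 3" .
  show ?thesis by (rule achieves_mono[OF all le post])
qed

section \<open>The program\<close>

text \<open>
  Array 5 holds the product of the columns found so far, 6 the masked residual \<open>B\<close>, 7 its Gram
  matrix \<open>G\<close>, 8 and 9 the current and previous Lanczos matrices with squared norms in 15 and 16,
  11 and 12 (row 0) the corresponding polynomials, 17 and 18 the recursion coefficients,
  19 the eigenvalue, 20 and 21 the Horner scheme for \<open>V\<close>, and 14 row norms; 10, 13 and 22 are temporary.
  Register 3 is the column index, 4 the number of Lanczos steps, 5 the Horner index and 6
  the chosen row of \<open>V\<close>.
\<close>

abbreviation "mset_sum a \<equiv> msum a (IConst 0) (IConst 0)"
abbreviation "scalar a \<equiv> REntry a (IConst 0) (IConst 0)"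
abbreviation "iX \<equiv> IVar 10"
abbreviation "iY \<equiv> IVar 11"
abbreviation "iZ \<equiv> IVar 12"

lemma block_sum_inside:
  "o1 \<le> u \<Longrightarrow> u < o1 + p \<Longrightarrow> o2 \<le> v \<Longrightarrow> v < o2 + q \<Longrightarrow>
    block_sum s a o1 o2 p q e f u v = (\<Sum>l<e. rval f (regs (u - o1) (v - o2) l s))"
  by (simp add: block_sum_def)

text \<open>\<open>msum\<close> has a single summation index, so the double sum passes through row
  norms in array 14.\<close>

definition norm_com :: com where
  "norm_com = Seq (mset_sum 14 (IVar 0) (IConst 1) (IVar 1) (RMul (REntry 8 iX iZ) (REntry 8 iX iZ)))
     (mset_sum 15 (IConst 1) (IConst 1) (IVar 0) (REntry 14 iZ (IConst 0)))"

lemma achieves_norm_com: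
  assumes "ireg s 10 = 0" "ireg s 11 = 0" "ireg s 12 = 0" "ireg s 0 < M" "ireg s 1 < M" "1 < M"
  shows "achieves norm_com s (200 * M ^ 3) (\<lambda>s'. ireg s' = ireg s \<and>
    (\<forall>a. a \<noteq> 14 \<and> a \<noteq> 15 \<longrightarrow> rarr s' a = rarr s a) \<and>
    rarr s' 15 0 0 = ip (ireg s 0) (ireg s 1) (rarr s 8) (rarr s 8))"
proof -
  define s1 where "s1 = upd 14 (block_sum s 14 0 0 (ireg s 0) 1 (ireg s 1)
    (RMul (REntry 8 iX iZ) (REntry 8 iX iZ))) s"
  have "achieves norm_com s (100 * M ^ 3 + 100 * M ^ 3) (\<lambda>s'. ireg s' = ireg s \<and>
    (\<forall>a. a \<noteq> 14 \<and> a \<noteq> 15 \<longrightarrow> rarr s' a = rarr s a) \<and>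
    rarr s' 15 0 0 = ip (ireg s 0) (ireg s 1) (rarr s 8) (rarr s 8))"
    unfolding norm_com_def
  proof (rule achieves_Seq_eq)
    show "achieves (mset_sum 14 (IVar 0) (IConst 1) (IVar 1) (RMul (REntry 8 iX iZ) (REntry 8 iX iZ)))
      s (100 * M ^ 3) (\<lambda>s'. s' = s1)"
      by (rule achieves_msum) (use assms in \<open>simp_all add: s1_def\<close>)
    show "achieves (mset_sum 15 (IConst 1) (IConst 1) (IVar 0) (REntry 14 iZ (IConst 0)))
      s1 (100 * M ^ 3) (\<lambda>s'. ireg s' = ireg s \<and>
    (\<forall>a. a \<noteq> 14 \<and> a \<noteq> 15 \<longrightarrow> rarr s' a = rarr s a) \<and>
    rarr s' 15 0 0 = ip (ireg s 0) (ireg s 1) (rarr s 8) (rarr s 8))"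
      by (rule achieves_msum) (use assms in \<open>simp_all add: s1_def block_sum_inside ip_def\<close>)
  qed
  then show ?thesis by simp
qed

text \<open>The new matrix needs both old ones and is therefore built in array 21; array 8 moves to
  9 before it is overwritten.\<close>

definition step_com :: com where
  "step_com =
     Seq (mset_sum 10 (IVar 0) (IVar 1) (IVar 1) (RMul (REntry 8 iX iZ) (REntry 7 iZ iY)))
    (Seq (mset_sum 14 (IVar 0) (IConst 1) (IVar 1) (RMul (REntry 10 iX iZ) (REntry 8 iX iZ)))
    (Seq (mset_sum 17 (IConst 1) (IConst 1) (IVar 0) (RDiv (REntry 14 iZ (IConst 0)) (scalar 15)))
    (Seq (RAssign 18 (IConst 0) (IConst 0) (RDiv (scalar 15) (scalar 16)))
    (Seq (mset_sum 21 (IVar 0) (IVar 1) (IConst 1)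
           (RSub (RSub (REntry 10 iX iY) (RMul (scalar 17) (REntry 8 iX iY)))
             (RMul (scalar 18) (REntry 9 iX iY))))
    (Seq (mset_sum 9 (IVar 0) (IVar 1) (IConst 1) (REntry 8 iX iY))
         (mset_sum 8 (IVar 0) (IVar 1) (IConst 1) (REntry 21 iX iY)))))))"

lemma achieves_step_com:
  fixes s :: store and M :: nat
  defines "m \<equiv> ireg s 0" and "n \<equiv> ireg s 1"
  defines "S \<equiv> mmul n (rarr s 8) (rarr s 7)"
  defines "a \<equiv> ip m n S (rarr s 8) / rarr s 15 0 0" and "b \<equiv> rarr s 15 0 0 / rarr s 16 0 0"
  assumes "ireg s 10 = 0" "ireg s 11 = 0" "ireg s 12 = 0" "m < M" "n < M" "1 < M"
  shows "achieves step_com s (700 * M ^ 3) (\<lambda>s'. ireg s' = ireg s \<and>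
    (\<forall>a. a \<notin> {8, 9, 10, 14, 17, 18, 21} \<longrightarrow> rarr s' a = rarr s a) \<and>
    rarr s' 17 0 0 = a \<and> rarr s' 18 0 0 = b \<and>
    (\<forall>i<m. \<forall>j<n. rarr s' 9 i j = rarr s 8 i j \<and>
      rarr s' 8 i j = S i j - a * rarr s 8 i j - b * rarr s 9 i j))"
    (is "achieves _ _ _ ?Q")
proof -
  define s1 where "s1 = upd 10 (block_sum s 10 0 0 m n n
    (RMul (REntry 8 iX iZ) (REntry 7 iZ iY))) s"
  define s2 where "s2 = upd 14 (block_sum s1 14 0 0 m 1 n
    (RMul (REntry 10 iX iZ) (REntry 8 iX iZ))) s1"
  define s3 where "s3 = upd 17 (block_sum s2 17 0 0 1 1 m
    (RDiv (REntry 14 iZ (IConst 0)) (scalar 15))) s2"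
  define s4 where "s4 = upd 18 ((rarr s3 18)(0 := (rarr s3 18 0)(0 := b))) s3"
  define s5 where "s5 = upd 21 (block_sum s4 21 0 0 m n 1
    (RSub (RSub (REntry 10 iX iY) (RMul (scalar 17) (REntry 8 iX iY)))
       (RMul (scalar 18) (REntry 9 iX iY)))) s4"
  define s6 where "s6 = upd 9 (block_sum s5 9 0 0 m n 1 (REntry 8 iX iY)) s5"
  have reg: "ireg s1 = ireg s" "ireg s2 = ireg s" "ireg s3 = ireg s" "ireg s4 = ireg s"
    "ireg s5 = ireg s" "ireg s6 = ireg s"
    by (simp_all add: s1_def s2_def s3_def s4_def s5_def s6_def)
  note r = assms(6-) reg m_def[symmetric] n_def[symmetric]
  have S: "rarr s1 10 i j = S i j" if "i < m" "j < n" for i j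
    using that by (simp add: s1_def block_sum_inside S_def mmul_def)
  have R: "rarr s2 14 i 0 = (\<Sum>l<n. S i l * rarr s 8 i l)" if "i < m" for i
    using that S by (simp add: s2_def block_sum_inside) (simp add: s1_def)
  have a: "rarr s3 17 0 0 = a"
    using R by (simp add: s3_def block_sum_inside a_def ip_def sum_divide_distrib) (simp add: s1_def s2_def)
  have b15: "rarr s3 15 0 0 = rarr s 15 0 0" "rarr s3 16 0 0 = rarr s 16 0 0"
    by (simp_all add: s1_def s2_def s3_def)
  have old: "rarr s4 10 = rarr s1 10" "rarr s4 8 = rarr s 8" "rarr s4 9 = rarr s 9"
    "rarr s4 17 = rarr s3 17" "rarr s4 18 0 0 = b"
    by (simp_all add: s1_def s2_def s3_def s4_def)
  have U: "rarr s5 21 i j = S i j - a * rarr s 8 i j - b * rarr s 9 i j" if "i < m" "j < n" for i j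
    using that by (simp add: s5_def block_sum_inside old a S)
  have s5: "rarr s5 8 = rarr s 8" by (simp add: s5_def old)
  have "achieves step_com s (100 * M ^ 3 + (100 * M ^ 3 + (100 * M ^ 3 + (12 +
    (100 * M ^ 3 + (100 * M ^ 3 + 100 * M ^ 3)))))) ?Q"
    unfolding step_com_def
  proof (rule achieves_Seq_eq[of _ _ _ s1], goal_cases)
    case 1 show ?case by (rule achieves_msum) (use r in \<open>simp_all add: s1_def\<close>)
  next
    case 2 show ?case
    proof (rule achieves_Seq_eq[of _ _ _ s2], goal_cases)
      case 1 show ?case by (rule achieves_msum) (use r in \<open>simp_all add: s2_def\<close>)
    next
      case 2 show ?case
      proof (rule achieves_Seq_eq[of _ _ _ s3], goal_cases)
        case 1 show ?case by (rule achieves_msum) (use r in \<open>simp_all add: s3_def\<close>)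
      next
        case 2 show ?case
        proof (rule achieves_Seq_eq[of _ _ _ s4], goal_cases)
          case 1 show ?case
            by (rule achieves_mono[where P = "\<lambda>s'. s' = s4", OF achieves_RAssign])
               (simp_all add: s4_def write_entry_upd b_def b15)
        next
          case 2 show ?case
          proof (rule achieves_Seq_eq[of _ _ _ s5], goal_cases)
            case 1 show ?case by (rule achieves_msum) (use r in \<open>simp_all add: s5_def\<close>)
          next
            case 2 show ?case
            proof (rule achieves_Seq_eq[of _ _ _ s6], goal_cases)
              case 1 show ?case by (rule achieves_msum) (use r in \<open>simp_all add: s6_def\<close>)
            next
              case 2 show ?case
                apply (rule achieves_msum)
                            apply (use r in simp_all)
                apply (auto simp: block_sum_inside s6_def U s5)
                   apply (simp_all add: s5_def old a)
                apply (auto simp: s4_def s3_def s2_def s1_def)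
                done
            qed
          qed
        qed
      qed
    qed
  qed
  moreover have "1 \<le> M ^ 3" using assms by simp
  ultimately show ?thesis by (elim achieves_mono) auto
qed

text \<open>Entry \<open>d + 1\<close> of both polynomials is cleared because it may be left over
  from an earlier column of the factorization. Array 13 is the current polynomial shifted by one
  degree, that is, multiplied by the variable.\<close>

definition poly_com :: com where
  "poly_com =
     Seq (RAssign 11 (IConst 0) (IAdd (IVar 4) (IConst 1)) (RConst 0))
    (Seq (RAssign 12 (IConst 0) (IAdd (IVar 4) (IConst 1)) (RConst 0))
    (Seq (RAssign 13 (IConst 0) (IConst 0) (RConst 0))
    (Seq (msum 13 (IConst 0) (IConst 1) (IConst 1) (IAdd (IVar 4) (IConst 1)) (IConst 1)
           (REntry 11 (IConst 0) iY))
    (Seq (mset_sum 22 (IConst 1) (IAdd (IVar 4) (IConst 2)) (IConst 1)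
           (RSub (RSub (REntry 13 (IConst 0) iY) (RMul (scalar 17) (REntry 11 (IConst 0) iY)))
             (RMul (scalar 18) (REntry 12 (IConst 0) iY))))
    (Seq (mset_sum 12 (IConst 1) (IAdd (IVar 4) (IConst 2)) (IConst 1) (REntry 11 (IConst 0) iY))
         (mset_sum 11 (IConst 1) (IAdd (IVar 4) (IConst 2)) (IConst 1) (REntry 22 (IConst 0) iY)))))))"

lemma achieves_poly_com:
  fixes s :: store and M :: nat
  defines "d \<equiv> ireg s 4" and "a \<equiv> rarr s 17 0 0" and "b \<equiv> rarr s 18 0 0"
  defines "p \<equiv> \<lambda>l. if l \<le> d then rarr s 11 0 l else 0" and "p' \<equiv> \<lambda>l. if l \<le> d then rarr s 12 0 l else 0"
  assumes "ireg s 10 = 0" "ireg s 11 = 0" "ireg s 12 = 0" "d + 2 < M"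
  shows "achieves poly_com s (500 * M ^ 3) (\<lambda>s'. ireg s' = ireg s \<and>
    (\<forall>a. a \<notin> {11, 12, 13, 22} \<longrightarrow> rarr s' a = rarr s a) \<and>
    (\<forall>l\<le>Suc d. rarr s' 12 0 l = p l \<and>
      rarr s' 11 0 l = (if l = 0 then 0 else p (l - 1)) - a * p l - b * p' l))"
    (is "achieves _ _ _ ?Q")
proof -
  define s1 where "s1 = upd 11 ((rarr s 11)(0 := (rarr s 11 0)(Suc d := 0))) s"
  define s2 where "s2 = upd 12 ((rarr s1 12)(0 := (rarr s1 12 0)(Suc d := 0))) s1"
  define s3 where "s3 = upd 13 ((rarr s2 13)(0 := (rarr s2 13 0)(0 := 0))) s2"
  define s4 where "s4 = upd 13 (block_sum s3 13 0 1 1 (Suc d) 1 (REntry 11 (IConst 0) iY)) s3"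
  define s5 where "s5 = upd 22 (block_sum s4 22 0 0 1 (d + 2) 1
    (RSub (RSub (REntry 13 (IConst 0) iY) (RMul (scalar 17) (REntry 11 (IConst 0) iY)))
             (RMul (scalar 18) (REntry 12 (IConst 0) iY)))) s4"
  define s6 where "s6 = upd 12 (block_sum s5 12 0 0 1 (d + 2) 1 (REntry 11 (IConst 0) iY)) s5"
  have reg: "ireg s1 = ireg s" "ireg s2 = ireg s" "ireg s3 = ireg s" "ireg s4 = ireg s"
    "ireg s5 = ireg s" "ireg s6 = ireg s"
    by (simp_all add: s1_def s2_def s3_def s4_def s5_def s6_def)
  note r = assms(6-) reg d_def[symmetric]
  have p: "rarr s4 11 0 l = p l" "rarr s4 12 0 l = p' l" if "l \<le> Suc d" for l
    using that by (auto simp: s1_def s2_def s3_def s4_def p_def p'_def)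
  have sh: "rarr s4 13 0 l = (if l = 0 then 0 else p (l - 1))" if "l \<le> Suc d" for l
    using that
    by (auto simp: s4_def block_sum_def) (auto simp: s1_def s2_def s3_def p_def)
  have old: "rarr s4 17 0 0 = a" "rarr s4 18 0 0 = b"
    by (simp_all add: s1_def s2_def s3_def s4_def a_def b_def)
  have U: "rarr s5 22 0 l = (if l = 0 then 0 else p (l - 1)) - a * p l - b * p' l" if "l \<le> Suc d" for l
    using that by (simp add: s5_def block_sum_inside old p sh)
  have s5: "rarr s5 11 = rarr s4 11" by (simp add: s5_def)
  have "achieves poly_com s (10 + (10 + (10 + (100 * M ^ 3 +
    (100 * M ^ 3 + (100 * M ^ 3 + 100 * M ^ 3)))))) ?Q"
    unfolding poly_com_def
  proof (rule achieves_Seq_eq[of _ _ _ s1], goal_cases)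
    case 1 show ?case
      by (rule achieves_mono[where P = "\<lambda>s'. s' = s1", OF achieves_RAssign])
         (simp_all add: s1_def write_entry_upd d_def)
  next
    case 2 show ?case
    proof (rule achieves_Seq_eq[of _ _ _ s2], goal_cases)
      case 1 show ?case
        by (rule achieves_mono[where P = "\<lambda>s'. s' = s2", OF achieves_RAssign])
           (simp_all add: s2_def write_entry_upd d_def reg)
    next
      case 2 show ?case
      proof (rule achieves_Seq_eq[of _ _ _ s3], goal_cases)
        case 1 show ?case
          by (rule achieves_mono[where P = "\<lambda>s'. s' = s3", OF achieves_RAssign])
             (simp_all add: s3_def write_entry_upd)
      next
        case 2 show ?case
        proof (rule achieves_Seq_eq[of _ _ _ s4], goal_cases)
          case 1 show ?case by (rule achieves_msum) (use r in \<open>simp_all add: s4_def\<close>)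
        next
          case 2 show ?case
          proof (rule achieves_Seq_eq[of _ _ _ s5], goal_cases)
            case 1 show ?case by (rule achieves_msum) (use r in \<open>simp_all add: s5_def\<close>)
          next
            case 2 show ?case
            proof (rule achieves_Seq_eq[of _ _ _ s6], goal_cases)
              case 1 show ?case by (rule achieves_msum) (use r in \<open>simp_all add: s6_def\<close>)
            next
              case 2 show ?case
                apply (rule achieves_msum)
                            apply (use r in simp_all)
                apply (auto simp: block_sum_inside s6_def U s5 p)
                apply (auto simp: s5_def s4_def s3_def s2_def s1_def)
                done
            qed
          qed
        qed
      qed
    qed
  qed
  moreover have "1 \<le> M ^ 3" using assms by simp
  ultimately show ?thesis by (elim achieves_mono) auto
qed

section \<open>Invariant of the Lanczos loop\<close>

lemma mmul_cong:
  "(\<And>l. l < n \<Longrightarrow> P i l = P' i l \<and> G l j = G' l j) \<Longrightarrow> mmul n P G i j = mmul n P' G' i j"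
  by (simp add: mmul_def)

lemma ip_cong:
  "(\<And>i j. i < m \<Longrightarrow> j < n \<Longrightarrow> P i j = P' i j \<and> Q i j = Q' i j) \<Longrightarrow> ip m n P Q = ip m n P' Q'"
  by (simp add: ip_def)

text \<open>Frame condition for the work on one column: arrays 0 to 7 hold the data, the factors,
  their product, the residual and its Gram matrix, and registers 4 to 6 are scratch.\<close>

definition keeps :: "store \<Rightarrow> store \<Rightarrow> bool" where
  "keeps s s' \<longleftrightarrow> (\<forall>a<8. rarr s' a = rarr s a) \<and> (\<forall>x. x \<notin> {4, 5, 6} \<longrightarrow> ireg s' x = ireg s x)"

lemma keeps_trans: "keeps s s' \<Longrightarrow> keeps s' s'' \<Longrightarrow> keeps s s''"
  by (simp add: keeps_def)

text \<open>Agreement is demanded at indices in range only; elsewhere the arrays may hold stale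
  values.\<close>

definition lz_state where
  "lz_state m n G B d s \<longleftrightarrow> ireg s 4 = d \<and>
    (\<forall>i<m. \<forall>j<n. rarr s 8 i j = fst (lzQ m n G B d) i j \<and> rarr s 9 i j = snd (lzQ m n G B d) i j) \<and>
    (\<forall>l\<le>d. rarr s 11 0 l = fst (lzp m n G B d) l \<and> rarr s 12 0 l = snd (lzp m n G B d) l) \<and>
    rarr s 15 0 0 = ip m n (fst (lzQ m n G B d)) (fst (lzQ m n G B d)) \<and>
    rarr s 16 0 0 = ip m n (snd (lzQ m n G B d)) (snd (lzQ m n G B d))"

text \<open>\<open>poly_com\<close> uses register 4 as the degree and so runs before the increment;
  array 15 is saved in 16 before \<open>norm_com\<close> overwrites it.\<close>

definition lanczos_step_com :: com where
  "lanczos_step_com = Seq step_com (Seq poly_com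
    (Seq (IAssign 4 (IAdd (IVar 4) (IConst 1)))
    (Seq (RAssign 16 (IConst 0) (IConst 0) (scalar 15)) norm_com)))"

lemma achieves_lanczos_step_com:
  assumes st: "lz_state m n G B d s" and G: "\<And>i j. i < n \<Longrightarrow> j < n \<Longrightarrow> rarr s 7 i j = G i j"
    and reg: "ireg s 0 = m" "ireg s 1 = n" "ireg s 10 = 0" "ireg s 11 = 0" "ireg s 12 = 0"
    and M: "m < M" "n < M" "d + 2 < M"
  shows "achieves lanczos_step_com s (2000 * M ^ 3) (\<lambda>s'. keeps s s' \<and> lz_state m n G B (Suc d) s')"
proof -
  let ?Q = "fst (lzQ m n G B d)" and ?Q' = "snd (lzQ m n G B d)"
  let ?p = "fst (lzp m n G B d)" and ?p' = "snd (lzp m n G B d)"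
  define a where "a = lz_alpha m n G ?Q"
  define b where "b = lz_beta m n ?Q ?Q'"
  have d: "ireg s 4 = d" and Q: "\<And>i j. i < m \<Longrightarrow> j < n \<Longrightarrow> rarr s 8 i j = ?Q i j"
    and Q': "\<And>i j. i < m \<Longrightarrow> j < n \<Longrightarrow> rarr s 9 i j = ?Q' i j"
    and p: "\<And>l. l \<le> d \<Longrightarrow> rarr s 11 0 l = ?p l" "\<And>l. l \<le> d \<Longrightarrow> rarr s 12 0 l = ?p' l"
    and nu: "rarr s 15 0 0 = ip m n ?Q ?Q" "rarr s 16 0 0 = ip m n ?Q' ?Q'"
    using st by (auto simp: lz_state_def)
  have S: "mmul n (rarr s 8) (rarr s 7) i j = mmul n ?Q G i j" if "i < m" "j < n" for i j
    using that by (intro mmul_cong) (auto simp: Q G)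
  have ipS: "ip m n (mmul n (rarr s 8) (rarr s 7)) (rarr s 8) = ip m n (mmul n ?Q G) ?Q"
    by (intro ip_cong) (auto simp: Q S)
  have ab: "ip m n (mmul n (rarr s 8) (rarr s 7)) (rarr s 8) / rarr s 15 0 0 = a"
    "rarr s 15 0 0 / rarr s 16 0 0 = b"
    unfolding ipS nu by (simp_all add: a_def b_def lz_alpha_def lz_beta_def)
  have pp: "(if l \<le> d then rarr s 11 0 l else 0) = ?p l"
    "(if l \<le> d then rarr s 12 0 l else 0) = ?p' l" for l
    using lzp_zero[of d l m n G B] by (auto simp: p)
  have step: "achieves step_com s (700 * M ^ 3) (\<lambda>s'. ireg s' = ireg s \<and>
    (\<forall>a. a \<notin> {8, 9, 10, 14, 17, 18, 21} \<longrightarrow> rarr s' a = rarr s a) \<and>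
    rarr s' 17 0 0 = a \<and> rarr s' 18 0 0 = b \<and>
    (\<forall>i<m. \<forall>j<n. rarr s' 9 i j = ?Q i j \<and> rarr s' 8 i j = fst (lzQ m n G B (Suc d)) i j))"
    by (rule achieves_mono[OF achieves_step_com[of s M, unfolded reg ab]])
       (use M in \<open>auto simp: fst_lzQ_Suc S Q Q' simp flip: a_def b_def\<close>)
  have "achieves lanczos_step_com s
    (700 * M ^ 3 + (500 * M ^ 3 + (4 + (6 + 200 * M ^ 3))))
    (\<lambda>s'. keeps s s' \<and> lz_state m n G B (Suc d) s')"
    unfolding lanczos_step_com_def
  proof (rule achieves_Seq[OF step])
    fix s1 :: store assume s1: "ireg s1 = ireg s \<and>
      (\<forall>a. a \<notin> {8, 9, 10, 14, 17, 18, 21} \<longrightarrow> rarr s1 a = rarr s a) \<and>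
      rarr s1 17 0 0 = a \<and> rarr s1 18 0 0 = b \<and>
      (\<forall>i<m. \<forall>j<n. rarr s1 9 i j = ?Q i j \<and> rarr s1 8 i j = fst (lzQ m n G B (Suc d)) i j)"
    then have e: "ireg s1 4 = d" "rarr s1 11 = rarr s 11" "rarr s1 12 = rarr s 12"
      "rarr s1 17 0 0 = a" "rarr s1 18 0 0 = b" using d by auto
    have poly: "achieves poly_com s1 (500 * M ^ 3) (\<lambda>s'. ireg s' = ireg s \<and>
      (\<forall>a. a \<notin> {11, 12, 13, 22} \<longrightarrow> rarr s' a = rarr s1 a) \<and>
      (\<forall>l\<le>Suc d. rarr s' 12 0 l = ?p l \<and> rarr s' 11 0 l = fst (lzp m n G B (Suc d)) l))"
      by (rule achieves_mono[OF achieves_poly_com[of s1 M, unfolded e pp]])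
         (use reg M s1 in \<open>auto simp: fst_lzp_Suc simp flip: a_def b_def\<close>)
    show "achieves (Seq poly_com (Seq (IAssign 4 (IAdd (IVar 4) (IConst 1)))
        (Seq (RAssign 16 (IConst 0) (IConst 0) (scalar 15)) norm_com))) s1
      (500 * M ^ 3 + (4 + (6 + 200 * M ^ 3)))
      (\<lambda>s'. keeps s s' \<and> lz_state m n G B (Suc d) s')"
    proof (rule achieves_Seq[OF poly])
      fix s2 :: store assume s2: "ireg s2 = ireg s \<and>
        (\<forall>a. a \<notin> {11, 12, 13, 22} \<longrightarrow> rarr s2 a = rarr s1 a) \<and>
        (\<forall>l\<le>Suc d. rarr s2 12 0 l = ?p l \<and> rarr s2 11 0 l = fst (lzp m n G B (Suc d)) l)"
      define s3 where "s3 = s2\<lparr>ireg := (ireg s2)(4 := Suc d)\<rparr>"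
      define s4 where "s4 = upd 16 ((rarr s3 16)(0 := (rarr s3 16 0)(0 := rarr s3 15 0 0))) s3"
      show "achieves (Seq (IAssign 4 (IAdd (IVar 4) (IConst 1)))
        (Seq (RAssign 16 (IConst 0) (IConst 0) (scalar 15)) norm_com)) s2
        (4 + (6 + 200 * M ^ 3)) (\<lambda>s'. keeps s s' \<and> lz_state m n G B (Suc d) s')"
      proof (rule achieves_Seq_eq[of _ _ _ s3], goal_cases)
        case 1 show ?case
          by (rule achieves_mono[where P = "\<lambda>s'. s' = s3", OF achieves_IAssign])
             (use s2 d in \<open>simp_all add: s3_def\<close>)
      next
        case 2 show ?case
        proof (rule achieves_Seq_eq[of _ _ _ s4], goal_cases)
          case 1 show ?case
            by (rule achieves_mono[where P = "\<lambda>s'. s' = s4", OF achieves_RAssign])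
               (simp_all add: s4_def write_entry_upd)
        next
          case 2
          have s48: "rarr s4 8 i j = fst (lzQ m n G B (Suc d)) i j" if "i < m" "j < n" for i j
            using s1 s2 that by (simp add: s4_def s3_def)
          have ip4: "ip m n (rarr s4 8) (rarr s4 8)
            = ip m n (fst (lzQ m n G B (Suc d))) (fst (lzQ m n G B (Suc d)))"
            by (rule ip_cong) (simp add: s48)
          have r4: "ireg s4 = (ireg s)(4 := Suc d)" using s2 by (simp add: s4_def s3_def)
          show ?case
          proof (rule achieves_mono[OF achieves_norm_com, of s4 M])
            fix s' :: store assume s': "ireg s' = ireg s4 \<and>
              (\<forall>a. a \<noteq> 14 \<and> a \<noteq> 15 \<longrightarrow> rarr s' a = rarr s4 a) \<and>
              rarr s' 15 0 0 = ip (ireg s4 0) (ireg s4 1) (rarr s4 8) (rarr s4 8)"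
            have "keeps s s'" using s1 s2 s'
              by (simp add: keeps_def r4) (simp add: s4_def s3_def)
            moreover have "lz_state m n G B (Suc d) s'"
              using s' reg s48 ip4 nu s1 s2
              by (simp add: lz_state_def r4 del: One_nat_def) (simp add: s4_def s3_def)
            ultimately show "keeps s s' \<and> lz_state m n G B (Suc d) s'" ..
          qed (use reg M r4 in auto)
        qed
      qed
    qed
  qed
  moreover have "1 \<le> M ^ 3" using M by simp
  ultimately show ?thesis by (elim achieves_mono) auto
qed

section \<open>The masked residual and the complete Lanczos run\<close>

definition resid_com :: com where
  "resid_com =
     Seq (mset_sum 5 (IVar 0) (IVar 1) (IVar 3) (RMul (REntry 3 iX iZ) (REntry 4 iY iZ)))
    (Seq (mset_sum 6 (IVar 0) (IVar 1) (IConst 1) (RMul (RSub (REntry 0 iX iY) (REntry 5 iX iY))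
           (RMul (REntry 1 iX (IVar 3)) (REntry 2 iY (IVar 3)))))
         (mset_sum 7 (IVar 1) (IVar 1) (IVar 0) (RMul (REntry 6 iZ iX) (REntry 6 iZ iY))))"

lemma achieves_resid_com:
  fixes s :: store and M :: nat
  defines "m \<equiv> ireg s 0" and "n \<equiv> ireg s 1" and "k \<equiv> ireg s 3"
  defines "B \<equiv> \<lambda>i j. (rarr s 0 i j - (\<Sum>l<k. rarr s 3 i l * rarr s 4 j l)) * (rarr s 1 i k * rarr s 2 j k)"
  assumes "ireg s 10 = 0" "ireg s 11 = 0" "ireg s 12 = 0" "m < M" "n < M" "k < M" "1 < M"
  shows "achieves resid_com s (300 * M ^ 3) (\<lambda>s'. ireg s' = ireg s \<and>
    (\<forall>a. a \<notin> {5, 6, 7} \<longrightarrow> rarr s' a = rarr s a) \<and>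
    (\<forall>i<m. \<forall>j<n. rarr s' 6 i j = B i j) \<and> (\<forall>i<n. \<forall>j<n. rarr s' 7 i j = gram m B i j))"
    (is "achieves _ _ _ ?Q")
proof -
  define s1 where "s1 = upd 5 (block_sum s 5 0 0 m n k (RMul (REntry 3 iX iZ) (REntry 4 iY iZ))) s"
  define s2 where "s2 = upd 6 (block_sum s1 6 0 0 m n 1 (RMul (RSub (REntry 0 iX iY) (REntry 5 iX iY))
           (RMul (REntry 1 iX (IVar 3)) (REntry 2 iY (IVar 3))))) s1"
  have reg: "ireg s1 = ireg s" "ireg s2 = ireg s" by (simp_all add: s1_def s2_def)
  note r = assms(5-) reg m_def[symmetric] n_def[symmetric] k_def[symmetric]
  have T: "rarr s1 5 i j = (\<Sum>l<k. rarr s 3 i l * rarr s 4 j l)" if "i < m" "j < n" for i j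
    using that by (simp add: s1_def block_sum_inside)
  have B: "rarr s2 6 i j = B i j" if "i < m" "j < n" for i j
    using that by (simp add: s2_def block_sum_inside T r B_def) (simp add: s1_def)
  have "achieves resid_com s (100 * M ^ 3 + (100 * M ^ 3 + 100 * M ^ 3)) ?Q"
    unfolding resid_com_def
  proof (rule achieves_Seq_eq[of _ _ _ s1], goal_cases)
    case 1 show ?case by (rule achieves_msum) (use r in \<open>simp_all add: s1_def\<close>)
  next
    case 2 show ?case
    proof (rule achieves_Seq_eq[of _ _ _ s2], goal_cases)
      case 1 show ?case by (rule achieves_msum) (use r in \<open>simp_all add: s2_def\<close>)
    next
      case 2 show ?case
        apply (rule achieves_msum)
                    apply (use r in simp_all)
        apply (auto simp: block_sum_inside B gram_def)
        apply (auto simp: s1_def s2_def)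
        done
    qed
  qed
  then show ?thesis by simp
qed

definition start_com :: com where
  "start_com =
     Seq (mset_sum 8 (IVar 0) (IVar 1) (IConst 1) (REntry 6 iX iY))
    (Seq (mset_sum 9 (IVar 0) (IVar 1) (IConst 1) (RConst 0))
    (Seq (RAssign 11 (IConst 0) (IConst 0) (RConst 1))
    (Seq (RAssign 12 (IConst 0) (IConst 0) (RConst 0))
    (Seq (RAssign 16 (IConst 0) (IConst 0) (RConst 0))
    (Seq (IAssign 4 (IConst 0)) norm_com)))))"

lemma achieves_start_com:
  assumes B: "\<And>i j. i < m \<Longrightarrow> j < n \<Longrightarrow> rarr s 6 i j = B i j"
    and reg: "ireg s 0 = m" "ireg s 1 = n" "ireg s 10 = 0" "ireg s 11 = 0" "ireg s 12 = 0"
    and M: "m < M" "n < M" "1 < M"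
  shows "achieves start_com s (500 * M ^ 3) (\<lambda>s'. keeps s s' \<and> lz_state m n G B 0 s')"
    (is "achieves _ _ _ ?Q")
proof -
  define s1 where "s1 = upd 8 (block_sum s 8 0 0 m n 1 (REntry 6 iX iY)) s"
  define s2 where "s2 = upd 9 (block_sum s1 9 0 0 m n 1 (RConst 0)) s1"
  define s3 where "s3 = upd 11 ((rarr s2 11)(0 := (rarr s2 11 0)(0 := 1))) s2"
  define s4 where "s4 = upd 12 ((rarr s3 12)(0 := (rarr s3 12 0)(0 := 0))) s3"
  define s5 where "s5 = upd 16 ((rarr s4 16)(0 := (rarr s4 16 0)(0 := 0))) s4"
  define s6 where "s6 = s5\<lparr>ireg := (ireg s5)(4 := 0)\<rparr>"
  have r5: "ireg s1 = ireg s" "ireg s2 = ireg s" "ireg s3 = ireg s" "ireg s4 = ireg s" "ireg s5 = ireg s"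
    by (simp_all add: s1_def s2_def s3_def s4_def s5_def)
  have r6: "ireg s6 = (ireg s)(4 := 0)" by (simp add: s6_def r5)
  note r = reg M r5
  have Q: "rarr s6 8 i j = B i j" "rarr s6 9 i j = 0" if "i < m" "j < n" for i j
    using that by (simp_all add: s1_def s2_def s3_def s4_def s5_def s6_def block_sum_inside B)
  have ip6: "ip m n (rarr s6 8) (rarr s6 8) = ip m n B B"
    by (rule ip_cong) (simp add: Q)
  have "achieves start_com s (100 * M ^ 3 + (100 * M ^ 3 + (4 + (4 + (4 + (2 + 200 * M ^ 3)))))) ?Q"
    unfolding start_com_def
  proof (rule achieves_Seq_eq[of _ _ _ s1], goal_cases)
    case 1 show ?case by (rule achieves_msum) (use r in \<open>simp_all add: s1_def\<close>)
  next
    case 2 show ?case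
    proof (rule achieves_Seq_eq[of _ _ _ s2], goal_cases)
      case 1 show ?case by (rule achieves_msum) (use r in \<open>simp_all add: s2_def\<close>)
    next
      case 2 show ?case
      proof (rule achieves_Seq_eq[of _ _ _ s3], goal_cases)
        case 1 show ?case
          by (rule achieves_mono[where P = "\<lambda>s'. s' = s3", OF achieves_RAssign])
             (simp_all add: s3_def write_entry_upd)
      next
        case 2 show ?case
        proof (rule achieves_Seq_eq[of _ _ _ s4], goal_cases)
          case 1 show ?case
            by (rule achieves_mono[where P = "\<lambda>s'. s' = s4", OF achieves_RAssign])
               (simp_all add: s4_def write_entry_upd)
        next
          case 2 show ?case
          proof (rule achieves_Seq_eq[of _ _ _ s5], goal_cases)
            case 1 show ?case
              by (rule achieves_mono[where P = "\<lambda>s'. s' = s5", OF achieves_RAssign])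
                 (simp_all add: s5_def write_entry_upd)
          next
            case 2 show ?case
            proof (rule achieves_Seq_eq[of _ _ _ s6], goal_cases)
              case 1 show ?case
                by (rule achieves_mono[where P = "\<lambda>s'. s' = s6", OF achieves_IAssign])
                   (simp_all add: s6_def)
            next
              case 2 show ?case
              proof (rule achieves_mono[OF achieves_norm_com, of s6 M])
                fix s' :: store assume s': "ireg s' = ireg s6 \<and>
                  (\<forall>a. a \<noteq> 14 \<and> a \<noteq> 15 \<longrightarrow> rarr s' a = rarr s6 a) \<and>
                  rarr s' 15 0 0 = ip (ireg s6 0) (ireg s6 1) (rarr s6 8) (rarr s6 8)"
                have "keeps s s'" using s'
                  by (simp add: keeps_def r6) (simp add: s1_def s2_def s3_def s4_def s5_def s6_def)
                moreover have "lz_state m n G B 0 s'"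
                  using s' reg Q ip6
                  by (simp add: lz_state_def r6 del: One_nat_def)
                     (simp add: s1_def s2_def s3_def s4_def s5_def s6_def ip_def)
                ultimately show "?Q s'" ..
              qed (use reg M r6 in auto)
            qed
          qed
        qed
      qed
    qed
  qed
  moreover have "1 \<le> M ^ 3" using M by simp
  ultimately show ?thesis by (elim achieves_mono) auto
qed

definition lanczos_com :: com where
  "lanczos_com = Seq start_com (Loop (RLess (RConst 0) (scalar 15)) lanczos_step_com)"

text \<open>\<open>D\<close> is the first index at which the Lanczos matrix vanishes. The test of
  the squared norm is exact, so the loop makes exactly \<open>D\<close> rounds.\<close>

lemma achieves_lanczos_com:
  assumes B: "\<And>i j. i < m \<Longrightarrow> j < n \<Longrightarrow> rarr s 6 i j = B i j"
    and G: "\<And>i j. i < n \<Longrightarrow> j < n \<Longrightarrow> rarr s 7 i j = G i j"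
    and reg: "ireg s 0 = m" "ireg s 1 = n" "ireg s 10 = 0" "ireg s 11 = 0" "ireg s 12 = 0"
    and M: "m < M" "n < M" "D + 2 < M"
    and D: "\<And>j. j < D \<Longrightarrow> ip m n (fst (lzQ m n G B j)) (fst (lzQ m n G B j)) \<noteq> 0"
      "ip m n (fst (lzQ m n G B D)) (fst (lzQ m n G B D)) = 0"
  shows "achieves lanczos_com s (3000 * M ^ 4) (\<lambda>s'. keeps s s' \<and> lz_state m n G B D s')"
proof -
  define Inv where "Inv d s' \<longleftrightarrow> d \<le> D \<and> keeps s s' \<and> lz_state m n G B d s'" for d s'
  have loop: "achieves (Loop (RLess (RConst 0) (scalar 15)) lanczos_step_com) s0
      ((D - 0) * (1 + bcost (RLess (RConst 0) (scalar 15)) + 2000 * M ^ 3)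
        + (1 + bcost (RLess (RConst 0) (scalar 15))))
      (\<lambda>s'. \<exists>d\<le>D. Inv d s' \<and> \<not> bval (RLess (RConst 0) (scalar 15)) s')"
    if "Inv 0 s0" for s0
  proof (rule achieves_Loop[where Inv = Inv, OF _ that])
    fix d s' assume I: "Inv d s'" and b: "bval (RLess (RConst 0) (scalar 15)) s'"
    have st: "lz_state m n G B d s'" and k: "keeps s s'" and "d \<le> D" using I by (auto simp: Inv_def)
    moreover have "d \<noteq> D" using st b D(2) by (auto simp: lz_state_def)
    ultimately have d: "d < D" by simp
    have "achieves lanczos_step_com s' (2000 * M ^ 3)
      (\<lambda>s''. keeps s' s'' \<and> lz_state m n G B (Suc d) s'')"
      by (rule achieves_lanczos_step_com[OF st]) (use k reg M d G in \<open>auto simp: keeps_def\<close>)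
    then have "achieves lanczos_step_com s' (2000 * M ^ 3) (Inv (Suc d))"
      by (rule achieves_mono) (use keeps_trans[OF k] d in \<open>auto simp: Inv_def\<close>)
    with d show "d < D \<and> achieves lanczos_step_com s' (2000 * M ^ 3) (Inv (Suc d))" ..
  qed simp
  have "achieves lanczos_com s (500 * M ^ 3 +
      ((D - 0) * (1 + bcost (RLess (RConst 0) (scalar 15)) + 2000 * M ^ 3)
        + (1 + bcost (RLess (RConst 0) (scalar 15)))))
      (\<lambda>s'. \<exists>d\<le>D. Inv d s' \<and> \<not> bval (RLess (RConst 0) (scalar 15)) s')"
    unfolding lanczos_com_def
    by (rule achieves_Seq[OF achieves_start_com[where G = G, OF B reg] loop]) (use M in \<open>auto simp: Inv_def\<close>)
  then show ?thesis
  proof (rule achieves_mono)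
    fix s' assume "\<exists>d\<le>D. Inv d s' \<and> \<not> bval (RLess (RConst 0) (scalar 15)) s'"
    then obtain d where d: "d \<le> D" "Inv d s'" "\<not> 0 < rarr s' 15 0 0" by auto
    then have "ip m n (fst (lzQ m n G B d)) (fst (lzQ m n G B d)) = 0"
      using ip_self_nonneg[of m n "fst (lzQ m n G B d)"] by (simp add: Inv_def lz_state_def)
    with D(1)[of d] d(1) have "d = D" by (cases "d < D") auto
    with d show "keeps s s' \<and> lz_state m n G B D s'" by (simp add: Inv_def)
  next
    \<comment> \<open>\<open>(D + 1) * K \<le> M * K\<close> pays for the rounds and the fixed costs
      together.\<close>
    define K where "K = M ^ 3"
    have K: "1 \<le> K" "M ^ 4 = M * K" using M by (simp_all add: K_def power_numeral_reduce)
    then have "D \<le> D * K" by simp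
    moreover have "(D + 1) * K \<le> M * K" using M by (intro mult_right_mono) auto
    moreover have "(D + 1) * K = D * K + K" by simp
    ultimately have "500 * K + (6 * D + 2000 * (D * K) + 6) \<le> 3000 * (M * K)"
      using K(1) by linarith
    then show "500 * M ^ 3 + ((D - 0) * (1 + bcost (RLess (RConst 0) (scalar 15)) + 2000 * M ^ 3)
        + (1 + bcost (RLess (RConst 0) (scalar 15)))) \<le> 3000 * M ^ 4"
      unfolding K(2) K_def[symmetric] by (simp add: algebra_simps)
  qed
qed

section \<open>The largest root and Horner's scheme\<close>

definition horner_step_com :: com where
  "horner_step_com =
     Seq (RAssign 20 (IConst 0) (IConst 0)
           (RAdd (REntry 11 (IConst 0) (IVar 5)) (RMul (scalar 19) (scalar 20))))
    (Seq (mset_sum 22 (IVar 0) (IVar 1) (IVar 1) (RMul (REntry 21 iX iZ) (REntry 7 iZ iY)))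
    (Seq (mset_sum 21 (IVar 0) (IVar 1) (IConst 1)
           (RAdd (REntry 22 iX iY) (RMul (scalar 20) (REntry 6 iX iY))))
      (IAssign 5 (ISub (IVar 5) (IConst 1)))))"

text \<open>\<open>i\<close> counts rounds while register 5 runs down through the degrees, since
  coefficients enter from the top.\<close>

definition horner_state where
  "horner_state m n G B x p d i s \<longleftrightarrow> ireg s 5 = d - i \<and>
    (\<forall>l\<le>d. rarr s 11 0 l = p l) \<and> rarr s 19 0 0 = x \<and>
    rarr s 20 0 0 = horner_h x (\<lambda>i. p (d - i)) i \<and>
    (\<forall>u<m. \<forall>v<n. rarr s 21 u v = horner_V n G B x (\<lambda>i. p (d - i)) i u v)"

lemma achieves_horner_step_com:
  assumes st: "horner_state m n G B x p d i s"
    and B: "\<And>i j. i < m \<Longrightarrow> j < n \<Longrightarrow> rarr s 6 i j = B i j"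
    and G: "\<And>i j. i < n \<Longrightarrow> j < n \<Longrightarrow> rarr s 7 i j = G i j"
    and reg: "ireg s 0 = m" "ireg s 1 = n" "ireg s 10 = 0" "ireg s 11 = 0" "ireg s 12 = 0"
    and M: "m < M" "n < M" "1 < M"
  shows "achieves horner_step_com s (300 * M ^ 3)
    (\<lambda>s'. keeps s s' \<and> ireg s' 4 = ireg s 4 \<and> horner_state m n G B x p d (Suc i) s')"
    (is "achieves _ _ _ ?Q")
proof -
  let ?P = "\<lambda>i. p (d - i)"
  have 5: "ireg s 5 = d - i" and p: "\<And>l. l \<le> d \<Longrightarrow> rarr s 11 0 l = p l"
    and x: "rarr s 19 0 0 = x" and h: "rarr s 20 0 0 = horner_h x ?P i"
    and V: "\<And>u v. u < m \<Longrightarrow> v < n \<Longrightarrow> rarr s 21 u v = horner_V n G B x ?P i u v"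
    using st by (auto simp: horner_state_def)
  \<comment> \<open>The scalar is advanced first, because the matrix step uses the new
    coefficient.\<close>
  define s1 where "s1 = upd 20 ((rarr s 20)(0 := (rarr s 20 0)(0 := horner_h x ?P (Suc i)))) s"
  define s2 where "s2 = upd 22 (block_sum s1 22 0 0 m n n (RMul (REntry 21 iX iZ) (REntry 7 iZ iY))) s1"
  define s3 where "s3 = upd 21 (block_sum s2 21 0 0 m n 1
    (RAdd (REntry 22 iX iY) (RMul (scalar 20) (REntry 6 iX iY)))) s2"
  have rg: "ireg s1 = ireg s" "ireg s2 = ireg s" "ireg s3 = ireg s"
    by (simp_all add: s1_def s2_def s3_def)
  note r = reg M rg
  have W: "rarr s2 22 u v = mmul n (horner_V n G B x ?P i) G u v" if "u < m" "v < n" for u v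
    using that by (simp add: s2_def block_sum_inside mmul_def s1_def V G)
  have V': "rarr s3 21 u v = horner_V n G B x ?P (Suc i) u v" if "u < m" "v < n" for u v
    using that by (simp add: s3_def block_sum_inside W) (simp add: s2_def s1_def B)
  have "achieves horner_step_com s (20 + (100 * M ^ 3 + (100 * M ^ 3 + 4))) ?Q"
    unfolding horner_step_com_def
  proof (rule achieves_Seq_eq[of _ _ _ s1], goal_cases)
    case 1 show ?case
      by (rule achieves_mono[where P = "\<lambda>s'. s' = s1", OF achieves_RAssign])
         (simp_all add: s1_def write_entry_upd 5 p x h)
  next
    case 2 show ?case
    proof (rule achieves_Seq_eq[of _ _ _ s2], goal_cases)
      case 1 show ?case by (rule achieves_msum) (use r in \<open>simp_all add: s2_def\<close>)
    next
      case 2 show ?case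
      proof (rule achieves_Seq_eq[of _ _ _ s3], goal_cases)
        case 1 show ?case by (rule achieves_msum) (use r in \<open>simp_all add: s3_def\<close>)
      next
        case 2 show ?case
        proof (rule achieves_mono[where P = ?Q, OF achieves_IAssign])
          let ?s' = "s3\<lparr>ireg := (ireg s3)(5 := ival (ISub (IVar 5) (IConst 1)) s3)\<rparr>"
          have "keeps s ?s'" by (simp add: keeps_def rg) (simp add: s1_def s2_def s3_def)
          moreover have "horner_state m n G B x p d (Suc i) ?s'"
            unfolding horner_state_def
            by (simp add: V' rg 5 del: horner_h.simps horner_V.simps) (simp add: s1_def s2_def s3_def p x)
          ultimately show "?Q ?s'" by (simp add: rg)
        qed auto
      qed
    qed
  qed
  moreover have "M ^ 3 \<ge> 2 ^ 3" using M by (intro power_mono) auto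
  ultimately show ?thesis by (elim achieves_mono) auto
qed

definition eig_com :: com where
  "eig_com = Seq (MaxRoot 19 (IConst 0) (IConst 0) 11 (IConst 0) (IVar 4))
    (Seq (RAssign 20 (IConst 0) (IConst 0) (RConst 0))
    (Seq (mset_sum 21 (IVar 0) (IVar 1) (IConst 1) (RConst 0))
    (Seq (IAssign 5 (IVar 4)) (Loop (ILess (IConst 0) (IVar 5)) horner_step_com))))"

lemma achieves_eig_com:
  fixes p :: "nat \<Rightarrow> real" and d :: nat
  defines "x \<equiv> largest_root (\<Sum>l\<le>d. monom (p l) l)"
  assumes d: "ireg s 4 = d" and p: "\<And>l. l \<le> d \<Longrightarrow> rarr s 11 0 l = p l"
    and B: "\<And>i j. i < m \<Longrightarrow> j < n \<Longrightarrow> rarr s 6 i j = B i j"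
    and G: "\<And>i j. i < n \<Longrightarrow> j < n \<Longrightarrow> rarr s 7 i j = G i j"
    and reg: "ireg s 0 = m" "ireg s 1 = n" "ireg s 10 = 0" "ireg s 11 = 0" "ireg s 12 = 0"
    and M: "m < M" "n < M" "d + 2 < M"
  shows "achieves eig_com s (500 * M ^ 4) (\<lambda>s'. keeps s s' \<and>
    (\<forall>u<m. \<forall>v<n. rarr s' 21 u v = horner_V n G B x (\<lambda>i. p (d - i)) d u v))"
    (is "achieves _ _ _ ?Q")
proof -
  define s1 where "s1 = upd 19 ((rarr s 19)(0 := (rarr s 19 0)(0 := x))) s"
  define s2 where "s2 = upd 20 ((rarr s1 20)(0 := (rarr s1 20 0)(0 := 0))) s1"
  define s3 where "s3 = upd 21 (block_sum s2 21 0 0 m n 1 (RConst 0)) s2"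
  define s4 where "s4 = s3\<lparr>ireg := (ireg s3)(5 := d)\<rparr>"
  have rg: "ireg s1 = ireg s" "ireg s2 = ireg s" "ireg s3 = ireg s"
    by (simp_all add: s1_def s2_def s3_def)
  have r4: "ireg s4 = (ireg s)(5 := d)" by (simp add: s4_def rg)
  note r = reg M rg
  define Inv where "Inv i s' \<longleftrightarrow> keeps s s' \<and> horner_state m n G B x p d i s'" for i s'
  have I0: "Inv 0 s4"
    unfolding Inv_def keeps_def horner_state_def
    by (simp add: r4) (simp add: s1_def s2_def s3_def s4_def p block_sum_inside)
  have sum: "(\<Sum>l\<le>d. monom (rarr s 11 0 l) l) = (\<Sum>l\<le>d. monom (p l) l)"
    by (simp add: p)
  let ?b = "ILess (IConst 0) (IVar 5)"
  have loop: "achieves (Loop ?b horner_step_com) s4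
      ((d - 0) * (1 + bcost ?b + 300 * M ^ 3) + (1 + bcost ?b))
      (\<lambda>s'. \<exists>i\<le>d. Inv i s' \<and> \<not> bval ?b s')"
  proof (rule achieves_Loop[where Inv = Inv, OF _ I0])
    fix i s' assume I: "Inv i s'" and b: "bval ?b s'"
    have st: "horner_state m n G B x p d i s'" and k: "keeps s s'" using I by (auto simp: Inv_def)
    have i: "i < d" using st b by (simp add: horner_state_def)
    have "achieves horner_step_com s' (300 * M ^ 3)
      (\<lambda>s''. keeps s' s'' \<and> ireg s'' 4 = ireg s' 4 \<and> horner_state m n G B x p d (Suc i) s'')"
      by (rule achieves_horner_step_com[OF st]) (use k reg M B G in \<open>auto simp: keeps_def\<close>)
    then have "achieves horner_step_com s' (300 * M ^ 3) (Inv (Suc i))"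
      by (rule achieves_mono) (use keeps_trans[OF k] in \<open>auto simp: Inv_def\<close>)
    with i show "i < d \<and> achieves horner_step_com s' (300 * M ^ 3) (Inv (Suc i))" ..
  qed simp
  have "achieves eig_com s ((d + 6) + (4 + (100 * M ^ 3 + (2 +
      ((d - 0) * (1 + bcost ?b + 300 * M ^ 3) + (1 + bcost ?b)))))) ?Q"
    unfolding eig_com_def
  proof (rule achieves_Seq_eq[of _ _ _ s1], goal_cases)
    case 1 show ?case
      by (rule achieves_mono[where P = "\<lambda>s'. s' = s1", OF achieves_MaxRoot])
         (simp_all add: s1_def write_entry_upd d x_def sum)
  next
    case 2 show ?case
    proof (rule achieves_Seq_eq[of _ _ _ s2], goal_cases)
      case 1 show ?case
        by (rule achieves_mono[where P = "\<lambda>s'. s' = s2", OF achieves_RAssign])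
           (simp_all add: s2_def write_entry_upd)
    next
      case 2 show ?case
      proof (rule achieves_Seq_eq[of _ _ _ s3], goal_cases)
        case 1 show ?case by (rule achieves_msum) (use r in \<open>simp_all add: s3_def\<close>)
      next
        case 2 show ?case
        proof (rule achieves_Seq_eq[of _ _ _ s4], goal_cases)
          case 1 show ?case
            by (rule achieves_mono[where P = "\<lambda>s'. s' = s4", OF achieves_IAssign])
               (simp_all add: s4_def rg d)
        next
          case 2 show ?case
          proof (rule achieves_mono[OF loop order_refl])
            fix s' assume "\<exists>i\<le>d. Inv i s' \<and> \<not> bval ?b s'"
            then obtain i where i: "i \<le> d" "Inv i s'" "ireg s' 5 = 0" by auto
            then have "i = d" by (simp add: Inv_def horner_state_def)
            with i show "?Q s'" by (simp add: Inv_def horner_state_def)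
          qed
        qed
      qed
    qed
  qed
  then show ?thesis
  proof (rule achieves_mono)
    define K where "K = M ^ 3"
    have K: "1 \<le> K" "M ^ 4 = M * K" using M by (simp_all add: K_def power_numeral_reduce)
    then have "d \<le> d * K" by simp
    moreover have "(d + 1) * K \<le> M * K" using M by (intro mult_right_mono) auto
    moreover have "(d + 1) * K = d * K + K" by simp
    ultimately have "d + 6 + (4 + (100 * K + (2 + (4 * d + 300 * (d * K) + 4)))) \<le> 500 * (M * K)"
      using K(1) by linarith
    then show "d + 6 + (4 + (100 * M ^ 3 + (2 + ((d - 0) * (1 + bcost ?b + 300 * M ^ 3) + (1 + bcost ?b)))))
       \<le> 500 * M ^ 4"
      unfolding K(2) K_def[symmetric] by (simp add: algebra_simps)
  qed
qed

section \<open>Choosing an eigenvector row and storing the pair\<close>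

definition pick_com :: com where
  "pick_com =
     Seq (mset_sum 14 (IVar 0) (IConst 1) (IVar 1) (RMul (REntry 21 iX iZ) (REntry 21 iX iZ)))
    (Seq (IAssign 6 (IConst 0))
      (Loop (BNot (RLess (RConst 0) (REntry 14 (IVar 6) (IConst 0))))
        (IAssign 6 (IAdd (IVar 6) (IConst 1)))))"

text \<open>The search has no explicit bound; the nonzero entry in row \<open>i0\<close> stops it
  there at the latest.\<close>

lemma achieves_pick_com:
  assumes nz: "i0 < m" "j0 < n" "rarr s 21 i0 j0 \<noteq> 0"
    and reg: "ireg s 0 = m" "ireg s 1 = n" "ireg s 10 = 0" "ireg s 11 = 0" "ireg s 12 = 0"
    and M: "m < M" "n < M" "1 < M"
  shows "achieves pick_com s (200 * M ^ 3) (\<lambda>s'. keeps s s' \<and> rarr s' 21 = rarr s 21 \<and>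
    ireg s' 6 < m \<and> 0 < rarr s' 14 (ireg s' 6) 0 \<and>
    rarr s' 14 (ireg s' 6) 0 = dotp n (rarr s 21 (ireg s' 6)) (rarr s 21 (ireg s' 6)))"
    (is "achieves _ _ _ ?Q")
proof -
  define s1 where "s1 = upd 14 (block_sum s 14 0 0 m 1 n (RMul (REntry 21 iX iZ) (REntry 21 iX iZ))) s"
  define s2 where "s2 = s1\<lparr>ireg := (ireg s1)(6 := 0)\<rparr>"
  let ?b = "BNot (RLess (RConst 0) (REntry 14 (IVar 6) (IConst 0)))"
  define Inv where "Inv w s' \<longleftrightarrow> w \<le> i0 \<and> s' = s1\<lparr>ireg := (ireg s1)(6 := w)\<rparr>" for w s'
  have N: "rarr s1 14 i 0 = dotp n (rarr s 21 i) (rarr s 21 i)" if "i < m" for i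
    using that by (simp add: s1_def block_sum_inside dotp_def)
  have "dotp n (rarr s 21 i0) (rarr s 21 i0) \<noteq> 0"
    using nz by (auto simp: dotp_self_eq_0)
  then have pos: "0 < rarr s1 14 i0 0"
    using nz dotp_self_nonneg[of n "rarr s 21 i0"] by (simp add: N)
  have loop: "achieves (Loop ?b (IAssign 6 (IAdd (IVar 6) (IConst 1)))) s2
      ((i0 - 0) * (1 + bcost ?b + 4) + (1 + bcost ?b)) (\<lambda>s'. \<exists>w\<le>i0. Inv w s' \<and> \<not> bval ?b s')"
  proof (rule achieves_Loop[where Inv = Inv])
    fix w s' assume I: "Inv w s'" and b: "bval ?b s'"
    then have "w \<noteq> i0" using pos by (auto simp: Inv_def)
    with I have w: "w < i0" by (simp add: Inv_def)
    have "achieves (IAssign 6 (IAdd (IVar 6) (IConst 1))) s' 4 (Inv (Suc w))"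
      by (rule achieves_mono[where P = "Inv (Suc w)", OF achieves_IAssign])
         (use I w in \<open>auto simp: Inv_def\<close>)
    with w show "w < i0 \<and> achieves (IAssign 6 (IAdd (IVar 6) (IConst 1))) s' 4 (Inv (Suc w))" ..
  qed (auto simp: Inv_def s2_def)
  have "achieves pick_com s (100 * M ^ 3 + (2 + ((i0 - 0) * (1 + bcost ?b + 4) + (1 + bcost ?b)))) ?Q"
    unfolding pick_com_def
  proof (rule achieves_Seq_eq[of _ _ _ s1], goal_cases)
    case 1 show ?case by (rule achieves_msum) (use reg M in \<open>simp_all add: s1_def\<close>)
  next
    case 2 show ?case
    proof (rule achieves_Seq_eq[of _ _ _ s2], goal_cases)
      case 1 show ?case
        by (rule achieves_mono[where P = "\<lambda>s'. s' = s2", OF achieves_IAssign]) (simp_all add: s2_def)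
    next
      case 2 show ?case
      proof (rule achieves_mono[OF loop order_refl])
        fix s' assume "\<exists>w\<le>i0. Inv w s' \<and> \<not> bval ?b s'"
        then obtain w where w: "w \<le> i0" "s' = s1\<lparr>ireg := (ireg s1)(6 := w)\<rparr>" "0 < rarr s1 14 w 0"
          by (auto simp: Inv_def)
        have "w < m" using w nz by simp
        with w N[of w] show "?Q s'" by (simp add: keeps_def) (simp add: s1_def)
      qed
    qed
  qed
  moreover have "i0 * 11 \<le> M ^ 3 * 11"
  proof -
    have "i0 \<le> M ^ 1" using nz M by simp
    also have "\<dots> \<le> M ^ 3" using M by (intro power_increasing) auto
    finally show ?thesis by simp
  qed
  moreover have "M ^ 3 \<ge> 1" using M by simp
  ultimately show ?thesis by (elim achieves_mono) auto
qed

text \<open>The column of \<open>Y\<close> is stored first because that of \<open>X\<close> is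
  computed from it. Dividing \<open>X\<close> by the squared norm replaces a normalisation of
  both.\<close>

definition store_com :: com where
  "store_com =
     Seq (msum 4 (IConst 0) (IVar 3) (IVar 1) (IConst 1) (IConst 1) (REntry 21 (IVar 6) iX))
      (msum 3 (IConst 0) (IVar 3) (IVar 0) (IConst 1) (IVar 1)
        (RDiv (RMul (REntry 6 iX iZ) (REntry 4 iZ (IVar 3))) (REntry 14 (IVar 6) (IConst 0))))"

lemma achieves_store_com:
  fixes s :: store and M :: nat
  defines "m \<equiv> ireg s 0" and "n \<equiv> ireg s 1" and "k \<equiv> ireg s 3" and "w \<equiv> ireg s 6"
  assumes "ireg s 10 = 0" "ireg s 11 = 0" "ireg s 12 = 0" "m < M" "n < M" "1 < M"
  shows "achieves store_com s (200 * M ^ 3) (\<lambda>s'. ireg s' = ireg s \<and>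
    (\<forall>a. a \<notin> {3, 4} \<longrightarrow> rarr s' a = rarr s a) \<and>
    (\<forall>i l. l \<noteq> k \<longrightarrow> rarr s' 3 i l = rarr s 3 i l \<and> rarr s' 4 i l = rarr s 4 i l) \<and>
    (\<forall>j<n. rarr s' 4 j k = rarr s 21 w j) \<and>
    (\<forall>i<m. rarr s' 3 i k = mvec n (rarr s 6) (rarr s 21 w) i / rarr s 14 w 0))"
    (is "achieves _ _ _ ?Q")
proof -
  define s1 where "s1 = upd 4 (block_sum s 4 0 k n 1 1 (REntry 21 (IVar 6) iX)) s"
  have reg: "ireg s1 = ireg s" by (simp add: s1_def)
  note r = assms(5-) reg m_def[symmetric] n_def[symmetric] k_def[symmetric] w_def[symmetric]
  have Y: "rarr s1 4 j k = rarr s 21 w j" if "j < n" for j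
    using that by (simp add: s1_def block_sum_inside w_def)
  have Y': "rarr s1 4 j l = rarr s 4 j l" if "l \<noteq> k" for j l
    using that by (auto simp: s1_def block_sum_def)
  have old: "rarr s1 6 = rarr s 6" "rarr s1 14 = rarr s 14" "rarr s1 3 = rarr s 3"
    by (simp_all add: s1_def)
  have "achieves store_com s (100 * M ^ 3 + 100 * M ^ 3) ?Q"
    unfolding store_com_def
  proof (rule achieves_Seq_eq[of _ _ _ s1], goal_cases)
    case 1 show ?case by (rule achieves_msum) (use r in \<open>simp_all add: s1_def\<close>)
  next
    case 2 show ?case
      apply (rule achieves_msum)
                  apply (use r in simp_all)
      apply (auto simp: block_sum_inside Y Y' old mvec_def sum_divide_distrib)
        apply (auto simp: s1_def block_sum_def)
      done
  qed
  then show ?thesis by simp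
qed

section \<open>One column of the factorization\<close>

definition column_com :: com where
  "column_com = Seq resid_com (Seq lanczos_com
     (Cond (ILess (IConst 0) (IVar 4)) (Seq eig_com (Seq pick_com store_com)) Skip))"

lemma fro_cong:
  "(\<And>i j. i < m \<Longrightarrow> j < n \<Longrightarrow> A i j = B i j) \<Longrightarrow> fro m n A = fro m n B"
  by (simp add: fro_def)

lemma top_rank_one_cong:
  assumes "\<And>i j. i < m \<Longrightarrow> j < n \<Longrightarrow> B i j = B' i j"
    and "\<And>i. i < m \<Longrightarrow> x i = x' i" "\<And>j. j < n \<Longrightarrow> y j = y' j"
  shows "top_rank_one m n B x y \<longleftrightarrow> top_rank_one m n B' x' y'"
proof -
  have "dotp m (mvec n B u) (mvec n B u) = dotp m (mvec n B' u) (mvec n B' u)" for u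
    using assms by (simp add: dotp_def mvec_def)
  moreover have "fro m n B = fro m n B'" using assms by (intro fro_cong) auto
  moreover have "fro m n (\<lambda>i j. B i j - x i * y j) = fro m n (\<lambda>i j. B' i j - x' i * y' j)"
    using assms by (intro fro_cong) auto
  ultimately show ?thesis by (simp add: top_rank_one_def)
qed

lemma top_rank_one_zero:
  assumes "\<And>i j. i < m \<Longrightarrow> j < n \<Longrightarrow> B i j = 0"
  shows "top_rank_one m n B (\<lambda>_. 0) (\<lambda>_. 0)"
  using assms by (simp add: top_rank_one_def dotp_def mvec_def)

text \<open>Feasibility of \<open>Y\<close> rests on this: a column of \<open>B\<close> that the
  mask makes zero stays zero in \<open>V\<close>, hence in the chosen eigenvector.\<close>

lemma horner_V_zero_column:
  assumes "\<And>i. i < m \<Longrightarrow> B i j = 0" and "i < m"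
  shows "horner_V n (gram m B) B x P s i j = 0"
  using assms by (induction s) (auto simp: mmul_def gram_def)

lemma achieves_column_com:
  fixes s :: store and M :: nat
  defines "m \<equiv> ireg s 0" and "n \<equiv> ireg s 1" and "k \<equiv> ireg s 3"
  defines "B \<equiv> \<lambda>i j. (rarr s 0 i j - (\<Sum>l<k. rarr s 3 i l * rarr s 4 j l)) * (rarr s 1 i k * rarr s 2 j k)"
  assumes reg: "ireg s 10 = 0" "ireg s 11 = 0" "ireg s 12 = 0"
    and M: "m < M" "n < M" "k < M" "m * n + 2 < M"
    and z: "\<And>i. rarr s 3 i k = 0" "\<And>j. rarr s 4 j k = 0"
  shows "achieves column_com s (6000 * M ^ 4) (\<lambda>s'.
    (\<forall>x. x \<notin> {4, 5, 6} \<longrightarrow> ireg s' x = ireg s x) \<and>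
    rarr s' 0 = rarr s 0 \<and> rarr s' 1 = rarr s 1 \<and> rarr s' 2 = rarr s 2 \<and>
    (\<forall>i l. l \<noteq> k \<longrightarrow> rarr s' 3 i l = rarr s 3 i l \<and> rarr s' 4 i l = rarr s 4 i l) \<and>
    top_rank_one m n B (\<lambda>i. rarr s' 3 i k) (\<lambda>j. rarr s' 4 j k) \<and>
    (\<forall>i<m. rarr s 1 i k = 0 \<longrightarrow> rarr s' 3 i k = 0) \<and>
    (\<forall>j<n. rarr s 2 j k = 0 \<longrightarrow> rarr s' 4 j k = 0))"
    (is "achieves _ _ _ ?Q")
proof -
  let ?q = "\<lambda>d. fst (lzQ m n (gram m B) B d)"
  \<comment> \<open>Taking the least index makes all earlier norms nonzero, as orthogonality and the
    nonvanishing of \<open>V\<close> require.\<close>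
  define D where "D = (LEAST d. ip m n (?q d) (?q d) = 0)"
  obtain d0 where d0: "d0 \<le> m * n" "ip m n (?q d0) (?q d0) = 0"
    by (rule lanczos_terminates[of "gram m B" m n B, OF gram_sym])
  have D0: "ip m n (?q D) (?q D) = 0" unfolding D_def using d0(2) by (rule LeastI)
  have Dl: "ip m n (?q j) (?q j) \<noteq> 0" if "j < D" for j
    using not_less_Least[of j "\<lambda>d. ip m n (?q d) (?q d) = 0"] that by (auto simp: D_def)
  have "D \<le> d0" unfolding D_def by (rule Least_le[of _ d0]) (rule d0(2))
  then have DM: "D + 2 < M" using d0(1) M by simp
  define p where "p = fst (lzp m n (gram m B) B D)"
  define x where "x = largest_root (\<Sum>l\<le>D. monom (p l) l)"
  define V where "V = horner_V n (gram m B) B x (\<lambda>i. p (D - i)) D"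
  note r = reg m_def[symmetric] n_def[symmetric] k_def[symmetric]
  have K: "M ^ 3 * 2 \<le> M ^ 4" using M by (simp add: power_numeral_reduce)
  have 1: "1 \<le> M ^ 3" using M by simp
  have branch: "achieves (Cond (ILess (IConst 0) (IVar 4)) (Seq eig_com (Seq pick_com store_com)) Skip)
      s2 (4 + (500 * M ^ 4 + (200 * M ^ 3 + 200 * M ^ 3))) ?Q"
    if s1: "ireg s1 = ireg s" "\<And>a. a \<notin> {5, 6, 7} \<Longrightarrow> rarr s1 a = rarr s a"
        "\<And>i j. i < m \<Longrightarrow> j < n \<Longrightarrow> rarr s1 6 i j = B i j"
        "\<And>i j. i < n \<Longrightarrow> j < n \<Longrightarrow> rarr s1 7 i j = gram m B i j"
      and s2: "keeps s1 s2" "lz_state m n (gram m B) B D s2" for s1 s2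
  proof -
    have k2: "ireg s2 x = ireg s x" if "x \<notin> {4, 5, 6}" for x using s1(1) s2(1) that by (simp add: keeps_def)
    have a2: "rarr s2 a = rarr s a" if "a < 5" for a using s1(2)[of a] s2(1) that by (simp add: keeps_def)
    have B2: "rarr s2 6 i j = B i j" if "i < m" "j < n" for i j
      using s1(3)[OF that] s2(1) by (simp add: keeps_def)
    have G2: "rarr s2 7 i j = gram m B i j" if "i < n" "j < n" for i j
      using s1(4)[OF that] s2(1) by (simp add: keeps_def)
    have d2: "ireg s2 4 = D" using s2(2) by (simp add: lz_state_def)
    have p2: "rarr s2 11 0 l = p l" if "l \<le> D" for l using s2(2) that by (simp add: lz_state_def p_def)
    have "achieves (Cond (ILess (IConst 0) (IVar 4)) (Seq eig_com (Seq pick_com store_com)) Skip)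
      s2 (1 + bcost (ILess (IConst 0) (IVar 4)) + (500 * M ^ 4 + (200 * M ^ 3 + 200 * M ^ 3))) ?Q"
    proof (rule achieves_Cond)
      assume "bval (ILess (IConst 0) (IVar 4)) s2"
      then have Dpos: "0 < D" by (simp add: d2)
      note top = lanczos_top_rank_one[OF Dl D0 Dpos, folded p_def, folded x_def, folded V_def]
      obtain i0 j0 where ij0: "i0 < m" "j0 < n" "V i0 j0 \<noteq> 0" using top(1) by blast
      have eig: "achieves eig_com s2 (500 * M ^ 4) (\<lambda>s'. keeps s2 s' \<and>
        (\<forall>u<m. \<forall>v<n. rarr s' 21 u v = V u v))"
        unfolding V_def x_def
        by (rule achieves_eig_com[OF d2 p2 B2 G2]) (use k2 r M DM in auto)
      show "achieves (Seq eig_com (Seq pick_com store_com)) s2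
        (500 * M ^ 4 + (200 * M ^ 3 + 200 * M ^ 3)) ?Q"
      proof (rule achieves_Seq[OF eig])
        fix s3 :: store assume s3: "keeps s2 s3 \<and> (\<forall>u<m. \<forall>v<n. rarr s3 21 u v = V u v)"
        then have k3: "ireg s3 x = ireg s x" if "x \<notin> {4, 5, 6}" for x
          using k2[OF that] that by (simp add: keeps_def)
        have pick: "achieves pick_com s3 (200 * M ^ 3) (\<lambda>s'. keeps s3 s' \<and> rarr s' 21 = rarr s3 21 \<and>
            ireg s' 6 < m \<and> 0 < rarr s' 14 (ireg s' 6) 0 \<and>
            rarr s' 14 (ireg s' 6) 0 = dotp n (rarr s3 21 (ireg s' 6)) (rarr s3 21 (ireg s' 6)))"
          by (rule achieves_pick_com[OF ij0(1,2)]) (use s3 ij0 k3 r M in auto)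
        show "achieves (Seq pick_com store_com) s3 (200 * M ^ 3 + 200 * M ^ 3) ?Q"
        proof (rule achieves_Seq[OF pick])
          fix s4 :: store assume s4: "keeps s3 s4 \<and> rarr s4 21 = rarr s3 21 \<and>
            ireg s4 6 < m \<and> 0 < rarr s4 14 (ireg s4 6) 0 \<and>
            rarr s4 14 (ireg s4 6) 0 = dotp n (rarr s3 21 (ireg s4 6)) (rarr s3 21 (ireg s4 6))"
          have k4: "ireg s4 x = ireg s x" if "x \<notin> {4, 5, 6}" for x
            using k3[OF that] s4 that by (simp add: keeps_def)
          have a4: "rarr s4 a = rarr s a" if "a < 5" for a
            using a2[OF that] s3 s4 that by (simp add: keeps_def)
          have B4: "rarr s4 6 i j = B i j" if "i < m" "j < n" for i j
            using B2[OF that] s3 s4 by (simp add: keeps_def)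
          define w where "w = ireg s4 6"
          have w: "w < m" using s4 by (simp add: w_def)
          have Vw: "rarr s4 21 w j = V w j" if "j < n" for j using s3 s4 w that by simp
          have N: "rarr s4 14 w 0 = dotp n (V w) (V w)"
            using s3 s4 w by (simp add: w_def dotp_def)
          have Npos: "dotp n (V w) (V w) \<noteq> 0" using s4 N by (simp add: w_def)
          have By: "mvec n (rarr s4 6) (rarr s4 21 w) i = mvec n B (V w) i" if "i < m" for i
            using that by (simp add: mvec_def B4 Vw)
          have r4: "ireg s4 0 = m" "ireg s4 1 = n" "ireg s4 3 = k"
            by (simp_all add: k4 m_def n_def k_def)
          show "achieves store_com s4 (200 * M ^ 3) ?Q"
          proof (rule achieves_mono[OF achieves_store_com[of s4 M, unfolded r4 w_def[symmetric]] order_refl])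
            fix s' :: store assume s': "ireg s' = ireg s4 \<and>
              (\<forall>a. a \<notin> {3, 4} \<longrightarrow> rarr s' a = rarr s4 a) \<and>
              (\<forall>i l. l \<noteq> k \<longrightarrow> rarr s' 3 i l = rarr s4 3 i l \<and> rarr s' 4 i l = rarr s4 4 i l) \<and>
              (\<forall>j<n. rarr s' 4 j k = rarr s4 21 w j) \<and>
              (\<forall>i<m. rarr s' 3 i k = mvec n (rarr s4 6) (rarr s4 21 w) i / rarr s4 14 w 0)"
            have X: "rarr s' 3 i k = mvec n B (V w) i / dotp n (V w) (V w)" if "i < m" for i
              using s' that by (simp add: By N)
            have Y: "rarr s' 4 j k = V w j" if "j < n" for j using s' that by (simp add: Vw)
            have "top_rank_one m n B (\<lambda>i. rarr s' 3 i k) (\<lambda>j. rarr s' 4 j k)"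
              using top(2)[OF _ w Npos] by (subst top_rank_one_cong[OF refl X Y]) auto
            \<comment> \<open>A row outside the mask is zero in \<open>B\<close>, so the
              corresponding entry of B v is zero.\<close>
            moreover have "rarr s' 3 i k = 0" if "i < m" "rarr s 1 i k = 0" for i
              using that by (simp add: X mvec_def B_def)
            moreover have "rarr s' 4 j k = 0" if "j < n" "rarr s 2 j k = 0" for j
              using that w horner_V_zero_column[of m B j w n] by (simp add: Y V_def B_def)
            ultimately show "?Q s'" using s' k4 a4 by simp
          qed (use k4 r M in auto)
        qed
      qed
    next
      assume "\<not> bval (ILess (IConst 0) (IVar 4)) s2"
      \<comment> \<open>The residual is already zero on the support, and the column keeps its
        initial value 0.\<close>
      then have "D = 0" by (simp add: d2)
      then have B0: "B i j = 0" if "i < m" "j < n" for i j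
        using D0 that by (simp add: ip_self_eq_0)
      have top: "top_rank_one m n B (\<lambda>i. rarr s2 3 i k) (\<lambda>j. rarr s2 4 j k)"
        using top_rank_one_zero[OF B0] by (simp add: a2 z)
      have "?Q s2" using k2 a2 top z by simp
      then show "achieves Skip s2 (500 * M ^ 4 + (200 * M ^ 3 + 200 * M ^ 3)) ?Q"
        by (rule achieves_mono[OF achieves_Skip]) (use 1 in auto)
    qed
    then show ?thesis by (simp add: numeral_eq_Suc)
  qed
  have resid: "achieves resid_com s (300 * M ^ 3) (\<lambda>s1. ireg s1 = ireg s \<and>
      (\<forall>a. a \<notin> {5, 6, 7} \<longrightarrow> rarr s1 a = rarr s a) \<and>
      (\<forall>i<m. \<forall>j<n. rarr s1 6 i j = B i j) \<and> (\<forall>i<n. \<forall>j<n. rarr s1 7 i j = gram m B i j))"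
    unfolding m_def n_def k_def B_def
    by (rule achieves_resid_com) (use reg M in \<open>auto simp: m_def n_def k_def\<close>)
  have "achieves column_com s (300 * M ^ 3 + (3000 * M ^ 4 +
      (4 + (500 * M ^ 4 + (200 * M ^ 3 + 200 * M ^ 3))))) ?Q"
    unfolding column_com_def
  proof (rule achieves_Seq[OF resid])
    fix s1 :: store assume s1: "ireg s1 = ireg s \<and>
      (\<forall>a. a \<notin> {5, 6, 7} \<longrightarrow> rarr s1 a = rarr s a) \<and>
      (\<forall>i<m. \<forall>j<n. rarr s1 6 i j = B i j) \<and> (\<forall>i<n. \<forall>j<n. rarr s1 7 i j = gram m B i j)"
    have lz: "achieves lanczos_com s1 (3000 * M ^ 4)
        (\<lambda>s'. keeps s1 s' \<and> lz_state m n (gram m B) B D s')"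
      by (rule achieves_lanczos_com[OF _ _ _ _ _ _ _ M(1,2) DM Dl D0]) (use s1 r in auto)
    show "achieves (Seq lanczos_com (Cond (ILess (IConst 0) (IVar 4))
        (Seq eig_com (Seq pick_com store_com)) Skip)) s1
      (3000 * M ^ 4 + (4 + (500 * M ^ 4 + (200 * M ^ 3 + 200 * M ^ 3)))) ?Q"
      by (rule achieves_Seq[OF lz]) (use branch[of s1] s1 in auto)
  qed
  then show ?thesis by (rule achieves_mono) (use K 1 in auto)
qed

section \<open>The loop over all columns\<close>

definition fsmf_com :: com where
  "fsmf_com = for_loop 3 (IVar 2) column_com"

text \<open>The residual of column \<open>l\<close> depends only on the columns below
  \<open>l\<close>, so the statements about finished columns survive later writes. Columns from
  \<open>k\<close> on are still 0, which is the right value if their residual vanishes.\<close>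

definition greedy_state where
  "greedy_state m n r I J (s0 :: store) k (s :: store) \<longleftrightarrow>
    ireg s 0 = m \<and> ireg s 1 = n \<and> ireg s 2 = r \<and> ireg s 3 = k \<and>
    ireg s 10 = 0 \<and> ireg s 11 = 0 \<and> ireg s 12 = 0 \<and>
    rarr s 0 = rarr s0 0 \<and> rarr s 1 = rarr s0 1 \<and> rarr s 2 = rarr s0 2 \<and>
    (\<forall>l\<ge>k. \<forall>i. rarr s 3 i l = 0 \<and> rarr s 4 i l = 0) \<and>
    (\<forall>l<k. top_rank_one m n (masked_residual (rarr s 0) I J (rarr s 3) (rarr s 4) l)
        (\<lambda>i. rarr s 3 i l) (\<lambda>j. rarr s 4 j l) \<and>
      (\<forall>i<m. (i, l) \<notin> I \<longrightarrow> rarr s 3 i l = 0) \<and> (\<forall>j<n. (j, l) \<notin> J \<longrightarrow> rarr s 4 j l = 0))"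

lemma masked_residual_cong:
  assumes "\<And>i l. l < k \<Longrightarrow> X i l = X' i l" "\<And>j l. l < k \<Longrightarrow> Y j l = Y' j l"
  shows "masked_residual A I J X Y k = masked_residual A I J X' Y' k"
  using assms by (auto simp: masked_residual_def fun_eq_iff)

lemma achieves_fsmf_com:
  assumes s0: "ireg s0 0 = m" "ireg s0 1 = n" "ireg s0 2 = r"
      "ireg s0 10 = 0" "ireg s0 11 = 0" "ireg s0 12 = 0"
      "\<And>i k. rarr s0 1 i k = (if (i, k) \<in> I then 1 else 0)"
      "\<And>j k. rarr s0 2 j k = (if (j, k) \<in> J then 1 else 0)"
      "\<And>i k. rarr s0 3 i k = 0" "\<And>j k. rarr s0 4 j k = 0"
    and M: "m < M" "n < M" "r < M" "m * n + 2 < M"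
  shows "achieves fsmf_com s0 (7000 * M ^ 5) (\<lambda>s. \<forall>k<r.
    top_rank_one m n (masked_residual (rarr s0 0) I J (rarr s 3) (rarr s 4) k)
        (\<lambda>i. rarr s 3 i k) (\<lambda>j. rarr s 4 j k) \<and>
    (\<forall>i<m. (i, k) \<notin> I \<longrightarrow> rarr s 3 i k = 0) \<and> (\<forall>j<n. (j, k) \<notin> J \<longrightarrow> rarr s 4 j k = 0))"
    (is "achieves _ _ _ ?Q")
proof -
  let ?Inv = "greedy_state m n r I J s0"
  have "achieves fsmf_com s0 (r * (6000 * M ^ 4 + 7 + icost (IVar 2)) + icost (IVar 2) + 7) ?Q"
    unfolding fsmf_com_def
  proof (rule achieves_for_loop[where Inv = ?Inv])
    show "?Inv 0 (s0\<lparr>ireg := (ireg s0)(3 := 0)\<rparr>)" using s0 by (simp add: greedy_state_def)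
  next
    fix k :: nat and s :: store assume "?Inv k s"
    then show "ireg s 3 = k \<and> ival (IVar 2) s = r" by (simp add: greedy_state_def)
  next
    fix s :: store assume "?Inv r s"
    then show "?Q (s\<lparr>ireg := (ireg s)(3 := 0)\<rparr>)" by (auto simp: greedy_state_def)
  next
    fix k :: nat and s :: store assume k: "k < r" and I: "?Inv k s"
    have reg: "ireg s 0 = m" "ireg s 1 = n" "ireg s 3 = k"
      "ireg s 10 = 0" "ireg s 11 = 0" "ireg s 12 = 0" and r2: "ireg s 2 = r"
      and a: "rarr s 0 = rarr s0 0" "rarr s 1 = rarr s0 1" "rarr s 2 = rarr s0 2"
      and z: "\<And>l i. k \<le> l \<Longrightarrow> rarr s 3 i l = 0" "\<And>l i. k \<le> l \<Longrightarrow> rarr s 4 i l = 0"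
      and prev: "\<And>l. l < k \<Longrightarrow>
        top_rank_one m n (masked_residual (rarr s 0) I J (rarr s 3) (rarr s 4) l)
          (\<lambda>i. rarr s 3 i l) (\<lambda>j. rarr s 4 j l) \<and>
        (\<forall>i<m. (i, l) \<notin> I \<longrightarrow> rarr s 3 i l = 0) \<and> (\<forall>j<n. (j, l) \<notin> J \<longrightarrow> rarr s 4 j l = 0)"
      using I by (auto simp: greedy_state_def)
    \<comment> \<open>Multiplication by the two 0/1 indicators is the mask by the rank-one
      support.\<close>
    have B: "(\<lambda>i j. (rarr s 0 i j - (\<Sum>l<k. rarr s 3 i l * rarr s 4 j l)) * (rarr s 1 i k * rarr s 2 j k))
        = masked_residual (rarr s 0) I J (rarr s 3) (rarr s 4) k"
      unfolding a(2,3) s0(7,8) by (simp add: masked_residual_def in_rank_one_supp fun_eq_iff)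
    show "achieves column_com s (6000 * M ^ 4)
      (\<lambda>s'. ireg s' 3 = k \<and> ?Inv (Suc k) (s'\<lparr>ireg := (ireg s')(3 := Suc k)\<rparr>))"
    proof (rule achieves_mono[OF achieves_column_com[of s M, unfolded reg B] order_refl])
      fix s' :: store assume s': "(\<forall>x. x \<notin> {4, 5, 6} \<longrightarrow> ireg s' x = ireg s x) \<and>
        rarr s' 0 = rarr s 0 \<and> rarr s' 1 = rarr s 1 \<and> rarr s' 2 = rarr s 2 \<and>
        (\<forall>i l. l \<noteq> k \<longrightarrow> rarr s' 3 i l = rarr s 3 i l \<and> rarr s' 4 i l = rarr s 4 i l) \<and>
        top_rank_one m n (masked_residual (rarr s 0) I J (rarr s 3) (rarr s 4) k)
          (\<lambda>i. rarr s' 3 i k) (\<lambda>j. rarr s' 4 j k) \<and>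
        (\<forall>i<m. rarr s 1 i k = 0 \<longrightarrow> rarr s' 3 i k = 0) \<and>
        (\<forall>j<n. rarr s 2 j k = 0 \<longrightarrow> rarr s' 4 j k = 0)"
      have res: "masked_residual (rarr s 0) I J (rarr s' 3) (rarr s' 4) l
          = masked_residual (rarr s 0) I J (rarr s 3) (rarr s 4) l" if "l \<le> k" for l
        by (rule masked_residual_cong) (use s' that in auto)
      have fin: "top_rank_one m n (masked_residual (rarr s' 0) I J (rarr s' 3) (rarr s' 4) l)
          (\<lambda>i. rarr s' 3 i l) (\<lambda>j. rarr s' 4 j l) \<and>
        (\<forall>i<m. (i, l) \<notin> I \<longrightarrow> rarr s' 3 i l = 0) \<and> (\<forall>j<n. (j, l) \<notin> J \<longrightarrow> rarr s' 4 j l = 0)"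
        if "l < Suc k" for l
      proof (cases "l = k")
        case True
        then show ?thesis using s' res[of k] by (simp add: a s0 del: One_nat_def)
      next
        case False
        then show ?thesis using s' res[of l] prev[of l] that by simp
      qed
      have z': "rarr s' 3 i l = 0 \<and> rarr s' 4 i l = 0" if "Suc k \<le> l" for i l
        using s' z[of l i] that by simp
      show "ireg s' 3 = k \<and> ?Inv (Suc k) (s'\<lparr>ireg := (ireg s')(3 := Suc k)\<rparr>)"
        using s' reg r2 a fin z' by (simp add: greedy_state_def)
    qed (use k M reg z in auto)
  qed
  then show ?thesis
  proof (rule achieves_mono)
    have 1: "1 \<le> M ^ 4" using M by simp
    have "r * (6000 * M ^ 4 + 7 + icost (IVar 2)) \<le> r * (7000 * M ^ 4)"
      using 1 by (intro mult_left_mono) auto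
    moreover have "(r + 1) * (7000 * M ^ 4) \<le> M * (7000 * M ^ 4)"
      using M by (intro mult_right_mono) auto
    moreover have "M * (7000 * M ^ 4) = 7000 * M ^ 5" by (simp add: power_numeral_reduce)
    moreover have "(r + 1) * (7000 * M ^ 4) = r * (7000 * M ^ 4) + 7000 * M ^ 4" by simp
    ultimately show "r * (6000 * M ^ 4 + 7 + icost (IVar 2)) + icost (IVar 2) + 7 \<le> 7000 * M ^ 5"
      using 1 unfolding icost.simps by linarith
  qed
qed

section \<open>Passage to matrices and the polynomial bound\<close>

lemma fsmf_loss_eq_fro:
  assumes "A \<in> carrier_mat m n" "X \<in> carrier_mat m r" "Y \<in> carrier_mat n r"
  shows "fsmf_loss A X Y
    = fro m n (\<lambda>i j. A $$ (i, j) - (\<Sum>k<r. X $$ (i, k) * Y $$ (j, k)))"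
proof -
  have "fsmf_loss A X Y = (\<Sum>i<m. \<Sum>j<n. ((A - X * transpose_mat Y) $$ (i, j))\<^sup>2)"
    using assms by (simp add: fsmf_loss_def frob_norm_def sum_nonneg)
  also have "\<dots> = fro m n (\<lambda>i j. A $$ (i, j) - (\<Sum>k<r. X $$ (i, k) * Y $$ (j, k)))"
    unfolding fro_def using assms
    by (intro sum.cong refl) (auto simp: scalar_prod_def lessThan_atLeast0 intro!: arg_cong[of _ _ "\<lambda>x. x\<^sup>2"] sum.cong)
  finally show ?thesis .
qed

theorem theorem3p3:
  shows "fsmf_tractable
    {(m, n, r, A, I, J).
       A \<in> carrier_mat m n \<and> I \<subseteq> {..<m} \<times> {..<r} \<and> J \<subseteq> {..<n} \<times> {..<r} \<and>
       disjoint_family_on (class_supp I J) (supp_classes r I J)}"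
proof -
  \<comment> \<open>The value is 7000 M^5, with \<open>M\<close> the square defined below; hence the
    exponent 10.\<close>
  let ?p = "[:7000:] * [:2, 1:] ^ 10 :: nat poly"
  have "\<exists>t s. exec fsmf_com (fsmf_input m n r A I J) t s \<and> t \<le> poly ?p (m + n + r) \<and>
      fsmf_optimal m n r A I J (read_mat s 3 m r) (read_mat s 4 n r)"
    if A: "A \<in> carrier_mat m n" and disj: "disjoint_family_on (class_supp I J) (supp_classes r I J)"
    for m n r A I J
  proof -
    define s0 where "s0 = fsmf_input m n r A I J"
    \<comment> \<open>Squaring makes \<open>M\<close> exceed m n + 2, as the bound m n on the number
      of Lanczos steps demands.\<close>
    define M where "M = (m + n + r + 2)\<^sup>2"
    \<comment> \<open>The extension of \<open>A\<close> by 0 is literally what the input store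
      contains.\<close>
    define A' where "A' = (\<lambda>i j. if i < m \<and> j < n then A $$ (i, j) else 0)"
    have M: "m < M" "n < M" "r < M" "m * n + 2 < M"
      by (simp_all add: M_def power2_eq_square algebra_simps)
    have A0: "rarr s0 0 = A'" by (simp add: s0_def fsmf_input_def A'_def)
    have "achieves fsmf_com s0 (7000 * M ^ 5) (\<lambda>s. \<forall>k<r.
      top_rank_one m n (masked_residual (rarr s0 0) I J (rarr s 3) (rarr s 4) k)
        (\<lambda>i. rarr s 3 i k) (\<lambda>j. rarr s 4 j k) \<and>
      (\<forall>i<m. (i, k) \<notin> I \<longrightarrow> rarr s 3 i k = 0) \<and> (\<forall>j<n. (j, k) \<notin> J \<longrightarrow> rarr s 4 j k = 0))"
      by (rule achieves_fsmf_com) (use M in \<open>simp_all add: s0_def fsmf_input_def\<close>)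
    then obtain t s where e: "exec fsmf_com s0 t s" "t \<le> 7000 * M ^ 5" and
      s: "\<And>k. k < r \<Longrightarrow> top_rank_one m n (masked_residual A' I J (rarr s 3) (rarr s 4) k)
        (\<lambda>i. rarr s 3 i k) (\<lambda>j. rarr s 4 j k)"
        "\<And>i k. i < m \<Longrightarrow> k < r \<Longrightarrow> (i, k) \<notin> I \<Longrightarrow> rarr s 3 i k = 0"
        "\<And>j k. j < n \<Longrightarrow> k < r \<Longrightarrow> (j, k) \<notin> J \<Longrightarrow> rarr s 4 j k = 0"
      unfolding achieves_def A0 by blast
    let ?X = "read_mat s 3 m r" and ?Y = "read_mat s 4 n r"
    have feas: "fsmf_feasible m n r I J ?X ?Y"
      by (auto simp: fsmf_feasible_def read_mat_def mat_supp_def) (use s(2,3) in blast)+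
    have opt: "fsmf_loss A ?X ?Y \<le> fsmf_loss A X' Y'" if "fsmf_feasible m n r I J X' Y'" for X' Y'
    proof -
      have c: "X' \<in> carrier_mat m r" "Y' \<in> carrier_mat n r" "mat_supp X' \<subseteq> I" "mat_supp Y' \<subseteq> J"
        using that by (auto simp: fsmf_feasible_def)
      have X0: "X' $$ (i, k) = 0" if "i < m" "k < r" "(i, k) \<notin> I" for i k
        using c that by (auto simp: mat_supp_def)
      have Y0: "Y' $$ (j, k) = 0" if "j < n" "k < r" "(j, k) \<notin> J" for j k
        using c that by (auto simp: mat_supp_def)
      have "fro m n (\<lambda>i j. A' i j - (\<Sum>k<r. rarr s 3 i k * rarr s 4 j k))
          \<le> fro m n (\<lambda>i j. A' i j - (\<Sum>k<r. X' $$ (i, k) * Y' $$ (j, k)))"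
        by (rule greedy_optimal[OF disj s(2) s(3) s(1)]) (auto simp: X0 Y0)
      moreover have "fsmf_loss A ?X ?Y = fro m n (\<lambda>i j. A' i j - (\<Sum>k<r. rarr s 3 i k * rarr s 4 j k))"
        by (subst fsmf_loss_eq_fro[OF A, where r = r])
           (auto simp: read_mat_def A'_def intro!: fro_cong)
      moreover have "fsmf_loss A X' Y' = fro m n (\<lambda>i j. A' i j - (\<Sum>k<r. X' $$ (i, k) * Y' $$ (j, k)))"
        by (subst fsmf_loss_eq_fro[OF A c(1,2)]) (auto simp: A'_def intro!: fro_cong)
      ultimately show ?thesis by simp
    qed
    have "fsmf_optimal m n r A I J ?X ?Y"
      unfolding fsmf_optimal_def is_arg_min_def using feas opt by (auto simp: not_less)
    moreover have "7000 * M ^ 5 = poly ?p (m + n + r)"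
      by (simp add: M_def power_mult[symmetric] add.commute)
    ultimately show ?thesis using e unfolding s0_def by auto
  qed
  then show ?thesis unfolding fsmf_tractable_def by blast
qed

end
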